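(* Let $\Gamma^-$ be a lower differential game satisfying the standing assumptions in the context, with a controlled system that is not Lipschitz continuous. Suppose that the uniform time estimate assumption (defined in the context) holds and that the payoff function $\ell$ is Lipschitz continuous in $x$ uniformly in $(a,b)$. The following assertions are equivalent: (i) for every bounded continuous function $\ell':\mathbb{R}^n\times A\times B\to\mathbb{R}$ which is Lipschitz continuous in $x$ uniformly in $(a,b)$ and $\mathbb{Z}^n$-periodic in $x$, the modified game with running payoff $\ell'$ (all other data being equal) is ergodic; (ii) for every Lipschitz continuous and $\mathbb{Z}^n$-periodic function $g:\mathbb{R}^n\to\mathbb{R}$, the perturbed game with running payoff $(x,a,b)\mapsto\ell(x,a,b)+g(x)$ is ergodic; (iii) the players do not have disjoint dominions in the torus, i.e. $\overline{\pi(D^1)}\cap\overline{\pi(D^2)}\neq\emptyset$ for every dominion $D^1$ of player 1 and every dominion $D^2$ of player 2 in $\Gamma^-$.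
   Context: Setting (standing assumptions). $A,B$ are nonempty compact metric spaces, $|\cdot|$ is the Euclidean norm. $f:\mathbb{R}^n\times A\times B\to\mathbb{R}^n$ is continuous, and there is $L_f\ge0$ with $|f(x,a,b)-f(y,a,b)|\le L_f|x-y|$ for all $x,y,a,b$. $\ell:\mathbb{R}^n\times A\times B\to\mathbb{R}$ is bounded and continuous, and there is a modulus of continuity $\omega_\ell$ (nondecreasing $[0,\infty)\to[0,\infty)$, vanishing and continuous at $0$) with $|\ell(x,a,b)-\ell(y,a,b)|\le\omega_\ell(|x-y|)$ for all $x,y,a,b$. Both $f$ and $\ell$ are $\mathbb{Z}^n$-periodic in $x$. A function $\ell$ is Lipschitz continuous in $x$ uniformly in $(a,b)$ if there is $L_\ell>0$ with $|\ell(x,a,b)-\ell(y,a,b)|\le L_\ell|x-y|$ for all $x,y,a,b$. $\mathscr{A}$ (resp. $\mathscr{B}$) is the set of Lebesgue measurable functions $[0,+\infty)\to A$ (resp. $B$), called controls of player 1 (resp. 2). For $x\in\mathbb{R}^n$, $a\in\mathscr{A}$, $b\in\mathscr{B}$, $X^{x,a,b}_t$ is the unique solution of $\dot X_t=f(X_t,a_t,b_t)$ for a.e. $t>0$, $X_0=x$. The controlled system is Lipschitz continuous if there is $L>0$ with $|X^{x,a,b}_t-X^{y,a,b}_t|\le L|x-y|$ for all $x,y\in\mathbb{R}^n$, $a\in\mathscr{A}$, $b\in\mathscr{B}$, $t\ge0$; if it is not, then in particular $L_f>0$. A nonanticipating strategy of player 1 is a map $\alpha:\mathscr{B}\to\mathscr{A}$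 such that for all $t>0$ and $b^1,b^2\in\mathscr{B}$, if $b^1_s=b^2_s$ for a.e. $s\le t$ then $\alpha[b^1]_s=\alpha[b^2]_s$ for a.e. $s\le t$; $\mathfrak{A}$ is the set of these. Write $X^{x,\alpha,b}_t=X^{x,\alpha[b],b}_t$. The lower game $\Gamma^-$ with running payoff $\ell$ has discounted value, for $\delta>0$, $$v_\delta(x)=\inf_{\alpha\in\mathfrak{A}}\sup_{b\in\mathscr{B}}\int_0^\infty e^{-\delta s}\ell(X^{x,\alpha,b}_s,\alpha[b]_s,b_s)\,ds .$$ The game is ergodic if $\delta v_\delta(x)$ converges uniformly in $x$ to a constant as $\delta\to0$. For $K\subset\mathbb{R}^n$, $\operatorname{dist}_K(x)=\inf_{y\in K}|y-x|$. A dominion of player 1 in $\Gamma^-$ is a nonempty closed set $D\subset\mathbb{R}^n$ such that for all $x\in D$, $\varepsilon>0$, $T\ge0$ there is $\alpha\in\mathfrak{A}$ such that for all $b\in\mathscr{B}$ and $t\in[0,T]$, $\operatorname{dist}_D(X^{x,\alpha,b}_t)\le\varepsilon$. A dominion of player 2 in $\Gamma^-$ is a nonempty closed set $D\subset\mathbb{R}^n$ such that for all $x\in D$, $\varepsilon>0$, $T\ge0$ and all $\alpha\in\mathfrak{A}$ there is $b\in\mathscr{B}$ such that for all $t\in[0,T]$, $\operatorname{dist}_D(X^{x,\alpha,b}_t)\le\varepsilon$. $\pi:\mathbb{R}^n\to\mathbb{R}^n/\mathbb{Z}^n$ is the quotient map; the overline denotes closure; a dominion in the torus of a player is a set $\overline{\pi(D)}$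 with $D$ a dominion of that player in $\Gamma^-$. Reachable sets. For $\alpha\in\mathfrak{A}$ and $x\in\mathbb{R}^n$, $R^1_\alpha(x)=\{X^{x,\alpha,b}_t: b\in\mathscr{B},\ t\ge0\}$. For a map $\mathfrak{A}\to\mathscr{B}$, $\alpha\mapsto b_\alpha$, and $x\in\mathbb{R}^n$, $R^2_{b_\cdot}(x)=\{X^{x,\alpha,b_\alpha}_t:\alpha\in\mathfrak{A},\ t\ge0\}$. The map $\alpha\mapsto b_\alpha$ is nonanticipating if, whenever $\alpha^1[b]_s=\alpha^2[b]_s$ for all $b\in\mathscr{B}$ and a.e. $s\in[0,t]$, one has $(b_{\alpha^1})_s=(b_{\alpha^2})_s$ for a.e. $s\in[0,t]$. Uniform time estimate assumption. There exist constants $\gamma\in[0,1)$ and $C>0$ such that, for all $\varepsilon\in(0,1)$: - for all $\alpha\in\mathfrak{A}$, all $x\in\mathbb{R}^n$ and all $y\in\overline{R^1_\alpha(x)}$, there are a control $b\in\mathscr{B}$ and a time $0\le t\le C(-\log\varepsilon)^\gamma$ with $|y-X^{x,\alpha,b}_t|\le\varepsilon$; - for every nonanticipating map $\mathfrak{A}\to\mathscr{B}$, $\alpha\mapsto b_\alpha$, all $x\in\mathbb{R}^n$ and all $y\in\overline{R^2_{b_\cdot}(x)}$, there are a strategy $\alpha\in\mathfrak{A}$ and a time $0\le t\le C(-\log\varepsilon)^\gamma$ with $|y-X^{x,\alpha,b_\alpha}_t|\le\varepsilon$. *)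

theory Defs
  imports "HOL-Analysis.Analysis"
begin

subsection \<open>Controls and trajectories\<close>

text \<open>The control sets of the two players are types \<open>'a\<close>, \<open>'b\<close> of class \<open>metric_space\<close>, whose
  compactness is assumed where needed. A control is a function on the whole real line of which only
  the values on \<open>[0, \<infinity>)\<close> matter: measurability and the differential equation ignore negative times,
  and nonanticipation makes \<open>\<alpha> b\<close> independent (almost everywhere) of \<open>b\<close> there.\<close>

definition controls :: "(real \<Rightarrow> 'c::topological_space) set" where
  "controls = borel_measurable (lebesgue_on {0..})"

definition abs_continuous_on_interval :: "real \<Rightarrow> real \<Rightarrow> (real \<Rightarrow> 'v::real_normed_vector) \<Rightarrow> bool" where
  "abs_continuous_on_interval p q X \<longleftrightarrow>
     (\<forall>\<epsilon>>0. \<exists>\<delta>>0. \<forall>I. finite I \<and> (\<forall>(s, t)\<in>I. p \<le> s \<and> s \<le> t \<and> t \<le> q) \<and>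
        pairwise (\<lambda>i j. {fst i<..<snd i} \<inter> {fst j<..<snd j} = {}) I \<and> (\<Sum>(s, t)\<in>I. t - s) < \<delta>
        \<longrightarrow> (\<Sum>(s, t)\<in>I. norm (X t - X s)) < \<epsilon>)"

text \<open>Solutions of the differential equation are meant in the sense of Caratheodory, hence the
  local absolute continuity.\<close>

definition is_trajectory ::
  "((real^'n) \<times> 'a \<times> 'b \<Rightarrow> real^'n) \<Rightarrow> real^'n \<Rightarrow> (real \<Rightarrow> 'a) \<Rightarrow> (real \<Rightarrow> 'b) \<Rightarrow> (real \<Rightarrow> real^'n) \<Rightarrow> bool"
  where
  "is_trajectory f x a b X \<longleftrightarrow>
     X 0 = x \<and> (\<forall>T\<ge>0. abs_continuous_on_interval 0 T X) \<and>
     (AE t in lebesgue. t > 0 \<longrightarrow> (X has_vector_derivative f (X t, a t, b t)) (at t))"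

text \<open>The equation determines a solution on \<open>[0, \<infinity>)\<close> only, so uniqueness holds up to values at
  negative times and \<open>SOME\<close> is used instead of \<open>THE\<close>. The trajectory is meaningful at times
  \<open>t \<ge> 0\<close> and only evaluated there.\<close>

definition traj ::
  "((real^'n) \<times> 'a \<times> 'b \<Rightarrow> real^'n) \<Rightarrow> real^'n \<Rightarrow> (real \<Rightarrow> 'a) \<Rightarrow> (real \<Rightarrow> 'b) \<Rightarrow> real \<Rightarrow> real^'n" where
  "traj f x a b = (SOME X. is_trajectory f x a b X)"

definition lipschitz_system ::
  "((real^'n) \<times> 'a::metric_space \<times> 'b::metric_space \<Rightarrow> real^'n) \<Rightarrow> bool" where
  "lipschitz_system f \<longleftrightarrow>
     (\<exists>L>0. \<forall>a\<in>controls. \<forall>b\<in>controls. \<forall>t\<ge>0. \<forall>x y.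
        norm (traj f x a b t - traj f y a b t) \<le> L * norm (x - y))"

subsection \<open>Strategies\<close>

definition strategies ::
  "((real \<Rightarrow> 'b::topological_space) \<Rightarrow> (real \<Rightarrow> 'a::topological_space)) set" where
  "strategies = {\<alpha> \<in> controls \<rightarrow> controls.
     \<forall>t>0. \<forall>b1\<in>controls. \<forall>b2\<in>controls.
       (AE s\<in>{0..t} in lebesgue. b1 s = b2 s) \<longrightarrow> (AE s\<in>{0..t} in lebesgue. \<alpha> b1 s = \<alpha> b2 s)}"

abbreviation straj ::
  "((real^'n) \<times> 'a::topological_space \<times> 'b::topological_space \<Rightarrow> real^'n) \<Rightarrow> real^'n \<Rightarrow>
   ((real \<Rightarrow> 'b) \<Rightarrow> (real \<Rightarrow> 'a)) \<Rightarrow> (real \<Rightarrow> 'b) \<Rightarrow> real \<Rightarrow> real^'n" where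
  "straj f x \<alpha> b \<equiv> traj f x (\<alpha> b) b"

definition nonanticipating_responses ::
  "(((real \<Rightarrow> 'b::topological_space) \<Rightarrow> (real \<Rightarrow> 'a::topological_space)) \<Rightarrow> (real \<Rightarrow> 'b)) set" where
  "nonanticipating_responses = {\<beta> \<in> strategies \<rightarrow> controls.
     \<forall>t\<ge>0. \<forall>\<alpha>1\<in>strategies. \<forall>\<alpha>2\<in>strategies.
       (\<forall>b\<in>controls. AE s\<in>{0..t} in lebesgue. \<alpha>1 b s = \<alpha>2 b s) \<longrightarrow>
       (AE s\<in>{0..t} in lebesgue. \<beta> \<alpha>1 s = \<beta> \<alpha>2 s)}"

subsection \<open>The lower game\<close>

definition lower_value ::
  "((real^'n) \<times> 'a::metric_space \<times> 'b::metric_space \<Rightarrow> real^'n) \<Rightarrow> ((real^'n) \<times> 'a \<times> 'b \<Rightarrow> real) \<Rightarrow>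
   real \<Rightarrow> real^'n \<Rightarrow> real" where
  "lower_value f l \<delta> x =
     (INF \<alpha>\<in>strategies. SUP b\<in>controls.
        LINT s:{0..}|lebesgue. exp (- (\<delta> * s)) * l (straj f x \<alpha> b s, \<alpha> b s, b s))"

definition ergodic ::
  "((real^'n) \<times> 'a::metric_space \<times> 'b::metric_space \<Rightarrow> real^'n) \<Rightarrow> ((real^'n) \<times> 'a \<times> 'b \<Rightarrow> real) \<Rightarrow> bool"
  where
  "ergodic f l \<longleftrightarrow>
     (\<exists>c. uniform_limit UNIV (\<lambda>\<delta> x. \<delta> * lower_value f l \<delta> x) (\<lambda>_. c) (at_right 0))"

definition dominion1 ::
  "((real^'n) \<times> 'a::metric_space \<times> 'b::metric_space \<Rightarrow> real^'n) \<Rightarrow> (real^'n) set \<Rightarrow> bool" where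
  "dominion1 f D \<longleftrightarrow> D \<noteq> {} \<and> closed D \<and>
     (\<forall>x\<in>D. \<forall>\<epsilon>>0. \<forall>T\<ge>0. \<exists>\<alpha>\<in>strategies. \<forall>b\<in>controls. \<forall>t\<in>{0..T}. infdist (straj f x \<alpha> b t) D \<le> \<epsilon>)"

definition dominion2 ::
  "((real^'n) \<times> 'a::metric_space \<times> 'b::metric_space \<Rightarrow> real^'n) \<Rightarrow> (real^'n) set \<Rightarrow> bool" where
  "dominion2 f D \<longleftrightarrow> D \<noteq> {} \<and> closed D \<and>
     (\<forall>x\<in>D. \<forall>\<epsilon>>0. \<forall>T\<ge>0. \<forall>\<alpha>\<in>strategies. \<exists>b\<in>controls. \<forall>t\<in>{0..T}. infdist (straj f x \<alpha> b t) D \<le> \<epsilon>)"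

definition reach1 ::
  "((real^'n) \<times> 'a::metric_space \<times> 'b::metric_space \<Rightarrow> real^'n) \<Rightarrow>
   ((real \<Rightarrow> 'b) \<Rightarrow> (real \<Rightarrow> 'a)) \<Rightarrow> real^'n \<Rightarrow> (real^'n) set" where
  "reach1 f \<alpha> x = {straj f x \<alpha> b t |b t. b \<in> controls \<and> t \<ge> 0}"

definition reach2 ::
  "((real^'n) \<times> 'a::metric_space \<times> 'b::metric_space \<Rightarrow> real^'n) \<Rightarrow>
   (((real \<Rightarrow> 'b) \<Rightarrow> (real \<Rightarrow> 'a)) \<Rightarrow> (real \<Rightarrow> 'b)) \<Rightarrow> real^'n \<Rightarrow> (real^'n) set" where
  "reach2 f \<beta> x = {straj f x \<alpha> (\<beta> \<alpha>) t |\<alpha> t. \<alpha> \<in> strategies \<and> t \<ge> 0}"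

definition uniform_time_estimate ::
  "((real^'n) \<times> 'a::metric_space \<times> 'b::metric_space \<Rightarrow> real^'n) \<Rightarrow> bool" where
  "uniform_time_estimate f \<longleftrightarrow>
     (\<exists>\<gamma> C. 0 \<le> \<gamma> \<and> \<gamma> < 1 \<and> C > 0 \<and> (\<forall>\<epsilon>. 0 < \<epsilon> \<and> \<epsilon> < 1 \<longrightarrow>
        (\<forall>\<alpha>\<in>strategies. \<forall>x. \<forall>y\<in>closure (reach1 f \<alpha> x).
           \<exists>b\<in>controls. \<exists>t. 0 \<le> t \<and> t \<le> C * (- ln \<epsilon>) powr \<gamma> \<and> norm (y - straj f x \<alpha> b t) \<le> \<epsilon>) \<and>
        (\<forall>\<beta>\<in>nonanticipating_responses. \<forall>x. \<forall>y\<in>closure (reach2 f \<beta> x).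
           \<exists>\<alpha>\<in>strategies. \<exists>t. 0 \<le> t \<and> t \<le> C * (- ln \<epsilon>) powr \<gamma> \<and>
             norm (y - straj f x \<alpha> (\<beta> \<alpha>) t) \<le> \<epsilon>)))"

subsection \<open>Periodicity and the torus\<close>

definition int_lattice :: "(real^'n) set" where
  "int_lattice = {z. \<forall>i. z $ i \<in> \<int>}"

definition periodic_in_state :: "((real^'n) \<times> 'a \<times> 'b \<Rightarrow> 'v) \<Rightarrow> bool" where
  "periodic_in_state F \<longleftrightarrow> (\<forall>x a b. \<forall>z\<in>int_lattice. F (x + z, a, b) = F (x, a, b))"

definition lipschitz_in_state :: "((real^'n) \<times> 'a \<times> 'b \<Rightarrow> 'v::metric_space) \<Rightarrow> bool" where
  "lipschitz_in_state F \<longleftrightarrow> (\<exists>L>0. \<forall>a b. L-lipschitz_on UNIV (\<lambda>x. F (x, a, b)))"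

definition modulus_of_continuity :: "(real \<Rightarrow> real) \<Rightarrow> bool" where
  "modulus_of_continuity \<omega> \<longleftrightarrow>
     mono_on {0..} \<omega> \<and> (\<forall>r\<ge>0. \<omega> r \<ge> 0) \<and> \<omega> 0 = 0 \<and> continuous (at 0 within {0..}) \<omega>"

text \<open>Points of the torus are the cosets of the integer lattice, and the torus carries the quotient
  topology (see \<open>quotient_map_torus\<close>).\<close>

definition torus_proj :: "real^'n \<Rightarrow> (real^'n) set" where
  "torus_proj x = {y. y - x \<in> int_lattice}"

definition torus_topology :: "(real^'n) set topology" where
  "torus_topology = topology (\<lambda>U. U \<subseteq> range torus_proj \<and> open (torus_proj -` U))"

lemma openin_torus_topology:
  fixes U :: "(real^'n) set set"
  shows "openin torus_topology U \<longleftrightarrow> U \<subseteq> range torus_proj \<and> open (torus_proj -` U)"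
proof -
  have "istopology (\<lambda>U::(real^'n) set set. U \<subseteq> range torus_proj \<and> open (torus_proj -` U))"
    unfolding istopology_def vimage_Int vimage_Union
    by (intro conjI allI impI open_Int open_UN) blast+
  then show ?thesis
    unfolding torus_topology_def by simp
qed

lemma topspace_torus_topology: "topspace torus_topology = range (torus_proj :: real^'n \<Rightarrow> _)"
proof
  show "topspace torus_topology \<subseteq> range (torus_proj :: real^'n \<Rightarrow> _)"
    using openin_topspace[of torus_topology] unfolding openin_torus_topology by blast
  have "torus_proj -` range torus_proj = (UNIV :: (real^'n) set)"
    by blast
  then have "openin torus_topology (range (torus_proj :: real^'n \<Rightarrow> _))"
    unfolding openin_torus_topology by simp
  then show "range (torus_proj :: real^'n \<Rightarrow> _) \<subseteq> topspace torus_topology"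
    by (rule openin_subset)
qed

lemma quotient_map_torus: "quotient_map euclidean torus_topology torus_proj"
  unfolding quotient_map_def topspace_torus_topology openin_torus_topology
  by (simp add: vimage_def)

lemma torus_proj_eq_iff: "torus_proj x = torus_proj y \<longleftrightarrow> x - y \<in> int_lattice"
proof
  assume "torus_proj x = torus_proj y"
  moreover have "x \<in> torus_proj x"
    by (simp add: torus_proj_def int_lattice_def)
  ultimately show "x - y \<in> int_lattice"
    by (simp add: torus_proj_def)
next
  assume "x - y \<in> int_lattice"
  then have *: "x $ i - y $ i \<in> \<int>" for i
    by (simp add: int_lattice_def)
  have "z $ i - x $ i \<in> \<int> \<longleftrightarrow> z $ i - y $ i \<in> \<int>" for z i
    using Ints_add[OF _ *[of i], of "z $ i - x $ i"] Ints_diff[OF _ *[of i], of "z $ i - y $ i"]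
    by auto
  then show "torus_proj x = torus_proj y"
    by (simp add: torus_proj_def int_lattice_def)
qed

definition in_torus :: "(real^'n) set \<Rightarrow> (real^'n) set set" where
  "in_torus D = torus_topology closure_of (torus_proj ` D)"

end

theory Submission
  imports Defs
begin

text \<open>
  The implication from arbitrary payoffs to perturbations of \<open>l\<close> is immediate, because \<open>l + g\<close> is
  itself an admissible payoff. The other two implications rest on the following ideas.

  \<^emph>\<open>Ergodicity excludes disjoint dominions.\<close> If the closures of two dominions in the torus are
  disjoint, the sum of the periodic distances to them is bounded below by some \<open>m > 0\<close>
  (\<open>lattice_dist_gap\<close>). A large multiple \<open>g\<close> of the difference of these two distances makes \<open>l + g\<close>
  very negative near the dominion of player 1 and very positive near the dominion of player 2. Each
  player can stay near its own dominion for as long as the discount factor matters, so \<open>\<delta> v\<^sub>\<delta>\<close> takes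
  values separated by a fixed gap for all \<open>\<delta>\<close> (\<open>not_ergodic_if_separated\<close>).

  \<^emph>\<open>Intersecting dominions force ergodicity.\<close> For \<open>\<mu> \<le> \<delta>\<close> the dynamic programming principle gives
  \<open>sup \<mu> v\<^sub>\<mu> \<le> sup \<delta> v\<^sub>\<delta>\<close> and \<open>inf \<delta> v\<^sub>\<delta> \<le> inf \<mu> v\<^sub>\<mu>\<close> (\<open>hi_mono\<close>, \<open>lo_mono\<close>), so it suffices that the
  oscillation of \<open>\<delta> v\<^sub>\<delta>\<close> tends to \<open>0\<close>. Start player 1 at a point where \<open>\<delta> v\<^sub>\<delta>\<close> is almost minimal and
  let this player use an almost optimal strategy: along every trajectory \<open>\<delta> v\<^sub>\<delta>\<close> grows by at most
  \<open>O(\<delta> t)\<close> (\<open>low_value_persists\<close>). By the time estimate, every point of the closed reachable set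
  is within \<open>\<epsilon>\<close> of a point reached before \<open>C (- ln \<epsilon>)\<^sup>\<gamma>\<close>. On the other hand \<open>\<delta> v\<^sub>\<delta>\<close> varies little over
  distances \<open>\<epsilon> = exp (- p / \<delta>)\<close> with a constant \<open>p\<close> (\<open>val_close\<close>), and for this choice the time
  \<open>C (p / \<delta>)\<^sup>\<gamma>\<close> is negligible with respect to \<open>1 / \<delta>\<close> exactly because \<open>\<gamma> < 1\<close>. Hence \<open>\<delta> v\<^sub>\<delta>\<close> is almost
  minimal on the whole closed reachable set, which is a dominion of player 1
  (\<open>dominion1_closure_reach1\<close>). If player 2 has a nonanticipating response that keeps \<open>\<delta> v\<^sub>\<delta>\<close> almost
  maximal in the same way, its closed reachable set is a dominion of player 2. The two dominions come
  arbitrarily close to each other modulo the lattice, so the maximum and the minimum of \<open>\<delta> v\<^sub>\<delta>\<close>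
  almost coincide.

  The response of player 2 is the delicate point, since near-optimal controls against the various
  strategies have to be chosen in a nonanticipating way. It is built as a sampled feedback, by
  extremal aiming in the sense of Krasovskii and Subbotin: with
  \<open>V x = sup\<^sub>y (v\<^sub>\<delta> y - |x - y|\<^sup>2 / 2\<sigma>)\<close> and an almost optimal \<open>y\<close>, player 2 applies during a short
  step a constant control that is almost optimal in the static game with payoff \<open>q \<bullet> f + l\<close>,
  \<open>q = (y - x) / \<sigma>\<close>. Comparing with a fictitious trajectory from \<open>y\<close>, on which player 1 answers
  instantaneously and almost optimally, shows that \<open>V\<close> loses only a small multiple of the step length
  (\<open>aiming_step\<close>, \<open>feedback_step\<close>).

  The trajectories themselves require Caratheodory's existence and uniqueness theory, which is derived
  from the integral equation.
\<close>

section \<open>Absolutely continuous functions and indefinite integrals\<close>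

text \<open>The classical argument uses the Vitali covering theorem; with gauge integrals a direct estimate is
  possible. Tags at points of differentiability are handled as in the fundamental theorem of calculus.
  The remaining tags lie in a null set, which the gauge encloses in an open set of small measure, so
  the intervals that belong to them have small total length and absolute continuity applies.\<close>

lemma ftc_absolutely_continuous:
  fixes X :: "real \<Rightarrow> 'v::euclidean_space"
  assumes "p \<le> q" and ac: "abs_continuous_on_interval p q X" and "negligible N"
    and deriv: "\<And>t. t \<in> {p..q} - N \<Longrightarrow> (X has_vector_derivative g t) (at t)"
  shows "(g has_integral (X q - X p)) {p..q}"
proof -
  define g' where "g' = (\<lambda>t. if t \<in> N then 0 else g t)"
  have "(g' has_integral (X q - X p)) {p..q}"
    unfolding has_integral_real
  proof (intro allI impI)
    fix e :: real assume "e > 0"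
    define e1 where "e1 = e / (2 * (q - p + 1))"
    have "e1 > 0" using \<open>e > 0\<close> \<open>p \<le> q\<close> by (simp add: e1_def)
    have e1: "e1 * (q - p) \<le> e / 2"
    proof -
      have "e1 * (q - p) \<le> e1 * (q - p + 1)" using \<open>e1 > 0\<close> by simp
      also have "\<dots> = e / 2" using \<open>p \<le> q\<close> by (simp add: e1_def field_simps)
      finally show ?thesis .
    qed
    have "e / 2 > 0" using \<open>e > 0\<close> by simp
    with ac obtain \<delta> where "\<delta> > 0" and \<delta>: "\<forall>I. finite I \<and> (\<forall>(s, t)\<in>I. p \<le> s \<and> s \<le> t \<and> t \<le> q) \<and>
        pairwise (\<lambda>i j. {fst i<..<snd i} \<inter> {fst j<..<snd j} = {}) I \<and> (\<Sum>(s, t)\<in>I. t - s) < \<delta>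
        \<longrightarrow> (\<Sum>(s, t)\<in>I. norm (X t - X s)) < e / 2"
      unfolding abs_continuous_on_interval_def by blast
    have "N \<in> sets lebesgue" and emN: "emeasure lebesgue N = 0"
      using \<open>negligible N\<close> by (auto simp: negligible_iff_null_sets null_sets_def)
    obtain U where "open U" "N \<subseteq> U" "(U - N) \<in> lmeasurable" and U: "emeasure lebesgue (U - N) < ennreal \<delta>"
      using sets_lebesgue_outer_open[OF \<open>N \<in> sets lebesgue\<close> \<open>\<delta> > 0\<close>] by metis
    have Ueq: "emeasure lebesgue U = emeasure lebesgue (U - N)"
      using \<open>N \<in> sets lebesgue\<close> emN \<open>open U\<close> by (intro emeasure_Diff_null_set[symmetric]) (auto simp: null_sets_def)
    then have Ulm: "U \<in> lmeasurable"
      using U \<open>open U\<close> by (auto simp: fmeasurable_def intro: less_trans)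
    have mU: "measure lebesgue U < \<delta>"
    proof -
      have "ennreal (measure lebesgue U) < ennreal \<delta>"
        using U unfolding Ueq[symmetric] emeasure_eq_measure2[OF Ulm] .
      then show ?thesis by (simp add: ennreal_less_iff)
    qed
    have "\<forall>x. \<exists>d>0. x \<in> {p..q} - N \<longrightarrow>
         (\<forall>y. norm (y - x) < d \<longrightarrow> norm (X y - X x - (y - x) *\<^sub>R g x) \<le> e1 * norm (y - x))"
    proof
      fix x
      show "\<exists>d>0. x \<in> {p..q} - N \<longrightarrow>
         (\<forall>y. norm (y - x) < d \<longrightarrow> norm (X y - X x - (y - x) *\<^sub>R g x) \<le> e1 * norm (y - x))"
      proof (cases "x \<in> {p..q} - N")
        case True
        from deriv[OF True] \<open>e1 > 0\<close> show ?thesis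
          unfolding has_vector_derivative_def has_derivative_at_alt by blast
      qed (auto intro: exI[of _ 1])
    qed
    then obtain d where d0: "\<And>x. 0 < d x" and d: "\<And>x y. \<lbrakk>x \<in> {p..q} - N; norm (y - x) < d x\<rbrakk>
                        \<Longrightarrow> norm (X y - X x - (y - x) *\<^sub>R g x) \<le> e1 * norm (y - x)"
      by metis
    define \<gamma> where "\<gamma> = (\<lambda>x. if x \<in> N then U else ball x (d x))"
    show "\<exists>\<gamma>. gauge \<gamma> \<and> (\<forall>D. D tagged_division_of {p..q} \<and> \<gamma> fine D \<longrightarrow>
                norm ((\<Sum>(x, k)\<in>D. measure lborel k *\<^sub>R g' x) - (X q - X p)) < e)"
    proof (intro exI conjI allI impI)
      show "gauge \<gamma>"
        using d0 \<open>open U\<close> \<open>N \<subseteq> U\<close> by (auto simp: gauge_def \<gamma>_def)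
    next
      fix D assume "D tagged_division_of {p..q} \<and> \<gamma> fine D"
      then have D: "D tagged_division_of {p..q}" and fine: "\<gamma> fine D" by auto
      note DD = tagged_division_ofD[OF D]
      have K: "\<exists>u v. K = {u..v} \<and> u \<le> x \<and> x \<le> v \<and> p \<le> u \<and> v \<le> q" if "(x, K) \<in> D" for x K
      proof -
        from DD(4)[OF that] obtain u v where uv: "K = {u..v}" by auto
        with DD(2)[OF that] DD(3)[OF that] show ?thesis by auto
      qed
      have XD: "X q - X p = (\<Sum>(x, K)\<in>D. X (Sup K) - X (Inf K))"
        using additive_tagged_division_1[OF \<open>p \<le> q\<close> D, of X] by simp
      have LD: "q - p = (\<Sum>(x, K)\<in>D. Sup K - Inf K)"
        using additive_tagged_division_1[OF \<open>p \<le> q\<close> D, of "\<lambda>x. x"] by simp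
      define B where "B = {z \<in> D. fst z \<in> N}"
      have "finite B" "B \<subseteq> D" using DD(1) by (auto simp: B_def)
      let ?j = "\<lambda>z::real \<times> real set. (Inf (snd z), Sup (snd z))"
      have disj: "interior (snd z) \<inter> interior (snd z') = {}" if "z \<in> D" "z' \<in> D" "z \<noteq> z'" for z z'
        using DD(5)[of "fst z" "snd z" "fst z'" "snd z'"] that by auto
      have inj: "inj_on ?j B"
      proof (rule inj_onI)
        fix z z' assume z: "z \<in> B" "z' \<in> B" and eq: "?j z = ?j z'"
        then have zD: "z \<in> D" "z' \<in> D" using \<open>B \<subseteq> D\<close> by auto
        obtain u v where uv: "snd z = {u..v}" "u \<le> fst z" "fst z \<le> v" using K[of "fst z" "snd z"] zD by auto
        obtain u' v' where uv': "snd z' = {u'..v'}" "u' \<le> fst z'" "fst z' \<le> v'" using K[of "fst z'" "snd z'"] zD by auto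
        have "u = u'" "v = v'" using eq uv uv' by auto
        show "z = z'"
        proof (rule ccontr)
          assume "z \<noteq> z'"
          from disj[OF zD this] have "{u<..<v} = {}" using uv uv' \<open>u = u'\<close> \<open>v = v'\<close> by simp
          then have "u = v" using uv by auto
          with uv uv' \<open>u = u'\<close> \<open>v = v'\<close> have "z = z'" by (intro prod_eqI) auto
          with \<open>z \<noteq> z'\<close> show False by simp
        qed
      qed
      have lenB: "(\<Sum>(x, K)\<in>B. Sup K - Inf K) < \<delta>"
      proof -
        have KU: "snd z \<subseteq> U" if "z \<in> B" for z
          using fine that unfolding fine_def B_def \<gamma>_def by (cases z) force
        have "(\<Sum>z\<in>B. measure lebesgue (interior (snd z))) = measure lebesgue (\<Union>z\<in>B. interior (snd z))"
        proof (rule measure_finite_Union[symmetric])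
          show "finite B" by fact
          show "(\<lambda>z. interior (snd z)) ` B \<subseteq> sets lebesgue" by auto
          show "disjoint_family_on (\<lambda>z. interior (snd z)) B"
            unfolding disjoint_family_on_def using disj \<open>B \<subseteq> D\<close> by blast
          fix z assume "z \<in> B"
          then obtain u v where "snd z = {u..v}" "u \<le> v" using K[of "fst z" "snd z"] \<open>B \<subseteq> D\<close> by fastforce
          then show "emeasure lebesgue (interior (snd z)) \<noteq> \<infinity>" by simp
        qed
        also have "\<dots> \<le> measure lebesgue U"
        proof (rule measure_mono_fmeasurable[OF _ _ Ulm])
          show "(\<Union>z\<in>B. interior (snd z)) \<subseteq> U" using KU interior_subset by blast
          show "(\<Union>z\<in>B. interior (snd z)) \<in> sets lebesgue"
            using \<open>finite B\<close> by (intro sets.finite_UN) auto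
        qed
        also have "\<dots> < \<delta>" by fact
        finally have *: "(\<Sum>z\<in>B. measure lebesgue (interior (snd z))) < \<delta>" .
        have "(\<Sum>(x, K)\<in>B. Sup K - Inf K) = (\<Sum>z\<in>B. measure lebesgue (interior (snd z)))"
        proof (rule sum.cong[OF refl])
          fix z assume "z \<in> B"
          then obtain u v where "snd z = {u..v}" "u \<le> v" using K[of "fst z" "snd z"] \<open>B \<subseteq> D\<close> by fastforce
          then show "(case z of (x, K) \<Rightarrow> Sup K - Inf K) = measure lebesgue (interior (snd z))"
            by (cases z) simp
        qed
        with * show ?thesis by simp
      qed
      have "(\<Sum>(s, t)\<in>?j ` B. norm (X t - X s)) < e / 2"
      proof (rule \<delta>[rule_format], intro conjI)
        show "finite (?j ` B)" using \<open>finite B\<close> by simp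
        have "p \<le> Inf (snd z) \<and> Inf (snd z) \<le> Sup (snd z) \<and> Sup (snd z) \<le> q" if "z \<in> B" for z
          using K[of "fst z" "snd z"] that \<open>B \<subseteq> D\<close> by fastforce
        then show "\<forall>(s, t)\<in>?j ` B. p \<le> s \<and> s \<le> t \<and> t \<le> q" by auto
        show "pairwise (\<lambda>i j. {fst i<..<snd i} \<inter> {fst j<..<snd j} = {}) (?j ` B)"
        proof (rule pairwiseI)
          fix i j assume "i \<in> ?j ` B" "j \<in> ?j ` B" "i \<noteq> j"
          then obtain z z' where z: "z \<in> B" "z' \<in> B" "i = ?j z" "j = ?j z'" "z \<noteq> z'" by auto
          obtain u v where uv: "snd z = {u..v}" "u \<le> v" using K[of "fst z" "snd z"] z \<open>B \<subseteq> D\<close> by fastforce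
          obtain u' v' where uv': "snd z' = {u'..v'}" "u' \<le> v'" using K[of "fst z'" "snd z'"] z \<open>B \<subseteq> D\<close> by fastforce
          from disj[of z z'] z \<open>B \<subseteq> D\<close> have "interior (snd z) \<inter> interior (snd z') = {}" by auto
          then show "{fst i<..<snd i} \<inter> {fst j<..<snd j} = {}" using z uv uv' by simp
        qed
        show "(\<Sum>(s, t)\<in>?j ` B. t - s) < \<delta>"
          using lenB by (simp add: sum.reindex[OF inj] case_prod_beta)
      qed
      then have partB: "(\<Sum>(x, K)\<in>B. norm (X (Sup K) - X (Inf K))) < e / 2"
        by (simp add: sum.reindex[OF inj] case_prod_beta)
      have bound: "norm (measure lborel K *\<^sub>R g' x - (X (Sup K) - X (Inf K))) \<le>
          (if x \<in> N then norm (X (Sup K) - X (Inf K)) else e1 * (Sup K - Inf K))"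
        if xK: "(x, K) \<in> D" for x K
      proof (cases "x \<in> N")
        case True then show ?thesis by (simp add: g'_def norm_minus_commute)
      next
        case False
        obtain u v where uv: "K = {u..v}" "u \<le> x" "x \<le> v" "p \<le> u" "v \<le> q" using K[OF xK] by auto
        have "K \<subseteq> \<gamma> x" using fine xK by blast
        then have sub: "K \<subseteq> ball x (d x)" using False by (simp add: \<gamma>_def)
        have xin: "x \<in> {p..q} - N" using uv False by auto
        have "u \<in> K" "v \<in> K" using uv by auto
        then have du: "norm (u - x) < d x" and dv: "norm (v - x) < d x"
          using sub by (auto simp: dist_real_def)
        have "norm ((v - u) *\<^sub>R g x - (X v - X u)) =
            norm ((X u - X x - (u - x) *\<^sub>R g x) - (X v - X x - (v - x) *\<^sub>R g x))"
          by (simp add: algebra_simps)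
        also have "\<dots> \<le> norm (X u - X x - (u - x) *\<^sub>R g x) + norm (X v - X x - (v - x) *\<^sub>R g x)"
          by (rule norm_triangle_ineq4)
        also have "\<dots> \<le> e1 * norm (u - x) + e1 * norm (v - x)"
          using d[OF xin du] d[OF xin dv] by simp
        also have "\<dots> = e1 * (v - u)" using uv by (simp add: algebra_simps)
        finally show ?thesis using uv False by (simp add: g'_def)
      qed
      have "norm ((\<Sum>(x, k)\<in>D. measure lborel k *\<^sub>R g' x) - (X q - X p)) =
          norm (\<Sum>(x, K)\<in>D. measure lborel K *\<^sub>R g' x - (X (Sup K) - X (Inf K)))"
        unfolding XD by (simp add: sum_subtractf case_prod_beta)
      also have "\<dots> \<le> (\<Sum>(x, K)\<in>D. if x \<in> N then norm (X (Sup K) - X (Inf K)) else e1 * (Sup K - Inf K))"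
        using bound by (intro sum_norm_le) auto
      also have "\<dots> = (\<Sum>(x, K)\<in>B. norm (X (Sup K) - X (Inf K))) + (\<Sum>(x, K)\<in>D - B. e1 * (Sup K - Inf K))"
        using sum.subset_diff[OF \<open>B \<subseteq> D\<close> DD(1)]
        by (smt (verit, best) B_def DiffE add.commute case_prod_beta mem_Collect_eq sum.cong \<open>B \<subseteq> D\<close> subsetD)
      also have "(\<Sum>(x, K)\<in>D - B. e1 * (Sup K - Inf K)) \<le> (\<Sum>(x, K)\<in>D. e1 * (Sup K - Inf K))"
      proof (rule sum_mono2)
        show "finite D" by fact
        fix z assume "z \<in> D - (D - B)"
        then obtain u v where "snd z = {u..v}" "u \<le> v" using K[of "fst z" "snd z"] by fastforce
        then show "0 \<le> (case z of (x, K) \<Rightarrow> e1 * (Sup K - Inf K))" using \<open>e1 > 0\<close> by (cases z) simp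
      qed auto
      also have "\<dots> = e1 * (q - p)"
        unfolding LD by (simp add: sum_distrib_left case_prod_beta)
      finally show "norm ((\<Sum>(x, k)\<in>D. measure lborel k *\<^sub>R g' x) - (X q - X p)) < e"
        using partB e1 by simp
    qed
  qed
  then show ?thesis
    by (rule has_integral_spike[OF \<open>negligible N\<close>, rotated]) (simp add: g'_def)
qed

text \<open>The averages over intervals to the right converge almost everywhere; those to the left are
  averages to the right for the reflected function.\<close>

lemma indefinite_integral_derivative_AE:
  fixes g :: "real \<Rightarrow> 'v::euclidean_space"
  assumes int: "\<And>a b. g integrable_on {a..b}"
  obtains N where "negligible N"
    "\<And>t. t > 0 \<Longrightarrow> t \<notin> N \<Longrightarrow> ((\<lambda>u. integral {0..u} g) has_vector_derivative g t) (at t)"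
proof -
  have int1: "g integrable_on cbox a b" for a b using int by simp
  have int2: "(\<lambda>s. g (- s)) integrable_on cbox a b" for a b
    using int[of "-b" "-a"] Henstock_Kurzweil_Integration.integrable_reflect[of "\<lambda>s. g (- s)" b a] by simp
  obtain N1 where N1: "negligible N1"
       "\<And>x e. \<lbrakk>x \<notin> N1; 0 < e\<rbrakk> \<Longrightarrow> \<exists>d>0. \<forall>h. 0 < h \<and> h < d \<longrightarrow>
                         norm (integral {x..x + h} g /\<^sub>R h - g x) < e"
    using integrable_ccontinuous_explicit[OF int1] by (auto simp: Basis_real_def)
  obtain N2 where N2: "negligible N2"
       "\<And>x e. \<lbrakk>x \<notin> N2; 0 < e\<rbrakk> \<Longrightarrow> \<exists>d>0. \<forall>h. 0 < h \<and> h < d \<longrightarrow>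
                         norm (integral {x..x + h} (\<lambda>s. g (- s)) /\<^sub>R h - g (- x)) < e"
    using integrable_ccontinuous_explicit[OF int2] by (auto simp: Basis_real_def)
  show thesis
  proof
    have "negligible (uminus ` N2)" using N2(1) by (intro negligible_differentiable_image_negligible) (auto intro!: derivative_intros simp: differentiable_on_def)
    then show "negligible (N1 \<union> uminus ` N2)" using N1(1) by simp
    fix t :: real assume t: "t > 0" "t \<notin> N1 \<union> uminus ` N2"
    then have "t \<notin> N1" "- t \<notin> N2" by force+
    show "((\<lambda>u. integral {0..u} g) has_vector_derivative g t) (at t)"
      unfolding has_vector_derivative_def has_derivative_at_alt
    proof (intro conjI allI impI)
      show "bounded_linear (\<lambda>x. x *\<^sub>R g t)" by (rule bounded_linear_scaleR_left)
      fix e :: real assume "e > 0"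
      obtain d1 where "d1 > 0" and d1: "\<And>h. 0 < h \<Longrightarrow> h < d1 \<Longrightarrow> norm (integral {t..t + h} g /\<^sub>R h - g t) < e"
        using N1(2)[OF \<open>t \<notin> N1\<close> \<open>e > 0\<close>] by blast
      obtain d2 where "d2 > 0" and d2: "\<And>h. 0 < h \<Longrightarrow> h < d2 \<Longrightarrow>
          norm (integral {-t..-t + h} (\<lambda>s. g (- s)) /\<^sub>R h - g t) < e"
        using N2(2)[OF \<open>-t \<notin> N2\<close> \<open>e > 0\<close>] by auto
      show "\<exists>d>0. \<forall>y. norm (y - t) < d \<longrightarrow>
          norm (integral {0..y} g - integral {0..t} g - (y - t) *\<^sub>R g t) \<le> e * norm (y - t)"
      proof (intro exI conjI allI impI)
        show "min t (min d1 d2) > 0" using \<open>d1 > 0\<close> \<open>d2 > 0\<close> t by simp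
        fix y assume y: "norm (y - t) < min t (min d1 d2)"
        have scal: "norm (I - h *\<^sub>R c) \<le> e * h" if "norm (I /\<^sub>R h - c) < e" "h > 0" for I c :: 'v and h
        proof -
          have "I - h *\<^sub>R c = h *\<^sub>R (I /\<^sub>R h - c)" using that by (simp add: scaleR_diff_right)
          then have "norm (I - h *\<^sub>R c) = h * norm (I /\<^sub>R h - c)" using that by simp
          with that show ?thesis by simp
        qed
        consider "y = t" | "y > t" | "y < t" by linarith
        then show "norm (integral {0..y} g - integral {0..t} g - (y - t) *\<^sub>R g t) \<le> e * norm (y - t)"
        proof cases
          case 2
          have "integral {0..y} g - integral {0..t} g = integral {t..y} g"
            using Henstock_Kurzweil_Integration.integral_combine[of 0 t y g] int 2 t by (simp add: algebra_simps)
          moreover have "norm (integral {t..t + (y - t)} g /\<^sub>R (y - t) - g t) < e"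
            using 2 y by (intro d1) auto
          ultimately show ?thesis using scal[where I = "integral {t..y} g" and h = "y - t" and c = "g t"] 2 by simp
        next
          case 3
          have "y > 0" using y 3 by auto
          have "integral {0..t} g - integral {0..y} g = integral {y..t} g"
            using Henstock_Kurzweil_Integration.integral_combine[of 0 y t g] int 3 \<open>y > 0\<close> by (simp add: algebra_simps)
          moreover have "norm (integral {-t..-t + (t - y)} (\<lambda>s. g (- s)) /\<^sub>R (t - y) - g t) < e"
            using 3 y by (intro d2) auto
          moreover have "integral {-t..-y} (\<lambda>s. g (- s)) = integral {y..t} g"
            by (simp add: Henstock_Kurzweil_Integration.integral_reflect_real)
          ultimately have "norm ((integral {0..t} g - integral {0..y} g) - (t - y) *\<^sub>R g t) \<le> e * (t - y)"
            using scal[where I = "integral {y..t} g" and h = "t - y" and c = "g t"] 3 by simp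
          moreover have "integral {0..y} g - integral {0..t} g - (y - t) *\<^sub>R g t =
             - ((integral {0..t} g - integral {0..y} g) - (t - y) *\<^sub>R g t)"
            by (simp add: algebra_simps)
          ultimately show ?thesis using 3 by (metis norm_minus_cancel abs_minus_commute abs_of_pos diff_gt_0_iff_gt real_norm_def)
        qed simp
      qed
    qed
  qed
qed

section \<open>Measurability of pairs\<close>

lemma compact_UNIV_countable_dense:
  assumes "compact (UNIV :: 'c::metric_space set)"
  obtains D :: "'c::metric_space set" where "countable D" "\<And>x e. e > 0 \<Longrightarrow> \<exists>d\<in>D. dist x d < e"
proof -
  have "\<exists>K. finite K \<and> (\<forall>x::'c. \<exists>d\<in>K. dist x d < 1 / real (Suc n))" for n
  proof -
    obtain K where "finite K" and K: "(UNIV :: 'c set) \<subseteq> (\<Union>x\<in>K. ball x (1 / real (Suc n)))"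
      by (rule compactE_image[OF assms, of UNIV "\<lambda>x. ball x (1 / real (Suc n))"]) auto
    have "\<exists>d\<in>K. dist x d < 1 / real (Suc n)" for x :: 'c
    proof -
      from K have "x \<in> (\<Union>x\<in>K. ball x (1 / real (Suc n)))" by blast
      then obtain d where "d \<in> K" "x \<in> ball d (1 / real (Suc n))" by blast
      then show ?thesis by (metis dist_commute mem_ball)
    qed
    with \<open>finite K\<close> show ?thesis by blast
  qed
  then obtain K where K: "\<And>n. finite (K n)" "\<And>n x. \<exists>d\<in>K n. dist (x::'c) d < 1 / real (Suc n)"
    by metis
  show thesis
  proof
    show "countable (\<Union>n. K n)" using K(1) by (auto intro: countable_finite)
    fix x :: 'c and e :: real assume "e > 0"
    then obtain n where "1 / real (Suc n) < e" using nat_approx_posE by metis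
    moreover obtain d where "d \<in> K n" "dist x d < 1 / real (Suc n)" using K(2) by blast
    ultimately show "\<exists>d\<in>(\<Union>n. K n). dist x d < e" by force
  qed
qed

lemma euclidean_countable_dense:
  obtains D :: "'c::euclidean_space set" where "countable D" "\<And>x e. e > 0 \<Longrightarrow> \<exists>d\<in>D. dist x d < e"
proof -
  obtain D :: "'c set" where D: "countable D" "\<And>X. open X \<Longrightarrow> X \<noteq> {} \<Longrightarrow> \<exists>d\<in>D. d \<in> X"
    using countable_dense_setE by metis
  show thesis
  proof
    show "countable D" by fact
    fix x :: 'c and e :: real assume "e > 0"
    then show "\<exists>d\<in>D. dist x d < e" using D(2)[of "ball x e"] by auto
  qed
qed

text \<open>Countable dense sets write every open set of the product as a countable union of products of
  balls. The control sets are compact metric spaces, so such sets exist for them.\<close>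

lemma borel_measurable_Pair_dense:
  fixes X :: "'s \<Rightarrow> 'x::metric_space" and Y :: "'s \<Rightarrow> 'y::metric_space"
  assumes D: "countable D" "\<And>(x::'x) e. e > 0 \<Longrightarrow> \<exists>d\<in>D. dist x d < e"
    and E: "countable E" "\<And>(y::'y) e. e > 0 \<Longrightarrow> \<exists>d\<in>E. dist y d < e"
    and X: "X \<in> borel_measurable M" and Y: "Y \<in> borel_measurable M"
  shows "(\<lambda>s. (X s, Y s)) \<in> borel_measurable M"
proof (rule borel_measurableI)
  fix W :: "('x \<times> 'y) set" assume "open W"
  define I where "I = {(d, e, n). d \<in> D \<and> e \<in> E \<and> ball d (1 / real (Suc n)) \<times> ball e (1 / real (Suc n)) \<subseteq> W}"
  have "I \<subseteq> D \<times> E \<times> UNIV" by (auto simp: I_def)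
  moreover have "countable (D \<times> E \<times> (UNIV :: nat set))" using D(1) E(1) by (intro countable_SIGMA) auto
  ultimately have "countable I" by (rule countable_subset)
  have W: "(x, y) \<in> W \<longleftrightarrow> (\<exists>(d, e, n)\<in>I. x \<in> ball d (1 / real (Suc n)) \<and> y \<in> ball e (1 / real (Suc n)))" for x y
  proof
    assume "(x, y) \<in> W"
    then obtain A B where AB: "open A" "open B" "x \<in> A" "y \<in> B" "A \<times> B \<subseteq> W"
      using open_prod_elim[OF \<open>open W\<close>] by (metis mem_Sigma_iff)
    obtain r1 where r1: "r1 > 0" "ball x r1 \<subseteq> A" using AB openE by blast
    obtain r2 where r2: "r2 > 0" "ball y r2 \<subseteq> B" using AB openE by blast
    obtain n where n: "1 / real (Suc n) < min r1 r2 / 2" using r1 r2 nat_approx_posE[of "min r1 r2 / 2"] by auto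
    obtain d where d: "d \<in> D" "dist x d < 1 / real (Suc n)" using D(2)[of "1 / real (Suc n)" x] by auto
    obtain e where e: "e \<in> E" "dist y e < 1 / real (Suc n)" using E(2)[of "1 / real (Suc n)" y] by auto
    have "ball d (1 / real (Suc n)) \<subseteq> ball x r1"
    proof
      fix z assume "z \<in> ball d (1 / real (Suc n))"
      then have "dist x z < 1 / real (Suc n) + 1 / real (Suc n)"
        using d dist_triangle[of x z d] by auto
      then show "z \<in> ball x r1" using n by auto
    qed
    moreover have "ball e (1 / real (Suc n)) \<subseteq> ball y r2"
    proof
      fix z assume "z \<in> ball e (1 / real (Suc n))"
      then have "dist y z < 1 / real (Suc n) + 1 / real (Suc n)"
        using e dist_triangle[of y z e] by auto
      then show "z \<in> ball y r2" using n by auto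
    qed
    ultimately have "(d, e, n) \<in> I" using d e r1 r2 AB(5) unfolding I_def by blast
    moreover have "x \<in> ball d (1 / real (Suc n))" "y \<in> ball e (1 / real (Suc n))"
      using d e by (auto simp: dist_commute)
    ultimately show "\<exists>(d, e, n)\<in>I. x \<in> ball d (1 / real (Suc n)) \<and> y \<in> ball e (1 / real (Suc n))"
      by blast
  qed (auto simp: I_def)
  define P where "P = (\<lambda>i::'x \<times> 'y \<times> nat. ball (fst i) (1 / real (Suc (snd (snd i)))))"
  define Q where "Q = (\<lambda>i::'x \<times> 'y \<times> nat. ball (fst (snd i)) (1 / real (Suc (snd (snd i)))))"
  have WPQ: "(x, y) \<in> W \<longleftrightarrow> (\<exists>i\<in>I. x \<in> P i \<and> y \<in> Q i)" for x y
    unfolding W P_def Q_def by (simp add: case_prod_beta)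
  have "(\<lambda>s. (X s, Y s)) -` W \<inter> space M = (\<Union>i\<in>I. (X -` P i \<inter> space M) \<inter> (Y -` Q i \<inter> space M))"
    by (rule set_eqI) (simp add: WPQ, blast)
  also have "\<dots> \<in> sets M"
  proof (rule sets.countable_UN''[OF \<open>countable I\<close>])
    fix i
    have "X -` P i \<inter> space M \<in> sets M" by (rule measurable_sets[OF X]) (simp add: P_def)
    moreover have "Y -` Q i \<inter> space M \<in> sets M" by (rule measurable_sets[OF Y]) (simp add: Q_def)
    ultimately show "(X -` P i \<inter> space M) \<inter> (Y -` Q i \<inter> space M) \<in> sets M" by (rule sets.Int)
  qed
  finally show "(\<lambda>s. (X s, Y s)) -` W \<inter> space M \<in> sets M" .
qed

lemma borel_measurable_state_controls:
  fixes g :: "(real^'n) \<times> 'a::metric_space \<times> 'b::metric_space \<Rightarrow> 'v::topological_space"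
  assumes "compact (UNIV :: 'a set)" "compact (UNIV :: 'b set)" and g: "continuous_on UNIV g"
    and X: "X \<in> borel_measurable M" and a: "a \<in> borel_measurable M" and b: "b \<in> borel_measurable M"
  shows "(\<lambda>s. g (X s, a s, b s)) \<in> borel_measurable M"
proof -
  obtain D1 :: "(real^'n) set" where D1: "countable D1" "\<And>x e. e > 0 \<Longrightarrow> \<exists>d\<in>D1. dist x d < e"
    using euclidean_countable_dense by metis
  obtain D2 :: "'a set" where D2: "countable D2" "\<And>x e. e > 0 \<Longrightarrow> \<exists>d\<in>D2. dist x d < e"
    using compact_UNIV_countable_dense[OF assms(1)] by metis
  obtain D3 :: "'b set" where D3: "countable D3" "\<And>x e. e > 0 \<Longrightarrow> \<exists>d\<in>D3. dist x d < e"
    using compact_UNIV_countable_dense[OF assms(2)] by metis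
  have "compact (UNIV :: ('a \<times> 'b) set)"
    using compact_Times[OF assms(1,2)] by simp
  then obtain D4 :: "('a \<times> 'b) set" where D4: "countable D4" "\<And>x e. e > 0 \<Longrightarrow> \<exists>d\<in>D4. dist x d < e"
    using compact_UNIV_countable_dense by metis
  have "(\<lambda>s. (X s, (a s, b s))) \<in> borel_measurable M"
    by (rule borel_measurable_Pair_dense[OF D1 D4 X borel_measurable_Pair_dense[OF D2 D3 a b]])
  from measurable_compose[OF this borel_measurable_continuous_onI[OF g]] show ?thesis .
qed

lemma integrable_on_bounded_measurable:
  fixes g :: "real \<Rightarrow> 'v::euclidean_space"
  assumes g: "g \<in> borel_measurable (lebesgue_on {p..q})" and B: "\<And>s. s \<in> {p..q} \<Longrightarrow> norm (g s) \<le> B"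
  shows "g integrable_on {p..q}"
proof (rule measurable_bounded_by_integrable_imp_integrable)
  show "(\<lambda>s. B) integrable_on {p..q}" by (rule integrable_const_ivl)
qed (use assms in simp_all)

section \<open>Operations on controls\<close>

text \<open>Equality of two controls in the sense in which strategies and responses are nonanticipating.\<close>

definition agree :: "real \<Rightarrow> (real \<Rightarrow> 'c) \<Rightarrow> (real \<Rightarrow> 'c) \<Rightarrow> bool" where
  "agree t u v \<longleftrightarrow> (AE s\<in>{0..t} in lebesgue. u s = v s)"

definition shift :: "real \<Rightarrow> (real \<Rightarrow> 'c) \<Rightarrow> real \<Rightarrow> 'c" where
  "shift h u = (\<lambda>s. u (s + h))"

definition switch :: "real \<Rightarrow> (real \<Rightarrow> 'c) \<Rightarrow> (real \<Rightarrow> 'c) \<Rightarrow> real \<Rightarrow> 'c" where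
  "switch h u v = (\<lambda>s. if s < h then u s else v (s - h))"

lemma agree_iff_negligible: "agree t u v \<longleftrightarrow> negligible {s \<in> {0..t}. u s \<noteq> v s}"
proof -
  have "agree t u v \<longleftrightarrow> (\<exists>N\<in>null_sets lebesgue. {s. \<not> (s \<in> {0..t} \<longrightarrow> u s = v s)} \<subseteq> N)"
    unfolding agree_def eventually_ae_filter by simp
  also have "{s. \<not> (s \<in> {0..t} \<longrightarrow> u s = v s)} = {s \<in> {0..t}. u s \<noteq> v s}" by auto
  finally show ?thesis
    by (metis negligible_iff_null_sets negligible_subset subset_refl)
qed

lemma agree_refl [simp]: "agree t u u"
  by (simp add: agree_def)

lemma agree_mono:
  assumes "agree t u v" "s \<le> t"
  shows "agree s u v"
  using assms(1) unfolding agree_def by eventually_elim (use assms(2) in auto)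

lemma agreeI: "(\<And>s. 0 \<le> s \<Longrightarrow> s < t \<Longrightarrow> u s = v s) \<Longrightarrow> agree t u v"
  unfolding agree_iff_negligible
  by (rule negligible_subset[OF negligible_sing[of t]]) force

lemma agree_nonpos: "t \<le> 0 \<Longrightarrow> agree t u v"
  by (rule agreeI) auto

lemma agree_shift:
  assumes "agree (h + t) u v" "0 \<le> h"
  shows "agree t (shift h u) (shift h v)"
proof -
  have "negligible ((+) (- h) ` {s \<in> {0..h + t}. u s \<noteq> v s})"
    using assms(1) unfolding agree_iff_negligible by (rule negligible_translation)
  moreover have "{s \<in> {0..t}. shift h u s \<noteq> shift h v s} \<subseteq> (+) (- h) ` {s \<in> {0..h + t}. u s \<noteq> v s}"
  proof
    fix s assume "s \<in> {s \<in> {0..t}. shift h u s \<noteq> shift h v s}"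
    then have "s = - h + (s + h)" "s + h \<in> {s \<in> {0..h + t}. u s \<noteq> v s}"
      using \<open>0 \<le> h\<close> by (auto simp: shift_def)
    then show "s \<in> (+) (- h) ` {s \<in> {0..h + t}. u s \<noteq> v s}" by blast
  qed
  ultimately show ?thesis unfolding agree_iff_negligible by (rule negligible_subset)
qed

lemma agree_switch_left: "agree h (switch h u v) u"
  by (rule agreeI) (simp add: switch_def)

lemma shift_switch_agree: "agree t (shift h (switch h u v)) v"
  by (rule agreeI) (simp add: switch_def shift_def)

lemma agree_switch:
  assumes "agree (min h t) u u'" "agree (t - h) v v'"
  shows "agree t (switch h u v) (switch h u' v')"
proof -
  have "negligible ((+) h ` {s \<in> {0..t - h}. v s \<noteq> v' s})"
    using assms(2) unfolding agree_iff_negligible by (rule negligible_translation)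
  then have *: "negligible ({s \<in> {0..min h t}. u s \<noteq> u' s} \<union> (+) h ` {s \<in> {0..t - h}. v s \<noteq> v' s})"
    using assms(1) unfolding agree_iff_negligible by auto
  have "{s \<in> {0..t}. switch h u v s \<noteq> switch h u' v' s} \<subseteq>
      {s \<in> {0..min h t}. u s \<noteq> u' s} \<union> (+) h ` {s \<in> {0..t - h}. v s \<noteq> v' s}"
  proof
    fix s assume s: "s \<in> {s \<in> {0..t}. switch h u v s \<noteq> switch h u' v' s}"
    show "s \<in> {s \<in> {0..min h t}. u s \<noteq> u' s} \<union> (+) h ` {s \<in> {0..t - h}. v s \<noteq> v' s}"
    proof (cases "s < h")
      case True then show ?thesis using s by (auto simp: switch_def)
    next
      case False
      then have "s = h + (s - h)" "s - h \<in> {s \<in> {0..t - h}. v s \<noteq> v' s}"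
        using s by (auto simp: switch_def)
      then show ?thesis by blast
    qed
  qed
  then show ?thesis unfolding agree_iff_negligible by (rule negligible_subset[OF *])
qed

lemma const_controls [simp]: "(\<lambda>s. c) \<in> controls"
  by (simp add: controls_def)

lemma translation_measurable: "(\<lambda>s::real. h + s) \<in> lebesgue \<rightarrow>\<^sub>M lebesgue"
  using lebesgue_affine_measurable[where c = "\<lambda>x::real. 1" and t = h] by simp

lemma shift_controls:
  assumes "u \<in> controls" "0 \<le> h"
  shows "shift h u \<in> controls"
proof -
  have "(\<lambda>s. h + s) \<in> lebesgue_on {0..} \<rightarrow>\<^sub>M lebesgue_on {0..}"
    using \<open>0 \<le> h\<close> by (intro measurable_restrict_space2 measurable_restrict_space1 translation_measurable) auto
  from measurable_compose[OF this, of u borel] assms(1) show ?thesis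
    by (simp add: controls_def shift_def add.commute)
qed

lemma switch_controls:
  assumes u: "u \<in> controls" and v: "v \<in> controls" and "0 \<le> h"
  shows "switch h u v \<in> controls"
  unfolding controls_def
proof (rule measurable_piecewise_restrict[of "{{..<h}, {h..}}"])
  fix \<Omega> assume "\<Omega> \<in> {{..<h}, {h..}}"
  then have \<Omega>: "\<Omega> = {..<h} \<or> \<Omega> = {h..}" by auto
  then have "\<Omega> \<in> sets lebesgue" by auto
  from this show "\<Omega> \<inter> space (lebesgue_on {0..}) \<in> sets (lebesgue_on {0..})"
    by (auto simp: sets_restrict_space_iff intro: sets.Int)
  have eq: "restrict_space (lebesgue_on {0..}) \<Omega> = lebesgue_on ({0..} \<inter> \<Omega>)"
    using \<open>\<Omega> \<in> sets lebesgue\<close> by (intro restrict_restrict_space) auto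
  show "switch h u v \<in> borel_measurable (restrict_space (lebesgue_on {0..}) \<Omega>)"
  proof (cases "\<Omega> = {..<h}")
    case True
    have "u \<in> borel_measurable (lebesgue_on ({0..} \<inter> \<Omega>))"
      using u unfolding controls_def by (rule measurable_restrict_mono) auto
    then show ?thesis unfolding eq
      by (rule measurable_cong[THEN iffD1, rotated]) (auto simp: True switch_def space_restrict_space)
  next
    case False
    then have \<Omega>: "\<Omega> = {h..}" using \<Omega> by auto
    have "(\<lambda>s. - h + s) \<in> lebesgue_on ({0..} \<inter> \<Omega>) \<rightarrow>\<^sub>M lebesgue_on {0..}"
      by (intro measurable_restrict_space2 measurable_restrict_space1 translation_measurable)
         (auto simp: \<Omega> space_restrict_space)
    from measurable_compose[OF this, of v borel] v
    have "(\<lambda>s. v (- h + s)) \<in> borel_measurable (lebesgue_on ({0..} \<inter> \<Omega>))" by (simp add: controls_def)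
    then show ?thesis unfolding eq
      by (rule measurable_cong[THEN iffD1, rotated]) (auto simp: \<Omega> switch_def space_restrict_space)
  qed
qed auto

section \<open>Trajectories\<close>

lemma int_lattice_floor:
  fixes x :: "real^'n"
  obtains z where "z \<in> int_lattice" "x - z \<in> cbox 0 1"
proof
  show "(\<chi> i. of_int \<lfloor>x $ i\<rfloor>) \<in> int_lattice" by (simp add: int_lattice_def)
  show "x - (\<chi> i. of_int \<lfloor>x $ i\<rfloor>) \<in> cbox 0 1"
    by (auto simp: mem_box_cart) linarith
qed

lemma int_lattice_uminus: "z \<in> int_lattice \<Longrightarrow> - z \<in> int_lattice"
  by (simp add: int_lattice_def)

lemma int_lattice_diff: "z \<in> int_lattice \<Longrightarrow> w \<in> int_lattice \<Longrightarrow> z - w \<in> int_lattice"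
  by (simp add: int_lattice_def)

lemma zero_int_lattice [simp]: "0 \<in> int_lattice"
  by (simp add: int_lattice_def)

lemma periodic_continuous_bounded:
  fixes g :: "(real^'n) \<times> 'a::metric_space \<times> 'b::metric_space \<Rightarrow> 'v::real_normed_vector"
  assumes "compact (UNIV :: 'a set)" "compact (UNIV :: 'b set)" "continuous_on UNIV g" "periodic_in_state g"
  obtains B where "B > 0" "\<And>z. norm (g z) \<le> B"
proof -
  let ?K = "cbox (0::real^'n) 1 \<times> (UNIV :: 'a set) \<times> (UNIV :: 'b set)"
  have "compact ?K" by (intro compact_Times compact_cbox assms)
  then have "bounded (g ` ?K)"
    by (intro compact_imp_bounded compact_continuous_image continuous_on_subset[OF assms(3)]) auto
  then obtain B where "B > 0" and B: "\<And>z. z \<in> ?K \<Longrightarrow> norm (g z) \<le> B"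
    unfolding bounded_pos by auto
  have "norm (g z) \<le> B" for z
  proof -
    obtain x a b where z: "z = (x, a, b)" by (cases z) auto
    obtain w where w: "w \<in> int_lattice" "x - w \<in> cbox 0 1" using int_lattice_floor by metis
    have "g (x - w + w, a, b) = g (x - w, a, b)"
      using assms(4) w unfolding periodic_in_state_def by blast
    then show ?thesis using B[of "(x - w, a, b)"] w z by simp
  qed
  with \<open>B > 0\<close> show thesis by (rule that)
qed

lemma has_integral_exp_interval:
  fixes c r :: real
  assumes "r \<noteq> 0" "0 \<le> T"
  shows "((\<lambda>s. c * exp (r * s)) has_integral c * (exp (r * T) - 1) / r) {0..T}"
proof -
  have "((\<lambda>s. c * exp (r * s)) has_integral (c * exp (r * T) / r - c * exp (r * 0) / r)) {0..T}"
    using assms by (intro fundamental_theorem_of_calculus)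
      (auto intro!: derivative_eq_intros simp: has_real_derivative_iff_has_vector_derivative[symmetric])
  then show ?thesis by (simp add: right_diff_distrib diff_divide_distrib)
qed

lemma has_integral_discount_interval:
  fixes c \<delta> :: real
  assumes "0 < \<delta>" "0 \<le> T"
  shows "((\<lambda>s. c * exp (- (\<delta> * s))) has_integral c * (1 - exp (- (\<delta> * T))) / \<delta>) {0..T}"
proof -
  have "c * (exp (- \<delta> * T) - 1) / - \<delta> = c * (1 - exp (- (\<delta> * T))) / \<delta>"
    using assms by (simp add: field_simps)
  with has_integral_exp_interval[of "- \<delta>" T c] assms show ?thesis by simp
qed

text \<open>The maximum \<open>S\<close> of \<open>u t * exp (- 2 L t)\<close> satisfies \<open>S \<le> c + S / 2\<close>. The factor \<open>2\<close> that
  this argument costs is harmless below.\<close>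

lemma gronwall_weak:
  fixes u :: "real \<Rightarrow> real"
  assumes cont: "continuous_on {0..T} u" and "L > 0" and nonneg: "\<And>t. t \<in> {0..T} \<Longrightarrow> 0 \<le> u t" and "0 \<le> c"
    and le: "\<And>t. t \<in> {0..T} \<Longrightarrow> u t \<le> c + L * integral {0..t} u" and t: "t \<in> {0..T}"
  shows "u t \<le> 2 * c * exp (2 * L * t)"
proof -
  define w where "w = (\<lambda>t. u t * exp (- (2 * L * t)))"
  have "continuous_on {0..T} w" unfolding w_def by (intro continuous_intros cont)
  moreover have "{0..T} \<noteq> {}" using t by auto
  ultimately obtain t0 where t0: "t0 \<in> {0..T}" and max: "\<And>s. s \<in> {0..T} \<Longrightarrow> w s \<le> w t0"
    using continuous_attains_sup[of "{0..T}" w] by auto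
  define S where "S = w t0"
  have "S \<ge> 0" using nonneg[OF t0] by (simp add: S_def w_def)
  have uS: "u s \<le> S * exp (2 * L * s)" if "s \<in> {0..T}" for s
    using max[OF that] by (simp add: S_def w_def exp_minus field_simps)
  have int: "((\<lambda>s. S * exp (2 * L * s)) has_integral S * (exp (2 * L * t0) - 1) / (2 * L)) {0..t0}"
    using t0 \<open>L > 0\<close> by (intro has_integral_exp_interval) auto
  have "integral {0..t0} u \<le> S * (exp (2 * L * t0) - 1) / (2 * L)"
  proof (rule integral_le[THEN order_trans])
    show "u integrable_on {0..t0}"
      using t0 by (intro integrable_continuous_interval continuous_on_subset[OF cont]) auto
    show "(\<lambda>s. S * exp (2 * L * s)) integrable_on {0..t0}" using int by blast
    show "u s \<le> S * exp (2 * L * s)" if "s \<in> {0..t0}" for s using uS that t0 by auto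
    show "integral {0..t0} (\<lambda>s. S * exp (2 * L * s)) \<le> S * (exp (2 * L * t0) - 1) / (2 * L)"
      using integral_unique[OF int] by simp
  qed
  also have "\<dots> \<le> S * exp (2 * L * t0) / (2 * L)"
    using \<open>S \<ge> 0\<close> \<open>L > 0\<close> by (intro divide_right_mono mult_left_mono) auto
  finally have "L * integral {0..t0} u \<le> S * exp (2 * L * t0) / 2"
    using \<open>L > 0\<close> by (simp add: field_simps)
  then have "u t0 \<le> c + S * exp (2 * L * t0) / 2" using le[OF t0] by linarith
  moreover have "u t0 = S * exp (2 * L * t0)" by (simp add: S_def w_def exp_minus field_simps)
  ultimately have "S * exp (2 * L * t0) \<le> 2 * c" by simp
  moreover have "S * 1 \<le> S * exp (2 * L * t0)" using t0 \<open>L > 0\<close> \<open>S \<ge> 0\<close> by (intro mult_left_mono) auto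
  ultimately have "S \<le> 2 * c" by simp
  then have "S * exp (2 * L * t) \<le> 2 * c * exp (2 * L * t)" by simp
  with uS[OF t] show ?thesis by linarith
qed

locale control_system =
  fixes f :: "(real^'n) \<times> 'a::metric_space \<times> 'b::metric_space \<Rightarrow> real^'n" and L F :: real
  assumes compact_a: "compact (UNIV :: 'a set)" and compact_b: "compact (UNIV :: 'b set)"
    and cont_f: "continuous_on UNIV f" and per_f: "periodic_in_state f"
    and L_pos: "L > 0" and lip_f: "norm (f (x, a, b) - f (y, a, b)) \<le> L * norm (x - y)"
    and F_pos: "F > 0" and f_bound: "norm (f z) \<le> F"
begin

text \<open>The differential equation on \<open>[0, T]\<close> in integral form, which avoids any mention of derivatives.\<close>

definition solves :: "real \<Rightarrow> real^'n \<Rightarrow> (real \<Rightarrow> 'a) \<Rightarrow> (real \<Rightarrow> 'b) \<Rightarrow> (real \<Rightarrow> real^'n) \<Rightarrow> bool" where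
  "solves T x a b X \<longleftrightarrow> (\<forall>t\<in>{0..T}. ((\<lambda>s. f (X s, a s, b s)) has_integral (X t - x)) {0..t})"

lemma solves_diff:
  assumes "solves T x a b X" "0 \<le> s" "s \<le> t" "t \<le> T"
  shows "((\<lambda>r. f (X r, a r, b r)) has_integral (X t - X s)) {s..t}"
proof -
  let ?g = "\<lambda>r. f (X r, a r, b r)"
  have 1: "(?g has_integral (X t - x)) {0..t}" "(?g has_integral (X s - x)) {0..s}"
    using assms by (auto simp: solves_def)
  then have "?g integrable_on {0..t}" by blast
  then have "integral {0..s} ?g + integral {s..t} ?g = integral {0..t} ?g"
    using assms by (intro Henstock_Kurzweil_Integration.integral_combine) auto
  with 1 have "integral {s..t} ?g = X t - X s" by (simp add: integral_unique algebra_simps)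
  moreover have "?g integrable_on {s..t}"
    using integrable_subinterval_real[OF \<open>?g integrable_on {0..t}\<close>] assms by auto
  ultimately show ?thesis by (simp add: has_integral_iff)
qed

lemma solves_lipschitz:
  assumes "solves T x a b X" "0 \<le> s" "s \<le> t" "t \<le> T"
  shows "norm (X t - X s) \<le> F * (t - s)"
proof -
  have "norm (X t - X s) \<le> F * measure lborel (cbox s t)"
    using F_pos f_bound solves_diff[OF assms] by (intro has_integral_bound) auto
  then show ?thesis using assms by simp
qed

lemma solves_lipschitz_on: "solves T x a b X \<Longrightarrow> F-lipschitz_on {0..T} X"
proof (rule lipschitz_onI)
  fix s t assume "solves T x a b X" "s \<in> {0..T}" "t \<in> {0..T}"
  then show "dist (X s) (X t) \<le> F * dist s t"
    using solves_lipschitz[of T x a b X s t] solves_lipschitz[of T x a b X t s]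
    by (cases "s \<le> t") (auto simp: dist_norm norm_minus_commute)
qed (use F_pos in simp)

lemma solves_continuous: "solves T x a b X \<Longrightarrow> continuous_on {0..T} X"
  using solves_lipschitz_on lipschitz_on_continuous_on by blast

lemma solves_start: "solves T x a b X \<Longrightarrow> 0 \<le> T \<Longrightarrow> X 0 = x"
  unfolding solves_def by (drule bspec[of _ _ 0]) (auto dest: has_integral_unique[OF _ has_integral_refl(2)])

lemma solves_stable:
  assumes X: "solves T x a b X" and Y: "solves T y a b Y" and t: "t \<in> {0..T}"
  shows "norm (X t - Y t) \<le> 2 * norm (x - y) * exp (2 * L * t)"
proof -
  define u where "u = (\<lambda>t. norm (X t - Y t))"
  have cont: "continuous_on {0..T} u"
    unfolding u_def by (intro continuous_intros solves_continuous[OF X] solves_continuous[OF Y])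
  have "u t \<le> norm (x - y) + L * integral {0..t} u" if t: "t \<in> {0..T}" for t
  proof -
    let ?g = "\<lambda>s. f (X s, a s, b s) - f (Y s, a s, b s)"
    have "(?g has_integral ((X t - x) - (Y t - y))) {0..t}"
      using X Y t by (intro has_integral_diff) (auto simp: solves_def)
    then have g: "?g integrable_on {0..t}" "integral {0..t} ?g = (X t - Y t) - (x - y)"
      by (auto simp: has_integral_iff)
    have int_u: "(\<lambda>s. L * u s) integrable_on {0..t}"
      using t by (intro integrable_continuous_interval continuous_intros continuous_on_subset[OF cont]) auto
    have "norm (integral {0..t} ?g) \<le> integral {0..t} (\<lambda>s. L * u s)"
      using lip_f by (intro Henstock_Kurzweil_Integration.integral_norm_bound_integral[OF g(1) int_u]) (auto simp: u_def)
    then have "norm ((X t - Y t) - (x - y)) \<le> L * integral {0..t} u" using g(2) by simp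
    then show ?thesis
      unfolding u_def using norm_triangle_ineq[of "(X t - Y t) - (x - y)" "x - y"] by simp
  qed
  then have "u t \<le> 2 * norm (x - y) * exp (2 * L * t)"
    using t L_pos by (intro gronwall_weak[OF cont]) (auto simp: u_def)
  then show ?thesis by (simp add: u_def)
qed

lemma solves_agree:
  assumes X: "solves T x a b X" and "agree T a a'" "agree T b b'"
  shows "solves T x a' b' X"
  unfolding solves_def
proof
  fix t assume t: "t \<in> {0..T}"
  let ?N = "{s \<in> {0..T}. a s \<noteq> a' s} \<union> {s \<in> {0..T}. b s \<noteq> b' s}"
  show "((\<lambda>s. f (X s, a' s, b' s)) has_integral (X t - x)) {0..t}"
  proof (rule has_integral_spike)
    show "negligible ?N" using assms(2,3) by (simp add: agree_iff_negligible)
    show "((\<lambda>s. f (X s, a s, b s)) has_integral (X t - x)) {0..t}" using X t by (simp add: solves_def)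
  qed (use t in auto)
qed

lemma solves_shift:
  assumes X: "solves (h + T) x a b X" and "0 \<le> h"
  shows "solves T (X h) (shift h a) (shift h b) (\<lambda>t. X (h + t))"
  unfolding solves_def
proof
  fix t assume t: "t \<in> {0..T}"
  have "((\<lambda>r. f (X r, a r, b r)) has_integral (X (h + t) - X h)) {0 + h..t + h}"
    using solves_diff[OF X, of h "h + t"] t \<open>0 \<le> h\<close> by (simp add: add.commute)
  then have "(((\<lambda>r. f (X r, a r, b r)) \<circ> (+) h) has_integral (X (h + t) - X h)) {0..t}"
    by (subst has_integral_shift_Icc_real)
  then show "((\<lambda>s. f (X (h + s), shift h a s, shift h b s)) has_integral (X (h + t) - X h)) {0..t}"
    by (simp add: o_def shift_def add.commute)
qed

lemma f_controls_measurable: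
  assumes "a \<in> controls" "b \<in> controls" "X \<in> borel_measurable (lebesgue_on {0..})"
  shows "(\<lambda>s. f (X s, a s, b s)) \<in> borel_measurable (lebesgue_on {0..})"
  using assms unfolding controls_def
  by (intro borel_measurable_state_controls[OF compact_a compact_b cont_f])

lemma f_controls_integrable:
  assumes "a \<in> controls" "b \<in> controls" "continuous_on {0..} X" "0 \<le> p"
  shows "(\<lambda>s. f (X s, a s, b s)) integrable_on {p..q}"
proof (rule integrable_on_bounded_measurable)
  have "X \<in> borel_measurable (lebesgue_on {0..})"
    using assms by (intro continuous_imp_measurable_on_sets_lebesgue) auto
  from f_controls_measurable[OF assms(1,2) this]
  show "(\<lambda>s. f (X s, a s, b s)) \<in> borel_measurable (lebesgue_on {p..q})"
    by (rule measurable_restrict_mono) (use assms in auto)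
qed (rule f_bound)

text \<open>In the unknown \<open>Z t = exp (- 2 L t) (X t - x)\<close> the right-hand side is a contraction with constant
  \<open>1 / 2\<close> of the space of bounded continuous functions, so one application of the fixed point theorem
  gives a solution for all times. Constant extension to negative times makes \<open>Z\<close> a function on the
  whole line.\<close>

lemma integral_equation_solvable:
  assumes a: "a \<in> controls" and b: "b \<in> controls"
  obtains X where "continuous_on {0..} X"
    "\<And>t. t \<ge> 0 \<Longrightarrow> X t = x + integral {0..t} (\<lambda>s. f (X s, a s, b s))"
proof -
  define G where "G = (\<lambda>(Z :: real \<Rightarrow>\<^sub>C (real^'n)) s. f (x + exp (2 * L * s) *\<^sub>R Z s, a s, b s))"
  define I where "I = (\<lambda>Z t. exp (- (2 * L * max 0 t)) *\<^sub>R integral {0..max 0 t} (G Z))"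
  have int: "G Z integrable_on {0..t}" for Z t
    unfolding G_def by (intro f_controls_integrable[OF a b]) (auto intro!: continuous_intros)
  have intb: "norm (integral {0..t} (G Z)) \<le> F * t" if "t \<ge> 0" for Z t
  proof -
    have "norm (integral {0..t} (G Z)) \<le> F * measure lborel (cbox 0 t)"
      using F_pos f_bound integrable_integral[OF int[of Z t]] by (intro has_integral_bound) (auto simp: G_def)
    then show ?thesis using that by simp
  qed
  have texp: "t * exp (- (2 * L * t)) \<le> 1 / (2 * L)" for t
  proof -
    have "2 * L * t \<le> exp (2 * L * t)" using exp_ge_add_one_self[of "2 * L * t"] by linarith
    then show ?thesis using L_pos by (simp add: exp_minus field_simps)
  qed
  have I_in: "I Z \<in> bcontfun" for Z
  proof -
    have "continuous_on {0..} (\<lambda>t. integral {0..t} (G Z))"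
      unfolding continuous_on_eq_continuous_within
    proof
      fix t :: real assume "t \<in> {0..}"
      have "continuous_on {0..t + 1} (\<lambda>t. integral {0..t} (G Z))"
        by (rule indefinite_integral_continuous_1[OF int])
      then have "continuous (at t within {0..t + 1}) (\<lambda>t. integral {0..t} (G Z))"
        using \<open>t \<in> {0..}\<close> by (auto simp: continuous_on_eq_continuous_within)
      moreover have "at t within {0..t + 1} = at t within {0..}"
        by (rule at_within_nhd[of t "{..<t + 1}"]) auto
      ultimately show "continuous (at t within {0..}) (\<lambda>t. integral {0..t} (G Z))" by simp
    qed
    then have "continuous_on UNIV (\<lambda>t. integral {0..max 0 t} (G Z))"
      by (rule continuous_on_compose2) (auto intro!: continuous_intros)
    then have "continuous_on UNIV (I Z)"
      unfolding I_def by (intro continuous_intros)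
    moreover have "norm (I Z t) \<le> F / (2 * L)" for t
    proof -
      have "norm (I Z t) = exp (- (2 * L * max 0 t)) * norm (integral {0..max 0 t} (G Z))" by (simp add: I_def)
      also have "\<dots> \<le> exp (- (2 * L * max 0 t)) * (F * max 0 t)" by (intro mult_left_mono intb) auto
      also have "\<dots> = F * (max 0 t * exp (- (2 * L * max 0 t)))" by simp
      also have "\<dots> \<le> F * (1 / (2 * L))" using F_pos by (intro mult_left_mono texp) auto
      finally show ?thesis by simp
    qed
    ultimately show ?thesis by (auto simp: bcontfun_def bounded_iff)
  qed
  have app: "apply_bcontfun (Bcontfun (I Z)) = I Z" for Z
    by (rule Bcontfun_inverse[OF I_in])
  have "dist (Bcontfun (I Z)) (Bcontfun (I Z')) \<le> 1 / 2 * dist Z Z'" for Z Z'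
  proof (rule dist_bound)
    fix t :: real
    define \<tau> where "\<tau> = max 0 t"
    have "\<tau> \<ge> 0" by (simp add: \<tau>_def)
    have expint: "((\<lambda>s. L * dist Z Z' * exp (2 * L * s)) has_integral
        L * dist Z Z' * (exp (2 * L * \<tau>) - 1) / (2 * L)) {0..\<tau>}"
      using \<open>\<tau> \<ge> 0\<close> L_pos by (intro has_integral_exp_interval) auto
    have "norm (integral {0..\<tau>} (\<lambda>s. G Z s - G Z' s)) \<le> integral {0..\<tau>} (\<lambda>s. L * dist Z Z' * exp (2 * L * s))"
    proof (rule Henstock_Kurzweil_Integration.integral_norm_bound_integral)
      show "(\<lambda>s. G Z s - G Z' s) integrable_on {0..\<tau>}" by (intro Henstock_Kurzweil_Integration.integrable_diff int)
      show "(\<lambda>s. L * dist Z Z' * exp (2 * L * s)) integrable_on {0..\<tau>}" using expint by blast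
      fix s
      have "norm (G Z s - G Z' s) \<le> L * norm ((x + exp (2 * L * s) *\<^sub>R Z s) - (x + exp (2 * L * s) *\<^sub>R Z' s))"
        unfolding G_def by (rule lip_f)
      also have "(x + exp (2 * L * s) *\<^sub>R Z s) - (x + exp (2 * L * s) *\<^sub>R Z' s) = exp (2 * L * s) *\<^sub>R (Z s - Z' s)"
        by (simp add: algebra_simps)
      also have "norm (exp (2 * L * s) *\<^sub>R (Z s - Z' s)) = exp (2 * L * s) * dist (Z s) (Z' s)"
        by (simp add: dist_norm)
      also have "L * \<dots> \<le> L * (exp (2 * L * s) * dist Z Z')"
        using L_pos by (intro mult_left_mono dist_bounded) auto
      finally show "norm (G Z s - G Z' s) \<le> L * dist Z Z' * exp (2 * L * s)" by (simp add: mult_ac)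
    qed
    also have "\<dots> \<le> exp (2 * L * \<tau>) * dist Z Z' / 2"
      unfolding integral_unique[OF expint] using L_pos by (simp add: field_simps)
    finally have *: "norm (integral {0..\<tau>} (G Z) - integral {0..\<tau>} (G Z')) \<le> exp (2 * L * \<tau>) * dist Z Z' / 2"
      using int by (simp add: Henstock_Kurzweil_Integration.integral_diff)
    have "dist (I Z t) (I Z' t) = exp (- (2 * L * \<tau>)) * norm (integral {0..\<tau>} (G Z) - integral {0..\<tau>} (G Z'))"
      unfolding I_def \<tau>_def[symmetric] dist_norm scaleR_diff_right[symmetric] by simp
    also have "\<dots> \<le> exp (- (2 * L * \<tau>)) * (exp (2 * L * \<tau>) * dist Z Z' / 2)"
      using * by (intro mult_left_mono) auto
    also have "\<dots> = 1 / 2 * dist Z Z'" by (simp add: exp_minus)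
    finally show "dist (apply_bcontfun (Bcontfun (I Z)) t) (apply_bcontfun (Bcontfun (I Z')) t) \<le> 1 / 2 * dist Z Z'"
      unfolding app .
  qed
  then obtain Z where "Bcontfun (I Z) = Z"
    using banach_fix_type[of "1/2" "\<lambda>Z. Bcontfun (I Z)"] by auto
  then have Z: "apply_bcontfun Z = I Z" using app by metis
  define X where "X = (\<lambda>t. x + exp (2 * L * t) *\<^sub>R Z t)"
  show thesis
  proof
    show "continuous_on {0..} X" unfolding X_def by (intro continuous_intros continuous_on_apply_bcontfun)
    fix t :: real assume "t \<ge> 0"
    have "exp (2 * L * t) *\<^sub>R Z t = integral {0..t} (G Z)"
      unfolding Z I_def using \<open>t \<ge> 0\<close> by (simp add: max_def exp_minus)
    then show "X t = x + integral {0..t} (\<lambda>s. f (X s, a s, b s))"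
      by (simp add: X_def G_def)
  qed
qed

lemma trajectory_exists:
  assumes a: "a \<in> controls" and b: "b \<in> controls"
  shows "\<exists>X. is_trajectory f x a b X"
proof -
  obtain X where cX: "continuous_on {0..} X"
    and X: "\<And>t. t \<ge> 0 \<Longrightarrow> X t = x + integral {0..t} (\<lambda>s. f (X s, a s, b s))"
    by (rule integral_equation_solvable[OF a b, of x]) (rule that; assumption)
  have int: "(\<lambda>s. f (X s, a s, b s)) integrable_on {p..q}" if "0 \<le> p" for p q
    by (rule f_controls_integrable[OF a b cX that])
  then have sol: "solves T x a b X" for T
    unfolding solves_def using X by (auto simp: has_integral_iff)
  define g where "g = (\<lambda>s. if s \<in> {0..} then f (X s, a s, b s) else 0)"
  have "g integrable_on {p..q}" for p q
  proof -
    have "(\<lambda>s. f (X s, a s, b s)) integrable_on ({0..} \<inter> {p..q})"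
      using int[of "max 0 p" q] by simp
    then show ?thesis unfolding g_def by (simp only: integrable_restrict_Int)
  qed
  then obtain N where "negligible N"
    and N: "\<And>t. t > 0 \<Longrightarrow> t \<notin> N \<Longrightarrow> ((\<lambda>u. integral {0..u} g) has_vector_derivative g t) (at t)"
    using indefinite_integral_derivative_AE by blast
  have deriv: "(X has_vector_derivative f (X t, a t, b t)) (at t)" if "t > 0" "t \<notin> N" for t
  proof -
    have "((\<lambda>u. x + integral {0..u} g) has_vector_derivative g t) (at t)"
      using N[OF that] by (auto intro!: derivative_eq_intros)
    then have "(X has_vector_derivative g t) (at t)"
    proof (rule has_vector_derivative_transform_within_open[of _ _ _ "{0<..}"])
      fix u :: real assume "u \<in> {0<..}"
      moreover have "integral {0..u} g = integral {0..u} (\<lambda>s. f (X s, a s, b s))"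
        by (intro Henstock_Kurzweil_Integration.integral_cong) (simp add: g_def)
      ultimately show "x + integral {0..u} g = X u" using X[of u] by simp
    qed (use that in auto)
    then show ?thesis using that by (simp add: g_def)
  qed
  have "is_trajectory f x a b X"
    unfolding is_trajectory_def
  proof (intro conjI allI impI)
    show "X 0 = x" using X[of 0] by simp
    have "{t. \<not> (t > 0 \<longrightarrow> (X has_vector_derivative f (X t, a t, b t)) (at t))} \<subseteq> N" using deriv by blast
    then show "AE t in lebesgue. t > 0 \<longrightarrow> (X has_vector_derivative f (X t, a t, b t)) (at t)"
      using \<open>negligible N\<close> by (intro AE_I'[of N]) (auto simp: negligible_iff_null_sets)
    fix T :: real assume "T \<ge> 0"
    show "abs_continuous_on_interval 0 T X"
      unfolding abs_continuous_on_interval_def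
    proof (intro allI impI)
      fix \<epsilon> :: real assume "\<epsilon> > 0"
      show "\<exists>\<delta>>0. \<forall>I. finite I \<and> (\<forall>(s, t)\<in>I. 0 \<le> s \<and> s \<le> t \<and> t \<le> T) \<and>
        pairwise (\<lambda>i j. {fst i<..<snd i} \<inter> {fst j<..<snd j} = {}) I \<and> (\<Sum>(s, t)\<in>I. t - s) < \<delta>
        \<longrightarrow> (\<Sum>(s, t)\<in>I. norm (X t - X s)) < \<epsilon>"
      proof (intro exI conjI allI impI)
        show "\<epsilon> / F > 0" using \<open>\<epsilon> > 0\<close> F_pos by simp
        fix I :: "(real \<times> real) set"
        assume I: "finite I \<and> (\<forall>(s, t)\<in>I. 0 \<le> s \<and> s \<le> t \<and> t \<le> T) \<and>
          pairwise (\<lambda>i j. {fst i<..<snd i} \<inter> {fst j<..<snd j} = {}) I \<and> (\<Sum>(s, t)\<in>I. t - s) < \<epsilon> / F"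
        have "(\<Sum>(s, t)\<in>I. norm (X t - X s)) \<le> (\<Sum>(s, t)\<in>I. F * (t - s))"
          using I by (intro sum_mono) (auto intro!: solves_lipschitz[OF sol[of T]])
        also have "\<dots> = F * (\<Sum>(s, t)\<in>I. t - s)" by (simp add: sum_distrib_left case_prod_beta)
        also have "\<dots> < F * (\<epsilon> / F)" using I F_pos by (intro mult_strict_left_mono) auto
        finally show "(\<Sum>(s, t)\<in>I. norm (X t - X s)) < \<epsilon>" using F_pos by simp
      qed
    qed
  qed
  then show ?thesis by blast
qed

lemma is_trajectory_solves:
  assumes "is_trajectory f x a b X"
  shows "solves T x a b X"
  unfolding solves_def
proof
  fix t assume t: "t \<in> {0..T}"
  obtain N where "negligible N"
    and N: "\<And>t. t > 0 \<Longrightarrow> t \<notin> N \<Longrightarrow> (X has_vector_derivative f (X t, a t, b t)) (at t)"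
  proof -
    have "AE t in lebesgue. t > 0 \<longrightarrow> (X has_vector_derivative f (X t, a t, b t)) (at t)"
      using assms by (simp add: is_trajectory_def)
    then obtain N where "N \<in> null_sets lebesgue"
      "{t. \<not> (t > 0 \<longrightarrow> (X has_vector_derivative f (X t, a t, b t)) (at t))} \<subseteq> N"
      unfolding eventually_ae_filter by auto
    then show thesis by (intro that[of N]) (auto simp: negligible_iff_null_sets)
  qed
  have "((\<lambda>s. f (X s, a s, b s)) has_integral (X t - X 0)) {0..t}"
  proof (rule ftc_absolutely_continuous)
    show "negligible (insert 0 N)" using \<open>negligible N\<close> by simp
    show "abs_continuous_on_interval 0 t X" using assms t by (simp add: is_trajectory_def)
  qed (use t N in auto)
  then show "((\<lambda>s. f (X s, a s, b s)) has_integral (X t - x)) {0..t}"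
    using assms by (simp add: is_trajectory_def)
qed

lemma traj_solves:
  assumes "a \<in> controls" "b \<in> controls"
  shows "solves T x a b (traj f x a b)"
  unfolding traj_def using someI_ex[OF trajectory_exists[OF assms]] by (rule is_trajectory_solves)

lemma traj_unique:
  assumes "a \<in> controls" "b \<in> controls" and X: "solves T x a b X" and t: "t \<in> {0..T}"
  shows "X t = traj f x a b t"
  using solves_stable[OF X traj_solves[OF assms(1,2), of T x] t] by simp

lemma traj_0 [simp]: "a \<in> controls \<Longrightarrow> b \<in> controls \<Longrightarrow> traj f x a b 0 = x"
  using solves_start[OF traj_solves[of a b 0 x]] by simp

lemma traj_agree:
  assumes "a \<in> controls" "b \<in> controls" "a' \<in> controls" "b' \<in> controls"
    and "agree T a a'" "agree T b b'" and "0 \<le> t" "t \<le> T"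
  shows "traj f x a b t = traj f x a' b' t"
  using solves_agree[OF traj_solves[OF assms(1,2)] assms(5,6)] assms by (intro traj_unique[of _ _ T]) auto

lemma traj_shift:
  assumes "a \<in> controls" "b \<in> controls" "0 \<le> h" "0 \<le> t"
  shows "traj f x a b (h + t) = traj f (traj f x a b h) (shift h a) (shift h b) t"
  using solves_shift[OF traj_solves[OF assms(1,2)] assms(3), of t x] assms
  by (intro traj_unique[of _ _ t]) (auto intro: shift_controls)

lemma traj_stable:
  assumes "a \<in> controls" "b \<in> controls" "0 \<le> t"
  shows "norm (traj f x a b t - traj f y a b t) \<le> 2 * norm (x - y) * exp (2 * L * t)"
  using assms by (intro solves_stable[OF traj_solves traj_solves]) auto

lemma traj_speed:
  assumes "a \<in> controls" "b \<in> controls" "0 \<le> s" "s \<le> t"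
  shows "norm (traj f x a b t - traj f x a b s) \<le> F * (t - s)"
  using assms by (intro solves_lipschitz[OF traj_solves, of _ _ _ _ t]) auto

lemma traj_continuous:
  assumes "a \<in> controls" "b \<in> controls"
  shows "continuous_on {0..} (traj f x a b)"
proof (rule lipschitz_on_continuous_on[of F], rule lipschitz_onI)
  fix s t :: real assume "s \<in> {0..}" "t \<in> {0..}"
  then show "dist (traj f x a b s) (traj f x a b t) \<le> F * dist s t"
    using traj_speed[OF assms, of s t x] traj_speed[OF assms, of t s x]
    by (cases "s \<le> t") (auto simp: dist_norm norm_minus_commute)
qed (use F_pos in simp)

lemma traj_periodic:
  assumes "a \<in> controls" "b \<in> controls" "0 \<le> t" "z \<in> int_lattice"
  shows "traj f (x + z) a b t = traj f x a b t + z"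
proof -
  have "f (traj f x a b s + z, a s, b s) = f (traj f x a b s, a s, b s)" for s
    using per_f assms(4) unfolding periodic_in_state_def by blast
  then have "solves t (x + z) a b (\<lambda>s. traj f x a b s + z)"
    using traj_solves[OF assms(1,2), of t x] unfolding solves_def by simp
  from traj_unique[OF assms(1,2) this, of t] assms show ?thesis by simp
qed

lemma traj_has_integral:
  assumes "a \<in> controls" "b \<in> controls" "0 \<le> t"
  shows "((\<lambda>s. f (traj f x a b s, a s, b s)) has_integral (traj f x a b t - x)) {0..t}"
  using traj_solves[OF assms(1,2), of t x] assms(3) by (auto simp: solves_def)

end

section \<open>Strategies\<close>

lemma strategies_controls: "\<alpha> \<in> strategies \<Longrightarrow> b \<in> controls \<Longrightarrow> \<alpha> b \<in> controls"
  by (auto simp: strategies_def)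

lemma strategies_agree:
  assumes "\<alpha> \<in> strategies" "b1 \<in> controls" "b2 \<in> controls" "agree t b1 b2"
  shows "agree t (\<alpha> b1) (\<alpha> b2)"
proof (cases "t > 0")
  case True
  then show ?thesis using assms unfolding strategies_def agree_def by blast
next
  case False
  then show ?thesis by (intro agree_nonpos) simp
qed

lemma strategiesI:
  assumes "\<And>b. b \<in> controls \<Longrightarrow> \<alpha> b \<in> controls"
    and "\<And>t b1 b2. t > 0 \<Longrightarrow> b1 \<in> controls \<Longrightarrow> b2 \<in> controls \<Longrightarrow> agree t b1 b2 \<Longrightarrow> agree t (\<alpha> b1) (\<alpha> b2)"
  shows "\<alpha> \<in> strategies"
  using assms unfolding strategies_def agree_def by blast

lemma const_strategies [simp]: "(\<lambda>b s. c) \<in> strategies"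
  by (rule strategiesI) auto

lemma tail_strategies:
  fixes \<alpha> :: "(real \<Rightarrow> 'b::topological_space) \<Rightarrow> real \<Rightarrow> 'a::topological_space"
  assumes "\<alpha> \<in> strategies" "b0 \<in> controls" "0 \<le> h"
  shows "(\<lambda>b. shift h (\<alpha> (switch h b0 b))) \<in> strategies"
proof (rule strategiesI)
  fix b :: "real \<Rightarrow> 'b" assume "b \<in> controls"
  then show "shift h (\<alpha> (switch h b0 b)) \<in> controls"
    by (intro shift_controls[OF strategies_controls[OF assms(1) switch_controls[OF assms(2) _ assms(3)]] assms(3)])
next
  fix t and b1 b2 :: "real \<Rightarrow> 'b" assume "t > 0" "b1 \<in> controls" "b2 \<in> controls" "agree t b1 b2"
  then have "agree (h + t) (switch h b0 b1) (switch h b0 b2)"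
    by (intro agree_switch) auto
  then have "agree (h + t) (\<alpha> (switch h b0 b1)) (\<alpha> (switch h b0 b2))"
    using assms \<open>b1 \<in> controls\<close> \<open>b2 \<in> controls\<close> by (intro strategies_agree[OF assms(1)] switch_controls)
  then show "agree t (shift h (\<alpha> (switch h b0 b1))) (shift h (\<alpha> (switch h b0 b2)))"
    using assms(3) by (rule agree_shift)
qed

text \<open>The strategy followed after time \<open>h\<close> may be selected according to what player 2 has done before \<open>h\<close>,
  as long as the selection does not distinguish controls that agree up to \<open>h\<close>.\<close>

lemma switch_strategies:
  fixes \<alpha> :: "(real \<Rightarrow> 'b::topological_space) \<Rightarrow> real \<Rightarrow> 'a::topological_space"
  assumes "\<alpha> \<in> strategies" "0 \<le> h" and sel: "\<And>b. b \<in> controls \<Longrightarrow> sel b \<in> strategies"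
    and eq: "\<And>b1 b2. b1 \<in> controls \<Longrightarrow> b2 \<in> controls \<Longrightarrow> agree h b1 b2 \<Longrightarrow> sel b1 = sel b2"
  shows "(\<lambda>b. switch h (\<alpha> b) (sel b (shift h b))) \<in> strategies"
proof (rule strategiesI)
  fix b :: "real \<Rightarrow> 'b" assume "b \<in> controls"
  then show "switch h (\<alpha> b) (sel b (shift h b)) \<in> controls"
    by (intro switch_controls[OF strategies_controls[OF assms(1)] strategies_controls[OF sel shift_controls] assms(2)] assms(2))
next
  fix t and b1 b2 :: "real \<Rightarrow> 'b"
  assume b: "t > 0" "b1 \<in> controls" "b2 \<in> controls" "agree t b1 b2"
  show "agree t (switch h (\<alpha> b1) (sel b1 (shift h b1))) (switch h (\<alpha> b2) (sel b2 (shift h b2)))"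
  proof (rule agree_switch)
    show "agree (min h t) (\<alpha> b1) (\<alpha> b2)"
      using agree_mono[OF strategies_agree[OF assms(1) b(2,3,4)]] by simp
    show "agree (t - h) (sel b1 (shift h b1)) (sel b2 (shift h b2))"
    proof (cases "h \<le> t")
      case True
      then have "sel b1 = sel b2" using agree_mono[OF b(4)] b by (intro eq) auto
      moreover have "agree (t - h) (shift h b1) (shift h b2)"
        using b \<open>0 \<le> h\<close> by (intro agree_shift) auto
      ultimately show ?thesis
        using strategies_agree[OF sel[OF b(2)], of "shift h b1" "shift h b2"] b \<open>0 \<le> h\<close> by (simp add: shift_controls)
    next
      case False
      then show ?thesis by (intro agree_nonpos) simp
    qed
  qed
qed

section \<open>Discounted payoffs and values\<close>

locale game = control_system f L F
  for f :: "(real^'n) \<times> 'a::metric_space \<times> 'b::metric_space \<Rightarrow> real^'n" and L F +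
  fixes l :: "(real^'n) \<times> 'a \<times> 'b \<Rightarrow> real" and M K :: real
  assumes cont_l: "continuous_on UNIV l" and per_l: "periodic_in_state l"
    and M_pos: "M > 0" and l_bound: "\<bar>l z\<bar> \<le> M"
    and K_pos: "K > 0" and lip_l: "\<bar>l (x, a, b) - l (y, a, b)\<bar> \<le> K * norm (x - y)"
begin

definition cost :: "real \<Rightarrow> real^'n \<Rightarrow> (real \<Rightarrow> 'a) \<Rightarrow> (real \<Rightarrow> 'b) \<Rightarrow> real \<Rightarrow> real" where
  "cost \<delta> x a b s = exp (- (\<delta> * s)) * l (traj f x a b s, a s, b s)"

definition payoff :: "real \<Rightarrow> real^'n \<Rightarrow> (real \<Rightarrow> 'a) \<Rightarrow> (real \<Rightarrow> 'b) \<Rightarrow> real" where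
  "payoff \<delta> x a b = (LINT s:{0..}|lebesgue. cost \<delta> x a b s)"

text \<open>The part of the payoff that is collected up to time \<open>h\<close>. For \<open>\<delta> = 0\<close> it is the undiscounted
  running payoff.\<close>

definition run :: "real \<Rightarrow> real \<Rightarrow> real^'n \<Rightarrow> (real \<Rightarrow> 'a) \<Rightarrow> (real \<Rightarrow> 'b) \<Rightarrow> real" where
  "run \<delta> h x a b = integral {0..h} (cost \<delta> x a b)"

abbreviation "val \<delta> \<equiv> lower_value f l \<delta>"

lemma lower_value_payoff:
  "val \<delta> x = (INF \<alpha>\<in>strategies. SUP b\<in>controls. payoff \<delta> x (\<alpha> b) b)"
  by (simp add: lower_value_def payoff_def cost_def)

lemma cost_measurable:
  assumes a: "a \<in> controls" and b: "b \<in> controls"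
  shows "cost \<delta> x a b \<in> borel_measurable (lebesgue_on {0..})"
proof -
  have "traj f x a b \<in> borel_measurable (lebesgue_on {0..})"
    using traj_continuous[OF a b] by (intro continuous_imp_measurable_on_sets_lebesgue) auto
  then have "(\<lambda>s. l (traj f x a b s, a s, b s)) \<in> borel_measurable (lebesgue_on {0..})"
    using a b unfolding controls_def
    by (intro borel_measurable_state_controls[OF compact_a compact_b cont_l])
  moreover have "(\<lambda>s. exp (- (\<delta> * s))) \<in> borel_measurable (lebesgue_on {0..})"
    by (intro continuous_imp_measurable_on_sets_lebesgue continuous_intros) auto
  ultimately show ?thesis
    unfolding cost_def by (rule borel_measurable_times[rotated])
qed

lemma cost_bound: "\<bar>cost \<delta> x a b s\<bar> \<le> M * exp (- (\<delta> * s))"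
  using mult_left_mono[OF l_bound, of "exp (- (\<delta> * s))"] by (simp add: cost_def abs_mult mult.commute)

lemma cost_integrable:
  assumes a: "a \<in> controls" and b: "b \<in> controls" and "0 \<le> \<delta>"
  shows "cost \<delta> x a b integrable_on {0..h}"
proof (rule integrable_on_bounded_measurable)
  show "cost \<delta> x a b \<in> borel_measurable (lebesgue_on {0..h})"
    by (rule measurable_restrict_mono[OF cost_measurable[OF a b]]) auto
  fix s assume "s \<in> {0..h}"
  then have "M * exp (- (\<delta> * s)) \<le> M * 1" using M_pos \<open>0 \<le> \<delta>\<close> by (intro mult_left_mono) auto
  then show "norm (cost \<delta> x a b s) \<le> M" using cost_bound[of \<delta> x a b s] by simp
qed

lemma exp_integral:
  assumes "0 < (\<delta> :: real)"
  shows "((\<lambda>s. c * exp (- (\<delta> * s))) has_integral c / \<delta>) {0..}"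
  using has_integral_mult_right[OF has_integral_exp_minus_to_infinity[OF assms, of 0], of c] by simp

lemma cost_absolutely_integrable:
  assumes a: "a \<in> controls" and b: "b \<in> controls" and "0 < \<delta>"
  shows "set_integrable lebesgue {0..} (cost \<delta> x a b)"
proof (rule measurable_bounded_by_integrable_imp_absolutely_integrable)
  show "(\<lambda>s. M * exp (- (\<delta> * s))) integrable_on {0..}" using exp_integral[OF \<open>0 < \<delta>\<close>] by blast
qed (use cost_measurable[OF a b] cost_bound in auto)

lemma payoff_eq_integral:
  assumes "a \<in> controls" "b \<in> controls" "0 < \<delta>"
  shows "payoff \<delta> x a b = integral {0..} (cost \<delta> x a b)" "cost \<delta> x a b integrable_on {0..}"
  using set_lebesgue_integral_eq_integral[OF cost_absolutely_integrable[OF assms, of x]]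
  by (simp_all add: payoff_def)

lemma payoff_bound:
  assumes a: "a \<in> controls" and b: "b \<in> controls" and "0 < \<delta>"
  shows "\<bar>payoff \<delta> x a b\<bar> \<le> M / \<delta>"
proof -
  have "norm (integral {0..} (cost \<delta> x a b)) \<le> M / \<delta>"
    using cost_bound by (intro integral_norm_bound_integral'[OF _ cost_measurable[OF a b] _ exp_integral[OF \<open>0 < \<delta>\<close>]]) auto
  then show ?thesis using payoff_eq_integral[OF assms] by simp
qed

lemma run_bound:
  assumes a: "a \<in> controls" and b: "b \<in> controls" and "0 \<le> \<delta>" and "0 \<le> h"
  shows "\<bar>run \<delta> h x a b\<bar> \<le> M * h"
proof -
  have "norm (run \<delta> h x a b) \<le> M * measure lborel (cbox 0 h)"
    unfolding run_def
  proof (rule has_integral_bound)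
    show "(cost \<delta> x a b has_integral integral {0..h} (cost \<delta> x a b)) (cbox 0 h)"
      using integrable_integral[OF cost_integrable[OF a b \<open>0 \<le> \<delta>\<close>]] by simp
    fix s assume "s \<in> cbox 0 h"
    then have "M * exp (- (\<delta> * s)) \<le> M * 1" using M_pos \<open>0 \<le> \<delta>\<close> by (intro mult_left_mono) auto
    then show "norm (cost \<delta> x a b s) \<le> M" using cost_bound[of \<delta> x a b s] by simp
  qed (use M_pos in simp)
  then show ?thesis using \<open>0 \<le> h\<close> by simp
qed

lemma payoff_split:
  assumes a: "a \<in> controls" and b: "b \<in> controls" and "0 < \<delta>" and "0 \<le> h"
  shows "payoff \<delta> x a b = run \<delta> h x a b + exp (- (\<delta> * h)) * payoff \<delta> (traj f x a b h) (shift h a) (shift h b)"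
proof -
  let ?c = "cost \<delta> x a b" and ?c' = "cost \<delta> (traj f x a b h) (shift h a) (shift h b)"
  have si: "set_integrable lebesgue {0..} ?c" by (rule cost_absolutely_integrable[OF a b \<open>0 < \<delta>\<close>])
  have si1: "set_integrable lebesgue {0..h} ?c" by (rule set_integrable_subset[OF si]) auto
  have si2: "set_integrable lebesgue {h..} ?c" by (rule set_integrable_subset[OF si]) (use \<open>0 \<le> h\<close> in auto)
  have "{0..} = {0..h} \<union> {h..}" using \<open>0 \<le> h\<close> by auto
  moreover have "AE s in lebesgue. \<not> (s \<in> {0..h} \<and> s \<in> {h..})"
  proof (rule AE_I'[of "{h}"])
    show "{h} \<in> null_sets lebesgue" using negligible_sing negligible_iff_null_sets by blast
  qed auto
  ultimately have "payoff \<delta> x a b = (LINT s:{0..h}|lebesgue. ?c s) + (LINT s:{h..}|lebesgue. ?c s)"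
    unfolding payoff_def using set_integral_Un_AE[OF _ _ _ si1 si2] by auto
  also have "(LINT s:{0..h}|lebesgue. ?c s) = run \<delta> h x a b"
    unfolding run_def by (rule set_lebesgue_integral_eq_integral(2)[OF si1])
  also have "(LINT s:{h..}|lebesgue. ?c s) = (LINT s|lebesgue. indicator {h..} (h + s) *\<^sub>R ?c (h + s))"
    unfolding set_lebesgue_integral_def
    using lebesgue_integral_real_affine[of 1 "\<lambda>s. indicator {h..} s *\<^sub>R ?c s" h] by simp
  also have "\<dots> = (LINT s|lebesgue. exp (- (\<delta> * h)) * (indicator {0..} s *\<^sub>R ?c' s))"
  proof (rule Bochner_Integration.integral_cong[OF refl])
    fix s
    show "indicator {h..} (h + s) *\<^sub>R ?c (h + s) = exp (- (\<delta> * h)) * (indicator {0..} s *\<^sub>R ?c' s)"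
    proof (cases "0 \<le> s")
      case True
      moreover have "exp (- (\<delta> * (h + s))) = exp (- (\<delta> * h)) * exp (- (\<delta> * s))"
        by (simp add: distrib_left flip: exp_add)
      ultimately have "?c (h + s) = exp (- (\<delta> * h)) * ?c' s"
        using traj_shift[OF a b \<open>0 \<le> h\<close> True] by (simp add: cost_def shift_def add.commute)
      then show ?thesis using True by simp
    qed simp
  qed
  also have "\<dots> = exp (- (\<delta> * h)) * payoff \<delta> (traj f x a b h) (shift h a) (shift h b)"
    unfolding payoff_def set_lebesgue_integral_def by simp
  finally show ?thesis .
qed

lemma run_agree:
  assumes ab: "a \<in> controls" "b \<in> controls" "a' \<in> controls" "b' \<in> controls"
    and "agree h a a'" "agree h b b'"
  shows "run \<delta> h x a b = run \<delta> h x a' b'"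
  unfolding run_def
proof (rule integral_spike)
  show "negligible ({s \<in> {0..h}. a s \<noteq> a' s} \<union> {s \<in> {0..h}. b s \<noteq> b' s})"
    using assms by (simp add: agree_iff_negligible)
  fix s assume "s \<in> {0..h} - ({s \<in> {0..h}. a s \<noteq> a' s} \<union> {s \<in> {0..h}. b s \<noteq> b' s})"
  then show "cost \<delta> x a' b' s = cost \<delta> x a b s"
    using traj_agree[OF ab assms(5,6), of s x] by (simp add: cost_def)
qed

lemma payoff_agree:
  assumes ab: "a \<in> controls" "b \<in> controls" "a' \<in> controls" "b' \<in> controls" and "0 < \<delta>"
    and agr: "\<And>t. agree t a a'" "\<And>t. agree t b b'"
  shows "payoff \<delta> x a b = payoff \<delta> x a' b'"
proof -
  let ?N = "\<lambda>t. {s \<in> {0..t}. a s \<noteq> a' s} \<union> {s \<in> {0..t}. b s \<noteq> b' s}"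
  have "negligible (\<Union>n. ?N (real n))"
    by (rule negligible_Union_nat) (use agr in \<open>simp add: agree_iff_negligible\<close>)
  have "integral {0..} (cost \<delta> x a b) = integral {0..} (cost \<delta> x a' b')"
  proof (rule integral_spike)
    show "negligible (\<Union>n. ?N (real n))" by fact
    fix s assume s: "s \<in> {0..} - (\<Union>n. ?N (real n))"
    obtain n where "s \<le> real n" using real_arch_simple by blast
    with s have "s \<notin> ?N (real n)" by blast
    with s \<open>s \<le> real n\<close> show "cost \<delta> x a' b' s = cost \<delta> x a b s"
      using traj_agree[OF ab agr, of s s x] by (simp add: cost_def)
  qed
  then show ?thesis using payoff_eq_integral ab \<open>0 < \<delta>\<close> by simp
qed

lemma controls_nonempty: "(controls :: (real \<Rightarrow> 'c::topological_space) set) \<noteq> {}"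
  using const_controls by blast

lemma payoff_bdd:
  assumes "\<alpha> \<in> strategies" "0 < \<delta>"
  shows "bdd_above ((\<lambda>b. payoff \<delta> x (\<alpha> b) b) ` controls)"
proof (rule bdd_aboveI2)
  fix b :: "real \<Rightarrow> 'b" assume b: "b \<in> controls"
  show "payoff \<delta> x (\<alpha> b) b \<le> M / \<delta>"
    using payoff_bound[OF strategies_controls[OF assms(1) b] b assms(2), of x] unfolding abs_le_iff by blast
qed

lemma sup_payoff_ge:
  assumes "\<alpha> \<in> strategies" "b \<in> controls" "0 < \<delta>"
  shows "payoff \<delta> x (\<alpha> b) b \<le> (SUP b\<in>controls. payoff \<delta> x (\<alpha> b) b)"
  using assms(2) payoff_bdd[OF assms(1,3)] by (rule cSUP_upper)

lemma sup_payoff_bdd: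
  assumes "0 < \<delta>"
  shows "bdd_below ((\<lambda>\<alpha>. SUP b\<in>controls. payoff \<delta> x (\<alpha> b) b) ` strategies)"
proof (rule bdd_belowI2)
  fix \<alpha> :: "(real \<Rightarrow> 'b) \<Rightarrow> real \<Rightarrow> 'a" assume \<alpha>: "\<alpha> \<in> strategies"
  obtain b :: "real \<Rightarrow> 'b" where b: "b \<in> controls" using controls_nonempty by blast
  show "- (M / \<delta>) \<le> (SUP b\<in>controls. payoff \<delta> x (\<alpha> b) b)"
    using sup_payoff_ge[OF \<alpha> b assms, of x] payoff_bound[OF strategies_controls[OF \<alpha> b] b assms, of x]
    unfolding abs_le_iff by linarith
qed

lemma val_le:
  assumes "\<alpha> \<in> strategies" "0 < \<delta>" "\<And>b. b \<in> controls \<Longrightarrow> payoff \<delta> x (\<alpha> b) b \<le> c"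
  shows "val \<delta> x \<le> c"
proof -
  have "val \<delta> x \<le> (SUP b\<in>controls. payoff \<delta> x (\<alpha> b) b)"
    unfolding lower_value_payoff by (rule cINF_lower[OF sup_payoff_bdd[OF assms(2)] assms(1)])
  also have "\<dots> \<le> c" by (rule cSUP_least[OF controls_nonempty assms(3)])
  finally show ?thesis .
qed

lemma strategies_nonempty: "(strategies :: ((real \<Rightarrow> 'b) \<Rightarrow> real \<Rightarrow> 'a) set) \<noteq> {}"
  using const_strategies by blast

lemma val_ge:
  assumes "0 < \<delta>" "\<And>\<alpha>. \<alpha> \<in> strategies \<Longrightarrow> \<exists>b\<in>controls. c \<le> payoff \<delta> x (\<alpha> b) b"
  shows "c \<le> val \<delta> x"
  unfolding lower_value_payoff
proof (rule cINF_greatest[OF strategies_nonempty])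
  fix \<alpha> :: "(real \<Rightarrow> 'b) \<Rightarrow> real \<Rightarrow> 'a" assume "\<alpha> \<in> strategies"
  with assms obtain b where "b \<in> controls" "c \<le> payoff \<delta> x (\<alpha> b) b" by blast
  with sup_payoff_ge[OF \<open>\<alpha> \<in> strategies\<close> this(1) assms(1), of x]
  show "c \<le> (SUP b\<in>controls. payoff \<delta> x (\<alpha> b) b)" by linarith
qed

lemma near_optimal_strategy:
  assumes "0 < \<delta>" "0 < \<eta>"
  obtains \<alpha> where "\<alpha> \<in> strategies" "\<And>b. b \<in> controls \<Longrightarrow> payoff \<delta> x (\<alpha> b) b \<le> val \<delta> x + \<eta>"
proof (rule ccontr)
  assume "\<not> thesis"
  then have "\<And>\<alpha>. \<alpha> \<in> strategies \<Longrightarrow> \<exists>b\<in>controls. val \<delta> x + \<eta> \<le> payoff \<delta> x (\<alpha> b) b"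
    using that by (meson linear)
  from val_ge[OF assms(1) this] assms(2) show False by simp
qed

lemma near_optimal_control:
  assumes "\<alpha> \<in> strategies" "0 < \<delta>" "0 < \<eta>"
  obtains b where "b \<in> controls" "val \<delta> x - \<eta> \<le> payoff \<delta> x (\<alpha> b) b"
proof (rule ccontr)
  assume "\<not> thesis"
  then have "\<And>b. b \<in> controls \<Longrightarrow> payoff \<delta> x (\<alpha> b) b \<le> val \<delta> x - \<eta>" using that by force
  from val_le[OF assms(1,2) this] assms(3) show False by simp
qed

lemma val_bound:
  assumes "0 < \<delta>" shows "\<bar>\<delta> * val \<delta> x\<bar> \<le> M"
proof -
  obtain \<alpha> :: "(real \<Rightarrow> 'b) \<Rightarrow> real \<Rightarrow> 'a" where \<alpha>: "\<alpha> \<in> strategies" using strategies_nonempty by blast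
  have "val \<delta> x \<le> M / \<delta>"
  proof (rule val_le[OF \<alpha> assms])
    fix b :: "real \<Rightarrow> 'b" assume b: "b \<in> controls"
    show "payoff \<delta> x (\<alpha> b) b \<le> M / \<delta>"
      using payoff_bound[OF strategies_controls[OF \<alpha> b] b assms, of x] unfolding abs_le_iff by blast
  qed
  moreover have "- (M / \<delta>) \<le> val \<delta> x"
  proof (rule val_ge[OF assms])
    fix \<alpha> :: "(real \<Rightarrow> 'b) \<Rightarrow> real \<Rightarrow> 'a" assume \<alpha>: "\<alpha> \<in> strategies"
    obtain b :: "real \<Rightarrow> 'b" where b: "b \<in> controls" using controls_nonempty by blast
    show "\<exists>b\<in>controls. - (M / \<delta>) \<le> payoff \<delta> x (\<alpha> b) b"
    proof
      show "- (M / \<delta>) \<le> payoff \<delta> x (\<alpha> b) b"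
        using payoff_bound[OF strategies_controls[OF \<alpha> b] b assms, of x] unfolding abs_le_iff by linarith
    qed (rule b)
  qed
  ultimately show ?thesis using assms by (simp add: abs_le_iff field_simps)
qed

section \<open>Dynamic programming\<close>

text \<open>After any start \<open>b\<close> of player 2, the remainder of \<open>\<alpha>\<close> is a strategy for the game that begins at the
  point reached, so player 2 can still obtain at least the value there.\<close>

lemma dynamic_programming_strategy:
  assumes \<alpha>: "\<alpha> \<in> strategies" and "0 < \<delta>" and opt: "\<And>b. b \<in> controls \<Longrightarrow> payoff \<delta> x (\<alpha> b) b \<le> c"
    and b: "b \<in> controls" and "0 \<le> h"
  shows "run \<delta> h x (\<alpha> b) b + exp (- (\<delta> * h)) * val \<delta> (traj f x (\<alpha> b) b h) \<le> c"
proof -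
  define y where "y = traj f x (\<alpha> b) b h"
  have "val \<delta> y \<le> exp (\<delta> * h) * (c - run \<delta> h x (\<alpha> b) b)"
  proof (rule val_le[OF tail_strategies[OF \<alpha> b \<open>0 \<le> h\<close>] \<open>0 < \<delta>\<close>])
    fix b' :: "real \<Rightarrow> 'b" assume b': "b' \<in> controls"
    define bb where "bb = switch h b b'"
    have bb: "bb \<in> controls" using b b' \<open>0 \<le> h\<close> by (simp add: bb_def switch_controls)
    have agb: "agree h bb b" by (simp add: bb_def agree_switch_left)
    have aga: "agree h (\<alpha> bb) (\<alpha> b)" by (rule strategies_agree[OF \<alpha> bb b agb])
    note ctr = strategies_controls[OF \<alpha> bb] bb strategies_controls[OF \<alpha> b] b
    have "payoff \<delta> x (\<alpha> bb) bb = run \<delta> h x (\<alpha> bb) bb +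
        exp (- (\<delta> * h)) * payoff \<delta> (traj f x (\<alpha> bb) bb h) (shift h (\<alpha> bb)) (shift h bb)"
      using ctr \<open>0 < \<delta>\<close> \<open>0 \<le> h\<close> by (intro payoff_split)
    also have "run \<delta> h x (\<alpha> bb) bb = run \<delta> h x (\<alpha> b) b" by (rule run_agree[OF ctr aga agb])
    also have "traj f x (\<alpha> bb) bb h = y"
      unfolding y_def by (rule traj_agree[OF ctr aga agb \<open>0 \<le> h\<close> order_refl])
    also have "payoff \<delta> y (shift h (\<alpha> bb)) (shift h bb) = payoff \<delta> y (shift h (\<alpha> bb)) b'"
      using ctr b' \<open>0 \<le> h\<close> \<open>0 < \<delta>\<close> by (intro payoff_agree) (auto simp: shift_controls bb_def shift_switch_agree)
    finally have "run \<delta> h x (\<alpha> b) b + exp (- (\<delta> * h)) * payoff \<delta> y (shift h (\<alpha> bb)) b' \<le> c"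
      using opt[OF bb] by simp
    then show "payoff \<delta> y (shift h (\<alpha> (switch h b b'))) b' \<le> exp (\<delta> * h) * (c - run \<delta> h x (\<alpha> b) b)"
      by (simp add: bb_def exp_minus field_simps)
  qed
  then show ?thesis unfolding y_def[symmetric] by (simp add: exp_minus field_simps)
qed

text \<open>Otherwise player 1 could use \<open>\<alpha>\<close> up to time \<open>h\<close> and continue with an almost optimal strategy for
  the point reached. The point depends only on the past of \<open>b\<close>, so this is a strategy.\<close>

lemma dynamic_programming_control:
  assumes \<alpha>: "\<alpha> \<in> strategies" and "0 < \<delta>" "0 < \<eta>" "0 \<le> h"
  obtains b where "b \<in> controls"
    "val \<delta> x - \<eta> \<le> run \<delta> h x (\<alpha> b) b + exp (- (\<delta> * h)) * val \<delta> (traj f x (\<alpha> b) b h)"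
proof -
  have "\<exists>\<beta>. \<beta> \<in> strategies \<and> (\<forall>b\<in>controls. payoff \<delta> y (\<beta> b) b \<le> val \<delta> y + \<eta> / 2)" for y
    using near_optimal_strategy[OF \<open>0 < \<delta>\<close>, of "\<eta> / 2" y] \<open>0 < \<eta>\<close> by (metis half_gt_zero)
  then obtain S where S: "\<And>y. S y \<in> strategies" "\<And>y b. b \<in> controls \<Longrightarrow> payoff \<delta> y (S y b) b \<le> val \<delta> y + \<eta> / 2"
    by metis
  define sel where "sel = (\<lambda>b. S (traj f x (\<alpha> b) b h))"
  define \<alpha>' where "\<alpha>' = (\<lambda>b. switch h (\<alpha> b) (sel b (shift h b)))"
  have \<alpha>': "\<alpha>' \<in> strategies"
    unfolding \<alpha>'_def
  proof (rule switch_strategies[OF \<alpha> \<open>0 \<le> h\<close>])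
    fix b1 b2 :: "real \<Rightarrow> 'b" assume b: "b1 \<in> controls" "b2 \<in> controls" "agree h b1 b2"
    then have "traj f x (\<alpha> b1) b1 h = traj f x (\<alpha> b2) b2 h"
      using strategies_agree[OF \<alpha> b] strategies_controls[OF \<alpha> b(1)] strategies_controls[OF \<alpha> b(2)] \<open>0 \<le> h\<close>
      by (intro traj_agree[of _ _ _ _ h]) auto
    then show "sel b1 = sel b2" by (simp add: sel_def)
  qed (simp add: sel_def S(1))
  obtain b where b: "b \<in> controls" and opt: "val \<delta> x - \<eta> / 2 \<le> payoff \<delta> x (\<alpha>' b) b"
    using near_optimal_control[OF \<alpha>' \<open>0 < \<delta>\<close>, of "\<eta> / 2" x] \<open>0 < \<eta>\<close> by auto
  define y where "y = traj f x (\<alpha> b) b h"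
  have aga: "agree h (\<alpha>' b) (\<alpha> b)" by (simp add: \<alpha>'_def agree_switch_left)
  have sb: "shift h b \<in> controls" using b \<open>0 \<le> h\<close> by (rule shift_controls)
  note ctr = strategies_controls[OF \<alpha>' b] b strategies_controls[OF \<alpha> b] b
  have "payoff \<delta> x (\<alpha>' b) b = run \<delta> h x (\<alpha>' b) b +
      exp (- (\<delta> * h)) * payoff \<delta> (traj f x (\<alpha>' b) b h) (shift h (\<alpha>' b)) (shift h b)"
    using ctr \<open>0 < \<delta>\<close> \<open>0 \<le> h\<close> by (intro payoff_split)
  also have "run \<delta> h x (\<alpha>' b) b = run \<delta> h x (\<alpha> b) b" by (rule run_agree[OF ctr aga agree_refl])
  also have "traj f x (\<alpha>' b) b h = y"
    unfolding y_def by (rule traj_agree[OF ctr aga agree_refl \<open>0 \<le> h\<close> order_refl])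
  also have "payoff \<delta> y (shift h (\<alpha>' b)) (shift h b) = payoff \<delta> y (S y (shift h b)) (shift h b)"
    using ctr sb strategies_controls[OF S(1) sb] \<open>0 \<le> h\<close> \<open>0 < \<delta>\<close>
    by (intro payoff_agree) (auto simp: shift_controls \<alpha>'_def sel_def y_def shift_switch_agree)
  also have "exp (- (\<delta> * h)) * \<dots> \<le> exp (- (\<delta> * h)) * (val \<delta> y + \<eta> / 2)"
    by (intro mult_left_mono S(2) sb) auto
  also have "\<dots> \<le> exp (- (\<delta> * h)) * val \<delta> y + \<eta> / 2"
    using \<open>0 < \<delta>\<close> \<open>0 \<le> h\<close> \<open>0 < \<eta>\<close> mult_right_mono[of "exp (- (\<delta> * h))" 1 "\<eta> / 2"] by (simp add: distrib_left)
  finally show thesis using that[OF b] opt unfolding y_def by (simp add: algebra_simps)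
qed

end

section \<open>Almost optimal actions in a static game\<close>

text \<open>Player 2 chooses \<open>b\<close> without knowing the action of player 1, who answers by \<open>s b\<close>; both are almost
  optimal for the same number \<open>c = sup\<^sub>b inf\<^sub>a \<phi> (a, b)\<close>. An answer that is good for \<open>b\<close> is good on a
  neighbourhood of \<open>b\<close>, and finitely many such neighbourhoods cover the compact set of actions, so
  \<open>s\<close> can be taken with finitely many values on Borel pieces.\<close>

lemma minimax_selection:
  fixes \<phi> :: "'a::metric_space \<times> 'b::metric_space \<Rightarrow> real"
  assumes cA: "compact (UNIV :: 'a set)" and cB: "compact (UNIV :: 'b set)"
    and \<phi>: "continuous_on UNIV \<phi>" and "0 < \<eta>"
  obtains c b s where "s \<in> borel_measurable borel" "\<And>a. c - \<eta> \<le> \<phi> (a, b)" "\<And>b'. \<phi> (s b', b') \<le> c + \<eta>"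
proof -
  have "compact (\<phi> ` UNIV)"
    using compact_Times[OF cA cB] by (intro compact_continuous_image \<phi>) simp
  then have "bounded (range \<phi>)" by (rule compact_imp_bounded)
  then obtain B where B: "\<And>z. \<bar>\<phi> z\<bar> \<le> B" unfolding bounded_iff by auto
  define m where "m = (\<lambda>b. INF a. \<phi> (a, b))"
  have bdd: "bdd_below (range (\<lambda>a. \<phi> (a, b)))" for b
    using B by (intro bdd_belowI2[of _ "- B"]) (simp add: abs_le_iff minus_le_iff)
  have m_le: "m b \<le> \<phi> (a, b)" for a b
    unfolding m_def by (rule cINF_lower[OF bdd]) simp
  have "bdd_above (range m)"
  proof (rule bdd_aboveI2)
    fix b show "m b \<le> B" using m_le[of b undefined] B[of "(undefined, b)"] by linarith
  qed
  define c where "c = (SUP b. m b)"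
  have m_c: "m b \<le> c" for b unfolding c_def by (rule cSUP_upper[OF _ \<open>bdd_above (range m)\<close>]) simp
  have "c - \<eta> < c" using \<open>0 < \<eta>\<close> by simp
  then obtain b0 where b0: "c - \<eta> < m b0"
    unfolding c_def using less_cSUP_iff[OF _ \<open>bdd_above (range m)\<close>] by auto
  have "\<exists>a. \<phi> (a, b) < c + \<eta>" for b
  proof -
    have "m b < c + \<eta>" using m_c[of b] \<open>0 < \<eta>\<close> by simp
    then show ?thesis unfolding m_def using cINF_less_iff[OF _ bdd] by auto
  qed
  then obtain r where r: "\<And>b. \<phi> (r b, b) < c + \<eta>" by metis
  define U where "U = (\<lambda>b. {b'. \<phi> (r b, b') < c + \<eta>})"
  have openU: "open (U b)" for b
    unfolding U_def by (intro open_Collect_less continuous_on_const continuous_on_compose2[OF \<phi>]) (auto intro!: continuous_intros)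
  obtain C where C: "finite C" "UNIV \<subseteq> (\<Union>b\<in>C. U b)"
    by (rule compactE_image[OF cB, of UNIV U]) (use openU r in \<open>auto simp: U_def\<close>)
  have "\<exists>s \<in> borel_measurable borel. \<forall>b'\<in>(\<Union>b\<in>C. U b). \<phi> (s b', b') < c + \<eta>"
    using C(1)
  proof (induction C)
    case empty
    show ?case by (intro bexI[of _ "\<lambda>_. undefined"]) auto
  next
    case (insert b C)
    then obtain s where s: "s \<in> borel_measurable borel" "\<forall>b'\<in>(\<Union>b\<in>C. U b). \<phi> (s b', b') < c + \<eta>" by blast
    have "(\<lambda>b'. if b' \<in> U b then r b else s b') \<in> borel_measurable borel"
      using s(1) openU[of b] by (intro measurable_If_set) auto
    moreover have "\<forall>b'\<in>(\<Union>b\<in>insert b C. U b). \<phi> (if b' \<in> U b then r b else s b', b') < c + \<eta>"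
      using s(2) by (auto simp: U_def)
    ultimately show ?case by (intro bexI[of _ "\<lambda>b'. if b' \<in> U b then r b else s b'"])
  qed
  then obtain s where s: "s \<in> borel_measurable borel" "\<And>b'. \<phi> (s b', b') < c + \<eta>" using C(2) by blast
  show thesis
  proof (rule that[OF s(1)])
    show "c - \<eta> \<le> \<phi> (a, b0)" for a using m_le[of b0 a] b0 by linarith
    show "\<phi> (s b', b') \<le> c + \<eta>" for b' using s(2)[of b'] by linarith
  qed
qed

section \<open>Elementary estimates for discount factors\<close>

lemma exp_diff_bound:
  fixes s :: real assumes "0 \<le> \<mu>" "\<mu> \<le> \<delta>" "0 \<le> s"
  shows "0 \<le> exp (- (\<mu> * s)) - exp (- (\<delta> * s))" "exp (- (\<mu> * s)) - exp (- (\<delta> * s)) \<le> (\<delta> - \<mu>) * s"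
proof -
  have *: "exp (- (\<mu> * s)) - exp (- (\<delta> * s)) = exp (- (\<mu> * s)) * (1 - exp (- ((\<delta> - \<mu>) * s)))"
    by (simp add: right_diff_distrib left_diff_distrib flip: exp_add)
  have 1: "0 \<le> 1 - exp (- ((\<delta> - \<mu>) * s))" using assms by simp
  show "0 \<le> exp (- (\<mu> * s)) - exp (- (\<delta> * s))" unfolding * using 1 by simp
  have "exp (- (\<mu> * s)) * (1 - exp (- ((\<delta> - \<mu>) * s))) \<le> 1 * (1 - exp (- ((\<delta> - \<mu>) * s)))"
    using assms 1 by (intro mult_right_mono) auto
  also have "\<dots> \<le> (\<delta> - \<mu>) * s" using exp_ge_add_one_self[of "- ((\<delta> - \<mu>) * s)"] by simp
  finally show "exp (- (\<mu> * s)) - exp (- (\<delta> * s)) \<le> (\<delta> - \<mu>) * s" unfolding * .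
qed

text \<open>Divide the assumption by \<open>T\<close> and let \<open>T\<close> tend to \<open>0\<close>.\<close>

lemma discount_derivative_limit:
  fixes C S m :: real
  assumes "0 < \<mu>" "\<mu> \<le> \<delta>"
    and le: "\<And>T. 0 < T \<Longrightarrow> (1 - exp (- (\<mu> * T))) * S \<le> C * T\<^sup>2 + (exp (- (\<mu> * T)) - exp (- (\<delta> * T))) * m"
  shows "\<mu> * S \<le> (\<delta> - \<mu>) * m"
proof -
  have lim: "((\<lambda>T. (1 - exp (- (c * T))) / T) \<longlongrightarrow> c) (at_right 0)" for c :: real
  proof -
    have "((\<lambda>T. 1 - exp (- (c * T))) has_real_derivative c) (at_right 0)"
      by (auto intro!: derivative_eq_intros)
    then show ?thesis by (simp add: has_field_derivative_iff)
  qed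
  have T: "((\<lambda>T::real. T) \<longlongrightarrow> 0) (at_right 0)" by (rule tendsto_ident_at)
  have 1: "((\<lambda>T. (1 - exp (- (\<mu> * T))) / T * S) \<longlongrightarrow> \<mu> * S) (at_right 0)"
    by (intro tendsto_intros lim)
  have 2: "((\<lambda>T. C * T + ((1 - exp (- (\<delta> * T))) / T - (1 - exp (- (\<mu> * T))) / T) * m) \<longlongrightarrow> C * 0 + (\<delta> - \<mu>) * m) (at_right 0)"
    by (intro tendsto_intros lim T)
  have "\<forall>\<^sub>F T in at_right 0. (1 - exp (- (\<mu> * T))) / T * S \<le>
      C * T + ((1 - exp (- (\<delta> * T))) / T - (1 - exp (- (\<mu> * T))) / T) * m"
    unfolding eventually_at_right_field
  proof (intro exI conjI allI impI)
    fix T :: real assume "0 < T" "T < 1"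
    have "(1 - exp (- (\<mu> * T))) / T * S = ((1 - exp (- (\<mu> * T))) * S) / T" by simp
    also have "\<dots> \<le> (C * T\<^sup>2 + (exp (- (\<mu> * T)) - exp (- (\<delta> * T))) * m) / T"
      using le[OF \<open>0 < T\<close>] \<open>0 < T\<close> by (intro divide_right_mono) auto
    also have "\<dots> = C * T + ((1 - exp (- (\<delta> * T))) / T - (1 - exp (- (\<mu> * T))) / T) * m"
      using \<open>0 < T\<close> by (simp add: add_divide_distrib diff_divide_distrib left_diff_distrib power2_eq_square)
    finally show "(1 - exp (- (\<mu> * T))) / T * S \<le> C * T + ((1 - exp (- (\<delta> * T))) / T - (1 - exp (- (\<mu> * T))) / T) * m" .
  qed simp
  from tendsto_le[OF _ 2 1 this] show ?thesis by simp
qed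

section \<open>Continuity of the value\<close>

context game begin

text \<open>Up to time \<open>S\<close> the trajectories from \<open>x\<close> and \<open>y\<close> stay within \<open>2 |x - y| exp (2 L S)\<close> of each
  other, and afterwards the payoff is discounted by \<open>exp (- \<delta> S)\<close>. With \<open>S\<close> of order \<open>1 / \<delta>\<close> this is small for
  \<open>|x - y|\<close> of order \<open>exp (- p / \<delta>)\<close>.\<close>

lemma payoff_close:
  assumes a: "a \<in> controls" and b: "b \<in> controls" and "0 < \<delta>" and "0 \<le> S"
  shows "\<delta> * (payoff \<delta> x a b - payoff \<delta> y a b) \<le> 2 * K * norm (x - y) * exp (2 * L * S) + 2 * M * exp (- (\<delta> * S))"
proof -
  define C where "C = 2 * K * norm (x - y) * exp (2 * L * S)"
  have "C \<ge> 0" using K_pos by (simp add: C_def)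
  have Cint: "((\<lambda>s. C * exp (- (\<delta> * s))) has_integral C * (1 - exp (- (\<delta> * S))) / \<delta>) {0..S}"
    by (rule has_integral_discount_interval[OF assms(3,4)])
  have "norm (integral {0..S} (\<lambda>s. cost \<delta> x a b s - cost \<delta> y a b s)) \<le> integral {0..S} (\<lambda>s. C * exp (- (\<delta> * s)))"
  proof (rule Henstock_Kurzweil_Integration.integral_norm_bound_integral)
    show "(\<lambda>s. cost \<delta> x a b s - cost \<delta> y a b s) integrable_on {0..S}"
      using \<open>0 < \<delta>\<close> by (intro Henstock_Kurzweil_Integration.integrable_diff cost_integrable[OF a b]) auto
    show "(\<lambda>s. C * exp (- (\<delta> * s))) integrable_on {0..S}" using Cint by blast
    fix s assume s: "s \<in> {0..S}"
    have "norm (cost \<delta> x a b s - cost \<delta> y a b s) =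
        exp (- (\<delta> * s)) * \<bar>l (traj f x a b s, a s, b s) - l (traj f y a b s, a s, b s)\<bar>"
      unfolding cost_def by (simp add: abs_mult flip: right_diff_distrib)
    also have "\<dots> \<le> exp (- (\<delta> * s)) * (K * norm (traj f x a b s - traj f y a b s))"
      by (intro mult_left_mono lip_l) auto
    also have "\<dots> \<le> exp (- (\<delta> * s)) * (K * (2 * norm (x - y) * exp (2 * L * s)))"
      using s K_pos by (intro mult_left_mono traj_stable[OF a b]) auto
    also have "\<dots> \<le> exp (- (\<delta> * s)) * (K * (2 * norm (x - y) * exp (2 * L * S)))"
      using s K_pos L_pos by (intro mult_left_mono) auto
    finally show "norm (cost \<delta> x a b s - cost \<delta> y a b s) \<le> C * exp (- (\<delta> * s))" by (simp add: C_def mult_ac)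
  qed
  also have "\<dots> \<le> C / \<delta>"
    unfolding integral_unique[OF Cint] using \<open>C \<ge> 0\<close> \<open>0 < \<delta>\<close> by (intro divide_right_mono mult_left_le) auto
  finally have "\<bar>run \<delta> S x a b - run \<delta> S y a b\<bar> \<le> C / \<delta>"
    unfolding run_def using cost_integrable[OF a b] \<open>0 < \<delta>\<close> by (simp add: Henstock_Kurzweil_Integration.integral_diff)
  then have 1: "run \<delta> S x a b - run \<delta> S y a b \<le> C / \<delta>" by linarith
  define P where "P = (\<lambda>x. payoff \<delta> (traj f x a b S) (shift S a) (shift S b))"
  have P: "\<bar>P x\<bar> \<le> M / \<delta>" for x
    unfolding P_def using \<open>0 \<le> S\<close> \<open>0 < \<delta>\<close> by (intro payoff_bound shift_controls a b)
  have "exp (- (\<delta> * S)) * (P x - P y) \<le> exp (- (\<delta> * S)) * (2 * (M / \<delta>))"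
    using P[of x] P[of y] by (intro mult_left_mono) auto
  then have "payoff \<delta> x a b - payoff \<delta> y a b \<le> C / \<delta> + exp (- (\<delta> * S)) * (2 * (M / \<delta>))"
    using 1 payoff_split[OF a b \<open>0 < \<delta>\<close> \<open>0 \<le> S\<close>, of x] payoff_split[OF a b \<open>0 < \<delta>\<close> \<open>0 \<le> S\<close>, of y]
    by (simp add: P_def right_diff_distrib)
  then have "\<delta> * (payoff \<delta> x a b - payoff \<delta> y a b) \<le> \<delta> * (C / \<delta> + exp (- (\<delta> * S)) * (2 * (M / \<delta>)))"
    using \<open>0 < \<delta>\<close> by (intro mult_left_mono) auto
  also have "\<dots> = C + 2 * M * exp (- (\<delta> * S))" using \<open>0 < \<delta>\<close> by (simp add: field_simps)
  finally show ?thesis by (simp add: C_def)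
qed

lemma val_close:
  assumes "0 < \<delta>" and "0 \<le> S"
  shows "\<bar>\<delta> * val \<delta> x - \<delta> * val \<delta> y\<bar> \<le> 2 * K * norm (x - y) * exp (2 * L * S) + 2 * M * exp (- (\<delta> * S))"
proof -
  let ?c = "\<lambda>x y. 2 * K * norm (x - y) * exp (2 * L * S) + 2 * M * exp (- (\<delta> * S))"
  have "\<delta> * val \<delta> x - \<delta> * val \<delta> y \<le> ?c x y" for x y
  proof (rule field_le_epsilon)
    fix e :: real assume "0 < e"
    obtain \<alpha> where \<alpha>: "\<alpha> \<in> strategies" and opt: "\<And>b. b \<in> controls \<Longrightarrow> payoff \<delta> y (\<alpha> b) b \<le> val \<delta> y + e / \<delta>"
      using near_optimal_strategy[OF \<open>0 < \<delta>\<close>, of "e / \<delta>" y] \<open>0 < e\<close> \<open>0 < \<delta>\<close> by auto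
    have "val \<delta> x \<le> val \<delta> y + e / \<delta> + ?c x y / \<delta>"
    proof (rule val_le[OF \<alpha> \<open>0 < \<delta>\<close>])
      fix b :: "real \<Rightarrow> 'b" assume b: "b \<in> controls"
      have "payoff \<delta> x (\<alpha> b) b - payoff \<delta> y (\<alpha> b) b \<le> ?c x y / \<delta>"
        using payoff_close[OF strategies_controls[OF \<alpha> b] b assms, of x y] \<open>0 < \<delta>\<close>
        by (simp add: pos_le_divide_eq mult.commute)
      then show "payoff \<delta> x (\<alpha> b) b \<le> val \<delta> y + e / \<delta> + ?c x y / \<delta>" using opt[OF b] by linarith
    qed
    then have "\<delta> * val \<delta> x \<le> \<delta> * (val \<delta> y + e / \<delta> + ?c x y / \<delta>)" using \<open>0 < \<delta>\<close> by (intro mult_left_mono) auto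
    also have "\<dots> = \<delta> * val \<delta> y + e + ?c x y" using \<open>0 < \<delta>\<close> by (simp add: field_simps)
    finally show "\<delta> * val \<delta> x - \<delta> * val \<delta> y \<le> ?c x y + e" by simp
  qed
  from this[of x y] this[of y x] show ?thesis by (simp add: norm_minus_commute)
qed

lemma val_uniformly_continuous:
  assumes "0 < \<delta>" "0 < e"
  obtains r where "0 < r" "\<And>x y. norm (x - y) \<le> r \<Longrightarrow> \<bar>\<delta> * val \<delta> x - \<delta> * val \<delta> y\<bar> \<le> e"
proof -
  define S where "S = 4 * M / e / \<delta>"
  have "0 \<le> S" using assms M_pos by (simp add: S_def)
  have "2 * M * exp (- (\<delta> * S)) \<le> e / 2"
  proof -
    have "4 * M / e \<le> exp (4 * M / e)" using exp_ge_add_one_self[of "4 * M / e"] by linarith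
    then have "exp (- (4 * M / e)) \<le> e / (4 * M)" using M_pos \<open>0 < e\<close> by (simp add: exp_minus field_simps)
    moreover have "\<delta> * S = 4 * M / e" using \<open>0 < \<delta>\<close> by (simp add: S_def)
    ultimately show ?thesis using M_pos by (simp add: field_simps)
  qed
  define r where "r = e / 2 / (2 * K * exp (2 * L * S))"
  show thesis
  proof
    show "0 < r" using \<open>0 < e\<close> K_pos by (simp add: r_def)
    fix x y :: "real^'n" assume "norm (x - y) \<le> r"
    then have "2 * K * norm (x - y) * exp (2 * L * S) \<le> e / 2" using K_pos by (simp add: r_def field_simps)
    with val_close[OF \<open>0 < \<delta>\<close> \<open>0 \<le> S\<close>, of x y] \<open>2 * M * exp (- (\<delta> * S)) \<le> e / 2\<close>
    show "\<bar>\<delta> * val \<delta> x - \<delta> * val \<delta> y\<bar> \<le> e" by linarith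
  qed
qed

lemma val_periodic:
  assumes "z \<in> int_lattice"
  shows "val \<delta> (x + z) = val \<delta> x"
proof -
  have "payoff \<delta> (x + z) (\<alpha> b) b = payoff \<delta> x (\<alpha> b) b" if "\<alpha> \<in> strategies" "b \<in> controls" for \<alpha> b
    unfolding payoff_def
  proof (rule set_lebesgue_integral_cong)
    have "l (traj f x (\<alpha> b) b s + z, \<alpha> b s, b s) = l (traj f x (\<alpha> b) b s, \<alpha> b s, b s)" for s
      using per_l assms unfolding periodic_in_state_def by blast
    then show "\<forall>s. s \<in> {0..} \<longrightarrow> cost \<delta> (x + z) (\<alpha> b) b s = cost \<delta> x (\<alpha> b) b s"
      using traj_periodic[OF strategies_controls[OF that] that(2) _ assms] by (simp add: cost_def)
  qed simp
  then show ?thesis unfolding lower_value_payoff by (intro INF_cong SUP_cong refl) auto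
qed

section \<open>Extremal values for different discount factors\<close>

definition hi where "hi \<delta> = (SUP x. \<delta> * val \<delta> x)"
definition lo where "lo \<delta> = (INF x. \<delta> * val \<delta> x)"

lemma val_hi: "0 < \<delta> \<Longrightarrow> \<delta> * val \<delta> x \<le> hi \<delta>"
  unfolding hi_def using val_bound by (intro cSUP_upper bdd_aboveI2[of _ _ M]) (auto simp: abs_le_iff)

lemma val_lo: "0 < \<delta> \<Longrightarrow> lo \<delta> \<le> \<delta> * val \<delta> x"
  unfolding lo_def using val_bound by (intro cINF_lower bdd_belowI2[of _ "- M"]) (auto simp: abs_le_iff minus_le_iff)

lemma hi_near: assumes "0 < \<eta>" obtains x where "hi \<delta> - \<eta> \<le> \<delta> * val \<delta> x"
proof (rule ccontr)
  assume "\<not> thesis"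
  then have "\<And>x. \<delta> * val \<delta> x \<le> hi \<delta> - \<eta>" using \<open>\<not> thesis\<close> that linear by blast
  then have "hi \<delta> \<le> hi \<delta> - \<eta>" unfolding hi_def by (intro cSUP_least) auto
  with assms show False by simp
qed

lemma lo_near: assumes "0 < \<eta>" obtains x where "\<delta> * val \<delta> x \<le> lo \<delta> + \<eta>"
proof (rule ccontr)
  assume "\<not> thesis"
  then have "\<And>x. lo \<delta> + \<eta> \<le> \<delta> * val \<delta> x" using \<open>\<not> thesis\<close> that linear by blast
  then have "lo \<delta> + \<eta> \<le> lo \<delta>" unfolding lo_def by (intro cINF_greatest) auto
  with assms show False by simp
qed

lemma run_discount_diff:
  assumes a: "a \<in> controls" and b: "b \<in> controls" and "0 \<le> \<mu>" "\<mu> \<le> \<delta>" "0 \<le> T"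
  shows "\<bar>run \<mu> T x a b - run \<delta> T x a b\<bar> \<le> M * (\<delta> - \<mu>) * T\<^sup>2"
proof -
  have i: "cost \<mu> x a b integrable_on {0..T}" "cost \<delta> x a b integrable_on {0..T}"
    using assms by (auto intro!: cost_integrable)
  have "norm (integral {0..T} (\<lambda>s. cost \<mu> x a b s - cost \<delta> x a b s)) \<le> M * (\<delta> - \<mu>) * T * measure lborel (cbox 0 T)"
  proof (rule has_integral_bound)
    show "((\<lambda>s. cost \<mu> x a b s - cost \<delta> x a b s) has_integral integral {0..T} (\<lambda>s. cost \<mu> x a b s - cost \<delta> x a b s)) (cbox 0 T)"
      using integrable_integral[OF Henstock_Kurzweil_Integration.integrable_diff[OF i]] by simp
    fix s assume s: "s \<in> cbox 0 T"
    then have e: "0 \<le> exp (- (\<mu> * s)) - exp (- (\<delta> * s))" "exp (- (\<mu> * s)) - exp (- (\<delta> * s)) \<le> (\<delta> - \<mu>) * s"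
      using exp_diff_bound[OF assms(3,4), of s] by auto
    have "norm (cost \<mu> x a b s - cost \<delta> x a b s) = \<bar>l (traj f x a b s, a s, b s)\<bar> * (exp (- (\<mu> * s)) - exp (- (\<delta> * s)))"
      unfolding cost_def using e(1) by (simp add: abs_mult mult.commute flip: left_diff_distrib)
    also have "\<dots> \<le> M * ((\<delta> - \<mu>) * s)" using l_bound M_pos e by (intro mult_mono) auto
    also have "\<dots> \<le> M * ((\<delta> - \<mu>) * T)" using M_pos assms s by (intro mult_left_mono) auto
    finally show "norm (cost \<mu> x a b s - cost \<delta> x a b s) \<le> M * (\<delta> - \<mu>) * T" by (simp add: mult.assoc)
  qed (use assms M_pos in simp)
  then show ?thesis
    unfolding run_def using i \<open>0 \<le> T\<close> by (simp add: Henstock_Kurzweil_Integration.integral_diff power2_eq_square mult.assoc)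
qed

text \<open>Play a strategy that is almost optimal for \<open>\<delta>\<close> against a control that is almost optimal for \<open>\<mu>\<close>
  during the time \<open>T\<close>. The running payoffs for the two discount factors differ by \<open>O(T\<^sup>2)\<close> only.\<close>

lemma discount_comparison_step:
  assumes "0 < \<mu>" "0 < \<delta>" "0 < T" "0 < \<eta>"
  shows "\<exists>y. val \<mu> x - val \<delta> x \<le> M * \<bar>\<delta> - \<mu>\<bar> * T\<^sup>2 + \<eta>
           + (exp (- (\<mu> * T)) * val \<mu> y - exp (- (\<delta> * T)) * val \<delta> y)"
proof -
  obtain \<alpha> where \<alpha>: "\<alpha> \<in> strategies" and opt: "\<And>b. b \<in> controls \<Longrightarrow> payoff \<delta> x (\<alpha> b) b \<le> val \<delta> x + \<eta> / 2"
    using near_optimal_strategy[OF \<open>0 < \<delta>\<close>, of "\<eta> / 2" x] \<open>0 < \<eta>\<close> by auto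
  obtain b where b: "b \<in> controls"
    and 1: "val \<mu> x - \<eta> / 2 \<le> run \<mu> T x (\<alpha> b) b + exp (- (\<mu> * T)) * val \<mu> (traj f x (\<alpha> b) b T)"
    using dynamic_programming_control[OF \<alpha> \<open>0 < \<mu>\<close>, of "\<eta> / 2" T x] assms by auto
  have 2: "run \<delta> T x (\<alpha> b) b + exp (- (\<delta> * T)) * val \<delta> (traj f x (\<alpha> b) b T) \<le> val \<delta> x + \<eta> / 2"
    using dynamic_programming_strategy[OF \<alpha> \<open>0 < \<delta>\<close> opt b, of T] assms by auto
  note a = strategies_controls[OF \<alpha> b]
  have "\<bar>run \<mu> T x (\<alpha> b) b - run \<delta> T x (\<alpha> b) b\<bar> \<le> M * \<bar>\<delta> - \<mu>\<bar> * T\<^sup>2"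
    using run_discount_diff[OF a b, of \<mu> \<delta> T x] run_discount_diff[OF a b, of \<delta> \<mu> T x] assms
    by (cases "\<mu> \<le> \<delta>") (auto simp: abs_minus_commute)
  with 1 2 show ?thesis by (intro exI[of _ "traj f x (\<alpha> b) b T"]) (simp add: abs_le_iff)
qed

lemma val_diff_bound:
  assumes "0 < \<mu>" "0 < \<delta>"
  shows "\<bar>val \<mu> x - val \<delta> x\<bar> \<le> M / \<mu> + M / \<delta>"
proof -
  have "\<bar>val \<mu> x\<bar> \<le> M / \<mu>" "\<bar>val \<delta> x\<bar> \<le> M / \<delta>"
    using val_bound[of \<mu> x] val_bound[of \<delta> x] assms by (simp_all add: abs_mult pos_le_divide_eq mult.commute)
  then show ?thesis by linarith
qed

text \<open>If \<open>S\<close> is the supremum of \<open>v\<^sub>\<mu> - v\<^sub>\<delta>\<close>, the comparison step for \<open>T\<close> tending to \<open>0\<close> gives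
  \<open>\<mu> S \<le> (\<delta> - \<mu>) sup v\<^sub>\<delta>\<close>, and \<open>\<mu> v\<^sub>\<mu> \<le> \<mu> S + \<mu> v\<^sub>\<delta>\<close>.\<close>

lemma hi_mono:
  assumes "0 < \<mu>" "\<mu> \<le> \<delta>"
  shows "hi \<mu> \<le> hi \<delta>"
proof -
  have "0 < \<delta>" using assms by simp
  define u where "u = (\<lambda>x. val \<mu> x - val \<delta> x)"
  define S where "S = (SUP x. u x)"
  have "bdd_above (range u)"
    using val_diff_bound[OF \<open>0 < \<mu>\<close> \<open>0 < \<delta>\<close>]
    by (intro bdd_aboveI2[of _ _ "M / \<mu> + M / \<delta>"]) (auto simp: u_def intro: order_trans[OF abs_ge_self])
  then have uS: "u x \<le> S" for x unfolding S_def by (intro cSUP_upper) auto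
  define m where "m = hi \<delta> / \<delta>"
  have vm: "val \<delta> x \<le> m" for x
    using val_hi[OF \<open>0 < \<delta>\<close>, of x] \<open>0 < \<delta>\<close> by (simp add: m_def pos_le_divide_eq mult.commute)
  have "\<mu> * S \<le> (\<delta> - \<mu>) * m"
  proof (rule discount_derivative_limit[OF assms])
    fix T :: real assume "0 < T"
    have "S \<le> M * (\<delta> - \<mu>) * T\<^sup>2 + T\<^sup>2 + exp (- (\<mu> * T)) * S + (exp (- (\<mu> * T)) - exp (- (\<delta> * T))) * m"
      unfolding S_def
    proof (rule cSUP_least)
      fix x
      have "0 < T\<^sup>2" using \<open>0 < T\<close> by simp
      from discount_comparison_step[OF \<open>0 < \<mu>\<close> \<open>0 < \<delta>\<close> \<open>0 < T\<close> this, of x] obtain y where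
        "u x \<le> M * (\<delta> - \<mu>) * T\<^sup>2 + T\<^sup>2 + exp (- (\<mu> * T)) * u y + (exp (- (\<mu> * T)) - exp (- (\<delta> * T))) * val \<delta> y"
        unfolding u_def using assms(2) by (auto simp: algebra_simps)
      also have "\<dots> \<le> M * (\<delta> - \<mu>) * T\<^sup>2 + T\<^sup>2 + exp (- (\<mu> * T)) * S + (exp (- (\<mu> * T)) - exp (- (\<delta> * T))) * m"
        using exp_diff_bound(1)[of \<mu> \<delta> T] assms \<open>0 < T\<close> by (intro order_refl add_mono mult_left_mono uS vm) auto
      finally show "u x \<le> M * (\<delta> - \<mu>) * T\<^sup>2 + T\<^sup>2 + exp (- (\<mu> * T)) * (SUP x. u x) + (exp (- (\<mu> * T)) - exp (- (\<delta> * T))) * m"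
        unfolding S_def .
    qed simp
    then show "(1 - exp (- (\<mu> * T))) * S \<le> (M * (\<delta> - \<mu>) + 1) * T\<^sup>2 + (exp (- (\<mu> * T)) - exp (- (\<delta> * T))) * m"
      by (simp add: algebra_simps)
  qed
  show ?thesis unfolding hi_def[of \<mu>]
  proof (rule cSUP_least)
    fix x
    have "\<mu> * val \<mu> x = \<mu> * u x + \<mu> * val \<delta> x" by (simp add: u_def right_diff_distrib)
    also have "\<dots> \<le> \<mu> * S + \<mu> * m" using \<open>0 < \<mu>\<close> by (intro add_mono mult_left_mono uS vm) auto
    also have "\<dots> \<le> \<delta> * m" using \<open>\<mu> * S \<le> (\<delta> - \<mu>) * m\<close> by (simp add: algebra_simps)
    finally show "\<mu> * val \<mu> x \<le> hi \<delta>" using \<open>0 < \<delta>\<close> by (simp add: m_def)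
  qed simp
qed

lemma lo_mono:
  assumes "0 < \<mu>" "\<mu> \<le> \<delta>"
  shows "lo \<delta> \<le> lo \<mu>"
proof -
  have "0 < \<delta>" using assms by simp
  define u where "u = (\<lambda>x. val \<mu> x - val \<delta> x)"
  define S where "S = (INF x. u x)"
  have "bdd_below (range u)"
  proof (rule bdd_belowI2)
    show "- (M / \<mu> + M / \<delta>) \<le> u x" for x
      using val_diff_bound[OF \<open>0 < \<mu>\<close> \<open>0 < \<delta>\<close>, of x] unfolding u_def abs_le_iff by linarith
  qed
  then have uS: "S \<le> u x" for x unfolding S_def by (intro cINF_lower) auto
  define m where "m = lo \<delta> / \<delta>"
  have vm: "m \<le> val \<delta> x" for x
    using val_lo[OF \<open>0 < \<delta>\<close>, of x] \<open>0 < \<delta>\<close> by (simp add: m_def pos_divide_le_eq mult.commute)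
  have "\<mu> * (- S) \<le> (\<delta> - \<mu>) * (- m)"
  proof (rule discount_derivative_limit[OF assms])
    fix T :: real assume "0 < T"
    have "- (M * (\<delta> - \<mu>) * T\<^sup>2) - T\<^sup>2 + exp (- (\<mu> * T)) * S + (exp (- (\<mu> * T)) - exp (- (\<delta> * T))) * m \<le> S"
      unfolding S_def
    proof (rule cINF_greatest)
      fix x
      have "0 < T\<^sup>2" using \<open>0 < T\<close> by simp
      from discount_comparison_step[OF \<open>0 < \<delta>\<close> \<open>0 < \<mu>\<close> \<open>0 < T\<close> this, of x] obtain y where y:
        "- (M * (\<delta> - \<mu>) * T\<^sup>2) - T\<^sup>2 + exp (- (\<mu> * T)) * u y + (exp (- (\<mu> * T)) - exp (- (\<delta> * T))) * val \<delta> y \<le> u x"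
        unfolding u_def using assms(2) by (auto simp: algebra_simps)
      have "- (M * (\<delta> - \<mu>) * T\<^sup>2) - T\<^sup>2 + exp (- (\<mu> * T)) * S + (exp (- (\<mu> * T)) - exp (- (\<delta> * T))) * m \<le>
          - (M * (\<delta> - \<mu>) * T\<^sup>2) - T\<^sup>2 + exp (- (\<mu> * T)) * u y + (exp (- (\<mu> * T)) - exp (- (\<delta> * T))) * val \<delta> y"
        using exp_diff_bound(1)[of \<mu> \<delta> T] assms \<open>0 < T\<close> by (intro order_refl add_mono mult_left_mono uS vm) auto
      with y show "- (M * (\<delta> - \<mu>) * T\<^sup>2) - T\<^sup>2 + exp (- (\<mu> * T)) * (INF x. u x) + (exp (- (\<mu> * T)) - exp (- (\<delta> * T))) * m \<le> u x"
        unfolding S_def by linarith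
    qed simp
    then show "(1 - exp (- (\<mu> * T))) * (- S) \<le> (M * (\<delta> - \<mu>) + 1) * T\<^sup>2 + (exp (- (\<mu> * T)) - exp (- (\<delta> * T))) * (- m)"
      by (simp add: algebra_simps)
  qed
  then have Sm: "(\<delta> - \<mu>) * m \<le> \<mu> * S" by simp
  show ?thesis unfolding lo_def[of \<mu>]
  proof (rule cINF_greatest)
    fix x
    have "\<delta> * m \<le> \<mu> * S + \<mu> * m" using Sm by (simp add: algebra_simps)
    also have "\<dots> \<le> \<mu> * u x + \<mu> * val \<delta> x" using \<open>0 < \<mu>\<close> by (intro add_mono mult_left_mono uS vm) auto
    also have "\<dots> = \<mu> * val \<mu> x" by (simp add: u_def right_diff_distrib)
    finally show "lo \<delta> \<le> \<mu> * val \<mu> x" using \<open>0 < \<delta>\<close> by (simp add: m_def)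
  qed simp
qed

text \<open>By monotonicity the intervals from \<open>lo \<delta>\<close> to \<open>hi \<delta>\<close> shrink as \<open>\<delta>\<close> decreases, so they have a common
  point, which is the limit.\<close>

lemma ergodic_if_oscillation_vanishes:
  assumes osc: "\<And>\<eta>. 0 < \<eta> \<Longrightarrow> \<exists>\<delta>0>0. \<forall>\<delta>. 0 < \<delta> \<and> \<delta> < \<delta>0 \<longrightarrow> hi \<delta> - lo \<delta> \<le> \<eta>"
  shows "ergodic f l"
proof -
  have lo_hi: "lo \<delta> \<le> hi \<delta>'" if "0 < \<delta>" "0 < \<delta>'" for \<delta> \<delta>'
  proof (cases "\<delta>' \<le> \<delta>")
    case True
    then show ?thesis using lo_mono[OF that(2) True] val_lo[OF that(2), of 0] val_hi[OF that(2), of 0] by linarith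
  next
    case False
    then show ?thesis using hi_mono[OF that(1), of \<delta>'] val_lo[OF that(1), of 0] val_hi[OF that(1), of 0] by linarith
  qed
  define c where "c = (SUP \<delta>\<in>{0<..}. lo \<delta>)"
  have "bdd_above (lo ` {0<..})" using lo_hi[of _ 1] by (intro bdd_aboveI2[of _ _ "hi 1"]) auto
  then have c1: "lo \<delta> \<le> c" if "0 < \<delta>" for \<delta> unfolding c_def using that by (intro cSUP_upper) auto
  have c2: "c \<le> hi \<delta>" if "0 < \<delta>" for \<delta>
    unfolding c_def using lo_hi that by (intro cSUP_least) auto
  show ?thesis unfolding ergodic_def
  proof (rule exI[of _ c], rule uniform_limitI)
    fix e :: real assume "0 < e"
    then obtain \<delta>0 where "\<delta>0 > 0" and \<delta>0: "\<And>\<delta>. 0 < \<delta> \<Longrightarrow> \<delta> < \<delta>0 \<Longrightarrow> hi \<delta> - lo \<delta> \<le> e / 2"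
      using osc[of "e / 2"] by auto
    have "\<forall>x\<in>UNIV. dist (\<delta> * val \<delta> x) c < e" if "0 < \<delta>" "\<delta> < \<delta>0" for \<delta>
      using val_lo[OF that(1)] val_hi[OF that(1)] c1[OF that(1)] c2[OF that(1)] \<delta>0[OF that] \<open>0 < e\<close>
      unfolding dist_real_def abs_less_iff by (smt (verit) field_sum_of_halves)
    then show "\<forall>\<^sub>F \<delta> in at_right 0. \<forall>x\<in>UNIV. dist (\<delta> * val \<delta> x) c < e"
      unfolding eventually_at_right_field using \<open>\<delta>0 > 0\<close> by blast
  qed
qed

section \<open>One step of extremal aiming\<close>

lemma instantaneous_response_strategies:
  fixes s :: "'d::topological_space \<Rightarrow> 'c::topological_space"
  assumes "s \<in> borel_measurable borel"
  shows "(\<lambda>b t. s (b t)) \<in> strategies"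
proof (rule strategiesI)
  fix b :: "real \<Rightarrow> 'd" assume "b \<in> controls"
  then show "(\<lambda>t. s (b t)) \<in> controls"
    unfolding controls_def by (rule measurable_compose[OF _ assms])
next
  fix t and b1 b2 :: "real \<Rightarrow> 'd" assume "agree t b1 b2"
  then show "agree t (\<lambda>t. s (b1 t)) (\<lambda>t. s (b2 t))"
    unfolding agree_def by eventually_elim auto
qed

text \<open>To first order in \<open>h\<close>, the gain of \<open>q \<bullet> X + \<integral> l\<close> along a trajectory is governed by the static
  payoff \<open>q \<bullet> f + l\<close> frozen at a nearby point \<open>z\<close>.\<close>

lemma short_run_bounds:
  fixes x z q :: "real^'n"
  assumes a: "a \<in> controls" and b: "b \<in> controls" and "0 \<le> h"
  defines "J \<equiv> q \<bullet> (traj f x a b h - x) + run 0 h x a b"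
    and "E \<equiv> (L * norm q + K) * (norm (x - z) + F * h)"
  shows "(\<And>s. lb \<le> q \<bullet> f (z, a s, b s) + l (z, a s, b s)) \<Longrightarrow> h * (lb - E) \<le> J"
    and "(\<And>s. q \<bullet> f (z, a s, b s) + l (z, a s, b s) \<le> ub) \<Longrightarrow> J \<le> h * (ub + E)"
proof -
  define X where "X = traj f x a b"
  have c0: "cost 0 x a b = (\<lambda>s. l (X s, a s, b s))" by (simp add: cost_def X_def fun_eq_iff)
  have "((\<lambda>s. q \<bullet> f (X s, a s, b s)) has_integral q \<bullet> (X h - x)) {0..h}"
    using has_integral_linear[OF traj_has_integral[OF a b \<open>0 \<le> h\<close>, of x] bounded_linear_inner_right[of q]]
    by (simp add: o_def X_def)
  moreover have "((\<lambda>s. l (X s, a s, b s)) has_integral run 0 h x a b) {0..h}"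
    using integrable_integral[OF cost_integrable[OF a b order_refl, of x h]] unfolding run_def c0 .
  ultimately have J: "((\<lambda>s. q \<bullet> f (X s, a s, b s) + l (X s, a s, b s)) has_integral J) {0..h}"
    unfolding J_def X_def by (rule has_integral_add)
  have dev: "\<bar>(q \<bullet> f (X s, a s, b s) + l (X s, a s, b s)) - (q \<bullet> f (z, a s, b s) + l (z, a s, b s))\<bar> \<le> E"
    if "s \<in> {0..h}" for s
  proof -
    have "norm (X s - z) \<le> norm (X s - x) + norm (x - z)"
      using norm_triangle_ineq[of "X s - x" "x - z"] by simp
    moreover have "norm (X s - x) \<le> F * h"
    proof -
      have "norm (X s - x) \<le> F * s" using traj_speed[OF a b order_refl, of s x] that a b by (auto simp: X_def)
      also have "\<dots> \<le> F * h" using that F_pos by (intro mult_left_mono) auto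
      finally show ?thesis .
    qed
    ultimately have d: "norm (X s - z) \<le> norm (x - z) + F * h" by linarith
    have "\<bar>q \<bullet> f (X s, a s, b s) - q \<bullet> f (z, a s, b s)\<bar> \<le> norm q * norm (f (X s, a s, b s) - f (z, a s, b s))"
      unfolding inner_diff_right[symmetric] by (rule Cauchy_Schwarz_ineq2)
    also have "\<dots> \<le> norm q * (L * norm (X s - z))" by (intro mult_left_mono lip_f) auto
    finally have "\<bar>(q \<bullet> f (X s, a s, b s) + l (X s, a s, b s)) - (q \<bullet> f (z, a s, b s) + l (z, a s, b s))\<bar>
        \<le> norm q * (L * norm (X s - z)) + K * norm (X s - z)"
      using lip_l[of "X s" "a s" "b s" z] by linarith
    also have "\<dots> = (L * norm q + K) * norm (X s - z)" by (simp add: algebra_simps)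
    also have "\<dots> \<le> E" unfolding E_def using L_pos K_pos by (intro mult_left_mono d) auto
    finally show ?thesis .
  qed
  have const: "((\<lambda>s. c) has_integral h * c) {0..h}" for c :: real
    using has_integral_const_real[of c 0 h] \<open>0 \<le> h\<close> by simp
  show "h * (lb - E) \<le> J" if "\<And>s. lb \<le> q \<bullet> f (z, a s, b s) + l (z, a s, b s)"
  proof (rule has_integral_le[OF const J])
    fix s assume "s \<in> {0..h}"
    from dev[OF this] that[of s] show "lb - E \<le> q \<bullet> f (X s, a s, b s) + l (X s, a s, b s)" by linarith
  qed
  show "J \<le> h * (ub + E)" if "\<And>s. q \<bullet> f (z, a s, b s) + l (z, a s, b s) \<le> ub"
  proof (rule has_integral_le[OF J const])
    fix s assume "s \<in> {0..h}"
    from dev[OF this] that[of s] show "q \<bullet> f (X s, a s, b s) + l (X s, a s, b s) \<le> ub + E" by linarith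
  qed
qed

text \<open>Let \<open>q = (y - x) / \<sigma>\<close>, and let \<open>b\<close> be almost optimal for player 2 in the static game with payoff
  \<open>q \<bullet> f + l\<close> at \<open>x\<close>. A second trajectory starts at \<open>y\<close>, with player 1 answering instantaneously and
  almost optimally in the same static game; dynamic programming provides a control of player 2 along
  which the value from \<open>y\<close> is almost attained. Per unit of time, the static payoff is then at least
  the minimax value on the first trajectory and at most this value on the second, up to \<open>\<eta>\<close>, \<open>O(h)\<close> and
  the difference of \<open>f\<close> and \<open>l\<close> between \<open>x\<close> and \<open>y\<close>. Expanding
  \<open>|X - Y|\<^sup>2\<close>, the term \<open>q \<bullet> (\<Delta>X - \<Delta>Y)\<close> is what turns this comparison into a bound for \<open>V\<close> at
  the point that is actually reached.\<close>

lemma aiming_step: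
  assumes "0 < \<delta>" "0 < \<sigma>" "0 < h" "0 < \<eta>"
    and V: "\<And>x y. val \<delta> y - (norm (x - y))\<^sup>2 / (2 * \<sigma>) \<le> V x"
    and near: "V x - \<eta> * h \<le> val \<delta> y - (norm (x - y))\<^sup>2 / (2 * \<sigma>)" and d: "norm (x - y) \<le> r"
  obtains b where "\<And>a. a \<in> controls \<Longrightarrow>
    V x - h * (4 * \<eta> + L * (norm (x - y))\<^sup>2 / \<sigma> + K * norm (x - y)) -
      h\<^sup>2 * (2 * (L * r / \<sigma> + K) * F + 2 * M * \<delta> + 2 * \<delta> * F * r / \<sigma> + 2 * F\<^sup>2 / \<sigma>)
    \<le> run \<delta> h x a (\<lambda>_. b) + exp (- (\<delta> * h)) * V (traj f x a (\<lambda>_. b) h)"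
proof -
  define q where "q = (1 / \<sigma>) *\<^sub>R (y - x)"
  have nq: "norm q = norm (x - y) / \<sigma>" using \<open>0 < \<sigma>\<close> by (simp add: q_def norm_minus_commute)
  define Q where "Q = r / \<sigma>"
  have nqQ: "norm q \<le> Q" unfolding nq Q_def using d \<open>0 < \<sigma>\<close> by (simp add: divide_right_mono)
  then have "Q \<ge> 0" by (rule order_trans[OF norm_ge_zero])
  define \<phi> where "\<phi> = (\<lambda>(a, b). q \<bullet> f (x, a, b) + l (x, a, b))"
  have "continuous_on UNIV (\<lambda>z. f (x, fst z, snd z))" "continuous_on UNIV (\<lambda>z. l (x, fst z, snd z))"
    by (rule continuous_on_compose2[OF cont_f] continuous_on_compose2[OF cont_l]; (intro continuous_intros)?; simp)+
  then have "continuous_on UNIV \<phi>"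
    unfolding \<phi>_def case_prod_beta by (intro continuous_intros)
  then obtain c b0 s where s: "s \<in> borel_measurable borel"
    and lower: "\<And>a. c - \<eta> \<le> \<phi> (a, b0)" and upper: "\<And>b. \<phi> (s b, b) \<le> c + \<eta>"
    using minimax_selection[OF compact_a compact_b _ \<open>0 < \<eta>\<close>] by metis
  define \<alpha> where "\<alpha> = (\<lambda>(b :: real \<Rightarrow> 'b) t. s (b t))"
  have \<alpha>: "\<alpha> \<in> strategies" unfolding \<alpha>_def by (rule instantaneous_response_strategies[OF s])
  obtain b where b: "b \<in> controls"
    and dp: "val \<delta> y - \<eta> * h \<le> run \<delta> h y (\<alpha> b) b + exp (- (\<delta> * h)) * val \<delta> (traj f y (\<alpha> b) b h)"
    using dynamic_programming_control[OF \<alpha> \<open>0 < \<delta>\<close>, of "\<eta> * h" h y] assms by auto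
  show thesis
  proof (rule that[of b0])
    fix a :: "real \<Rightarrow> 'a" assume a: "a \<in> controls"
    define D where "D = norm (x - y)"
    have "D \<ge> 0" "D \<le> r" using d by (auto simp: D_def)
    define X where "X = traj f x a (\<lambda>_. b0) h"
    define Y where "Y = traj f y (\<alpha> b) b h"
    define e where "e = exp (- (\<delta> * h))"
    have e: "0 \<le> e" "e \<le> 1" "1 - e \<le> \<delta> * h"
      using \<open>0 < \<delta>\<close> \<open>0 < h\<close> exp_ge_add_one_self[of "- (\<delta> * h)"] by (auto simp: e_def)
    note ac = strategies_controls[OF \<alpha> b]
    have sx: "norm (X - x) \<le> F * h" and sy: "norm (Y - y) \<le> F * h"
      using traj_speed[OF a const_controls order_refl, of h x] traj_speed[OF ac b order_refl, of h y] a b ac \<open>0 < h\<close>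
      by (auto simp: X_def Y_def)
    have step: "norm ((X - x) - (Y - y)) \<le> 2 * F * h"
      using norm_triangle_ineq4[of "X - x" "Y - y"] sx sy by linarith
    define R1 R2 R1' R2' where "R1 = run \<delta> h x a (\<lambda>_. b0)" and "R2 = run \<delta> h y (\<alpha> b) b"
      and "R1' = run 0 h x a (\<lambda>_. b0)" and "R2' = run 0 h y (\<alpha> b) b"
    have R: "\<bar>R1' - R1\<bar> \<le> M * \<delta> * h\<^sup>2" "\<bar>R2' - R2\<bar> \<le> M * \<delta> * h\<^sup>2"
      unfolding R1_def R2_def R1'_def R2'_def
      using run_discount_diff[OF a const_controls, of 0 \<delta> h] run_discount_diff[OF ac b, of 0 \<delta> h] \<open>0 < \<delta>\<close> \<open>0 < h\<close>
      by auto
    have lowX: "h * (c - \<eta> - (L * norm q + K) * (F * h)) \<le> q \<bullet> (X - x) + R1'"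
      using short_run_bounds(1)[OF a const_controls, of h "c - \<eta>" q x b0 x] lower \<open>0 < h\<close>
      by (simp add: \<phi>_def X_def R1'_def)
    have upY: "q \<bullet> (Y - y) + R2' \<le> h * (c + \<eta> + (L * norm q + K) * (D + F * h))"
      using short_run_bounds(2)[OF ac b, of h q x "c + \<eta>" y] upper \<open>0 < h\<close>
      by (simp add: \<phi>_def \<alpha>_def Y_def R2'_def D_def norm_minus_commute)
    have qin: "\<bar>q \<bullet> ((X - x) - (Y - y))\<bar> \<le> Q * (2 * F * h)"
      using Cauchy_Schwarz_ineq2[of q "(X - x) - (Y - y)"] mult_mono[OF nqQ step \<open>Q \<ge> 0\<close> norm_ge_zero] by linarith
    have sq: "(norm (X - Y))\<^sup>2 / (2 * \<sigma>) \<le> D\<^sup>2 / (2 * \<sigma>) - q \<bullet> ((X - x) - (Y - y)) + 2 * F\<^sup>2 * h\<^sup>2 / \<sigma>"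
    proof -
      define w where "w = (X - x) - (Y - y)"
      have "X - Y = (x - y) + w" by (simp add: w_def)
      then have "(norm (X - Y))\<^sup>2 = D\<^sup>2 + 2 * ((x - y) \<bullet> w) + (norm w)\<^sup>2"
        unfolding D_def power2_norm_eq_inner by (simp add: inner_add_left inner_add_right inner_commute)
      moreover have "(x - y) \<bullet> w = - \<sigma> * (q \<bullet> w)"
        using \<open>0 < \<sigma>\<close> by (simp add: q_def inner_diff_left)
      moreover have "(norm w)\<^sup>2 \<le> (2 * F * h)\<^sup>2" using step by (intro power_mono) (auto simp: w_def)
      ultimately have "(norm (X - Y))\<^sup>2 \<le> D\<^sup>2 - 2 * \<sigma> * (q \<bullet> w) + 4 * F\<^sup>2 * h\<^sup>2"
        by (simp add: power_mult_distrib)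
      then have "(norm (X - Y))\<^sup>2 / (2 * \<sigma>) \<le> (D\<^sup>2 - 2 * \<sigma> * (q \<bullet> w) + 4 * F\<^sup>2 * h\<^sup>2) / (2 * \<sigma>)"
        using \<open>0 < \<sigma>\<close> by (intro divide_right_mono) auto
      also have "\<dots> = D\<^sup>2 / (2 * \<sigma>) - q \<bullet> w + 2 * F\<^sup>2 * h\<^sup>2 / \<sigma>"
        using \<open>0 < \<sigma>\<close> by (simp add: field_simps)
      finally show ?thesis unfolding w_def .
    qed
    define I where "I = q \<bullet> ((X - x) - (Y - y))"
    \<comment> \<open>test the supremum \<open>V X\<close> with the end point \<open>Y\<close> of the second trajectory\<close>
    have VX: "val \<delta> Y - D\<^sup>2 / (2 * \<sigma>) + I - 2 * F\<^sup>2 * h\<^sup>2 / \<sigma> \<le> V X"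
      using V[of Y X] sq unfolding I_def by linarith
    have "e * (val \<delta> Y - D\<^sup>2 / (2 * \<sigma>) + I - 2 * F\<^sup>2 * h\<^sup>2 / \<sigma>) \<le> e * V X"
      by (rule mult_left_mono[OF VX e(1)])
    moreover have "e * (val \<delta> Y - D\<^sup>2 / (2 * \<sigma>) + I - 2 * F\<^sup>2 * h\<^sup>2 / \<sigma>)
        = e * val \<delta> Y - e * (D\<^sup>2 / (2 * \<sigma>)) + e * I - e * (2 * F\<^sup>2 * h\<^sup>2 / \<sigma>)"
      by (simp add: algebra_simps)
    moreover have "e * (D\<^sup>2 / (2 * \<sigma>)) \<le> D\<^sup>2 / (2 * \<sigma>)"
      using e \<open>0 < \<sigma>\<close> by (intro mult_left_le_one_le) auto
    moreover have "e * (2 * F\<^sup>2 * h\<^sup>2 / \<sigma>) \<le> 2 * F\<^sup>2 * h\<^sup>2 / \<sigma>"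
      using e \<open>0 < \<sigma>\<close> by (intro mult_left_le_one_le) auto
    moreover have "I - \<delta> * h * (Q * (2 * F * h)) \<le> e * I"
    proof -
      have "(1 - e) * I \<le> (1 - e) * (Q * (2 * F * h))"
        using qin e unfolding I_def by (intro mult_left_mono) auto
      also have "\<dots> \<le> \<delta> * h * (Q * (2 * F * h))"
        using e \<open>Q \<ge> 0\<close> F_pos \<open>0 < h\<close> by (intro mult_right_mono) auto
      finally show ?thesis by (simp add: algebra_simps)
    qed
    ultimately have "e * val \<delta> Y - D\<^sup>2 / (2 * \<sigma>) + I - \<delta> * h * (Q * (2 * F * h)) - 2 * F\<^sup>2 * h\<^sup>2 / \<sigma> \<le> e * V X"
      by linarith
    moreover have "val \<delta> y - \<eta> * h - R2 \<le> e * val \<delta> Y" using dp by (simp add: R2_def e_def Y_def)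
    moreover have "V x - \<eta> * h \<le> val \<delta> y - D\<^sup>2 / (2 * \<sigma>)" using near by (simp add: D_def)
    moreover have "I = q \<bullet> (X - x) - q \<bullet> (Y - y)" by (simp add: I_def inner_diff_right)
    ultimately have "V x - 2 * (\<eta> * h) + h * (c - \<eta> - (L * norm q + K) * (F * h)) -
        h * (c + \<eta> + (L * norm q + K) * (D + F * h)) - 2 * (M * \<delta> * h\<^sup>2)
        - \<delta> * h * (Q * (2 * F * h)) - 2 * F\<^sup>2 * h\<^sup>2 / \<sigma> \<le> R1 + e * V X"
      using lowX upY R by linarith
    moreover have "h * (c - \<eta> - (L * norm q + K) * (F * h)) - h * (c + \<eta> + (L * norm q + K) * (D + F * h))
      = - (2 * (\<eta> * h)) - h * (L * D\<^sup>2 / \<sigma> + K * D) - h\<^sup>2 * (2 * (L * norm q + K) * F)"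
      unfolding nq D_def[symmetric] using \<open>0 < \<sigma>\<close> by (simp add: field_simps power2_eq_square)
    moreover have "h\<^sup>2 * (2 * (L * norm q + K) * F) \<le> h\<^sup>2 * (2 * (L * Q + K) * F)"
      using nqQ L_pos F_pos by (intro mult_left_mono mult_right_mono add_mono) auto
    ultimately have "V x - 4 * (\<eta> * h) - h * (L * D\<^sup>2 / \<sigma> + K * D) - h\<^sup>2 * (2 * (L * Q + K) * F)
        - 2 * (M * \<delta> * h\<^sup>2) - \<delta> * h * (Q * (2 * F * h)) - 2 * F\<^sup>2 * h\<^sup>2 / \<sigma> \<le> R1 + e * V X"
      by linarith
    moreover have "V x - 4 * (\<eta> * h) - h * (L * D\<^sup>2 / \<sigma> + K * D) - h\<^sup>2 * (2 * (L * Q + K) * F)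
        - 2 * (M * \<delta> * h\<^sup>2) - \<delta> * h * (Q * (2 * F * h)) - 2 * F\<^sup>2 * h\<^sup>2 / \<sigma>
      = V x - h * (4 * \<eta> + L * D\<^sup>2 / \<sigma> + K * D) -
      h\<^sup>2 * (2 * (L * r / \<sigma> + K) * F + 2 * M * \<delta> + 2 * \<delta> * F * r / \<sigma> + 2 * F\<^sup>2 / \<sigma>)"
      unfolding Q_def by (simp add: algebra_simps power2_eq_square)
    ultimately show "V x - h * (4 * \<eta> + L * (norm (x - y))\<^sup>2 / \<sigma> + K * norm (x - y)) -
      h\<^sup>2 * (2 * (L * r / \<sigma> + K) * F + 2 * M * \<delta> + 2 * \<delta> * F * r / \<sigma> + 2 * F\<^sup>2 / \<sigma>)
      \<le> run \<delta> h x a (\<lambda>_. b0) + exp (- (\<delta> * h)) * V (traj f x a (\<lambda>_. b0) h)"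
      unfolding D_def[symmetric] R1_def e_def X_def by linarith
  qed
qed

text \<open>For small \<open>\<sigma>\<close> the near-maximizer \<open>y\<close> is close to \<open>x\<close>, and then even
  \<open>|x - y|\<^sup>2 / \<sigma>\<close> is small because it is bounded by a multiple of the oscillation of the value between \<open>x\<close> and \<open>y\<close>,
  up to the tolerance in the choice of \<open>y\<close>.
  This controls the error per unit of time in the aiming step; the quadratic error is
  absorbed by the choice of \<open>h\<close>, which comes last.\<close>

lemma feedback_step:
  assumes "0 < \<delta>" "0 < \<eta>" "0 < h0"
  obtains V g h where "0 < h" "h \<le> h0"
    "\<And>x. val \<delta> x \<le> V x" "\<And>x. V x \<le> val \<delta> x + \<eta>"
    "\<And>x a. a \<in> controls \<Longrightarrow>
       V x - \<eta> * h \<le> run \<delta> h x a (\<lambda>_. g x) + exp (- (\<delta> * h)) * V (traj f x a (\<lambda>_. g x) h)"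
proof -
  define W where "W = M / \<delta>"
  have "W > 0" using M_pos \<open>0 < \<delta>\<close> by (simp add: W_def)
  have W: "\<bar>val \<delta> x\<bar> \<le> W" for x
    using val_bound[OF \<open>0 < \<delta>\<close>, of x] \<open>0 < \<delta>\<close> by (simp add: W_def abs_mult pos_le_divide_eq mult.commute)
  \<comment> \<open>with the following choices of \<open>e\<close>, \<open>r\<close> and \<open>h\<close> each of the four error terms is at most \<open>\<eta> / 4\<close>\<close>
  define e where "e = \<eta> / (16 * (1 + L))"
  have "e > 0" using \<open>0 < \<eta>\<close> L_pos by (simp add: e_def)
  have e: "16 * e \<le> \<eta>" "16 * (L * e) \<le> \<eta>"
    using \<open>0 < \<eta>\<close> L_pos by (simp_all add: e_def field_simps)
  obtain r0 where "0 < r0" and r0: "\<And>x y. norm (x - y) \<le> r0 \<Longrightarrow> \<bar>\<delta> * val \<delta> x - \<delta> * val \<delta> y\<bar> \<le> \<delta> * e"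
    using val_uniformly_continuous[OF \<open>0 < \<delta>\<close>, of "\<delta> * e"] \<open>0 < \<delta>\<close> \<open>e > 0\<close> by auto
  have cont: "\<bar>val \<delta> x - val \<delta> y\<bar> \<le> e" if "norm (x - y) \<le> r0" for x y
  proof -
    have "\<delta> * \<bar>val \<delta> x - val \<delta> y\<bar> \<le> \<delta> * e"
      using r0[OF that] \<open>0 < \<delta>\<close> by (simp add: abs_mult flip: right_diff_distrib)
    then show ?thesis using \<open>0 < \<delta>\<close> by simp
  qed
  define r where "r = min r0 (\<eta> / (4 * K))"
  have r: "0 < r" "r \<le> r0" "K * r \<le> \<eta> / 4"
  proof -
    show "0 < r" using \<open>0 < r0\<close> \<open>0 < \<eta>\<close> K_pos by (simp add: r_def)
    have "K * r \<le> K * (\<eta> / (4 * K))" using K_pos by (intro mult_left_mono) (auto simp: r_def)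
    then show "K * r \<le> \<eta> / 4" using K_pos by simp
  qed (simp add: r_def)
  \<comment> \<open>with the crude bound \<open>2 W + e\<close> for the oscillation of the value this ensures \<open>|x - y| \<le> r\<close>\<close>
  define \<sigma> where "\<sigma> = r\<^sup>2 / (2 * (2 * W + e))"
  have "\<sigma> > 0" using r \<open>W > 0\<close> \<open>e > 0\<close> by (simp add: \<sigma>_def)
  have \<sigma>: "(2 * W + e) * (2 * \<sigma>) = r\<^sup>2" using \<open>W > 0\<close> \<open>e > 0\<close> by (simp add: \<sigma>_def field_simps)
  define C where "C = 2 * (L * r / \<sigma> + K) * F + 2 * M * \<delta> + 2 * \<delta> * F * r / \<sigma> + 2 * F\<^sup>2 / \<sigma>"
  have "C > 0" unfolding C_def using L_pos K_pos F_pos M_pos r \<open>\<sigma> > 0\<close> \<open>0 < \<delta>\<close> by (intro add_pos_pos mult_pos_pos divide_pos_pos) auto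
  define h where "h = min (min 1 h0) (\<eta> / (4 * C))"
  have h: "0 < h" "h \<le> 1" "h \<le> h0" "h * C \<le> \<eta> / 4"
  proof -
    show "0 < h" using \<open>0 < h0\<close> \<open>0 < \<eta>\<close> \<open>C > 0\<close> by (simp add: h_def)
    have "h * C \<le> (\<eta> / (4 * C)) * C" using \<open>C > 0\<close> by (intro mult_right_mono) (auto simp: h_def)
    then show "h * C \<le> \<eta> / 4" using \<open>C > 0\<close> by simp
  qed (simp_all add: h_def)
  define V where "V = (\<lambda>x. SUP y. val \<delta> y - (norm (x - y))\<^sup>2 / (2 * \<sigma>))"
  have bdd: "bdd_above (range (\<lambda>y. val \<delta> y - (norm (x - y))\<^sup>2 / (2 * \<sigma>)))" for x
  proof (rule bdd_aboveI2)
    fix y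
    have "0 \<le> (norm (x - y))\<^sup>2 / (2 * \<sigma>)" using \<open>\<sigma> > 0\<close> by simp
    with W[of y] show "val \<delta> y - (norm (x - y))\<^sup>2 / (2 * \<sigma>) \<le> W" by linarith
  qed
  have V: "val \<delta> y - (norm (x - y))\<^sup>2 / (2 * \<sigma>) \<le> V x" for x y
    unfolding V_def by (rule cSUP_upper[OF _ bdd]) simp
  have vV: "val \<delta> x \<le> V x" for x using V[of x x] by simp
  have "\<exists>y. V x - e * h \<le> val \<delta> y - (norm (x - y))\<^sup>2 / (2 * \<sigma>)" for x
  proof -
    have "V x - e * h < V x" using \<open>e > 0\<close> h by simp
    then show ?thesis unfolding V_def using less_cSUP_iff[OF UNIV_not_empty bdd] less_imp_le by blast
  qed
  then obtain y where y: "\<And>x. V x - e * h \<le> val \<delta> (y x) - (norm (x - y x))\<^sup>2 / (2 * \<sigma>)" by metis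
  have eh: "e * h \<le> e" using \<open>e > 0\<close> h by simp
  have d: "norm (x - y x) \<le> r" for x
  proof -
    have "(norm (x - y x))\<^sup>2 / (2 * \<sigma>) \<le> 2 * W + e"
      using y[of x] vV[of x] W[of x] W[of "y x"] eh by linarith
    moreover have "0 < 2 * \<sigma>" using \<open>\<sigma> > 0\<close> by simp
    ultimately have "(norm (x - y x))\<^sup>2 \<le> (2 * W + e) * (2 * \<sigma>)" by (rule pos_divide_le_eq[THEN iffD1, rotated])
    then have "(norm (x - y x))\<^sup>2 \<le> r\<^sup>2" unfolding \<sigma> .
    then show ?thesis using less_imp_le[OF r(1)] by (rule power2_le_imp_le)
  qed
  have vy: "\<bar>val \<delta> x - val \<delta> (y x)\<bar> \<le> e" for x
    using cont[OF order_trans[OF d r(2)]] .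
  have dd: "(norm (x - y x))\<^sup>2 / \<sigma> \<le> 4 * e" for x
  proof -
    have "(norm (x - y x))\<^sup>2 / (2 * \<sigma>) \<le> 2 * e"
      using y[of x] vV[of x] vy[of x] eh by linarith
    then show ?thesis using \<open>\<sigma> > 0\<close> by (simp add: field_simps)
  qed
  have Vv: "V x \<le> val \<delta> x + \<eta>" for x
  proof -
    have "0 \<le> (norm (x - y x))\<^sup>2 / (2 * \<sigma>)" using \<open>\<sigma> > 0\<close> by simp
    then show ?thesis using y[of x] vy[of x] eh e(1) \<open>0 < \<eta>\<close> by linarith
  qed
  have "\<exists>b. \<forall>a\<in>controls. V x - \<eta> * h \<le> run \<delta> h x a (\<lambda>_. b) + exp (- (\<delta> * h)) * V (traj f x a (\<lambda>_. b) h)" for x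
  proof -
    obtain b where b: "\<And>a. a \<in> controls \<Longrightarrow>
      V x - h * (4 * e + L * (norm (x - y x))\<^sup>2 / \<sigma> + K * norm (x - y x)) - h\<^sup>2 * C
      \<le> run \<delta> h x a (\<lambda>_. b) + exp (- (\<delta> * h)) * V (traj f x a (\<lambda>_. b) h)"
      using aiming_step[OF \<open>0 < \<delta>\<close> \<open>\<sigma> > 0\<close> h(1) \<open>e > 0\<close> V y[of x] d[of x], folded C_def] by blast
    have "L * (norm (x - y x))\<^sup>2 / \<sigma> \<le> 4 * (L * e)"
      using mult_left_mono[OF dd[of x], of L] L_pos by simp
    moreover have "K * norm (x - y x) \<le> K * r" using K_pos d by (intro mult_left_mono) auto
    ultimately have "4 * e + L * (norm (x - y x))\<^sup>2 / \<sigma> + K * norm (x - y x) + h * C \<le> \<eta>"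
      using e r(3) h(4) by linarith
    then have "h * (4 * e + L * (norm (x - y x))\<^sup>2 / \<sigma> + K * norm (x - y x) + h * C) \<le> h * \<eta>"
      using h by (intro mult_left_mono) auto
    then have le: "V x - \<eta> * h \<le> V x - h * (4 * e + L * (norm (x - y x))\<^sup>2 / \<sigma> + K * norm (x - y x)) - h\<^sup>2 * C"
      by (simp add: distrib_left power2_eq_square mult.commute mult.left_commute)
    show ?thesis using order_trans[OF le b] by blast
  qed
  then obtain g where "\<And>x a. a \<in> controls \<Longrightarrow>
       V x - \<eta> * h \<le> run \<delta> h x a (\<lambda>_. g x) + exp (- (\<delta> * h)) * V (traj f x a (\<lambda>_. g x) h)" by metis
  with that[of h V g] h(1,3) vV Vv show thesis by blast
qed

end

section \<open>Feedback responses\<close>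

context control_system begin

text \<open>The control that results from \<open>g\<close> when the last sampling time is \<open>k * h\<close>: it keeps the last
  sampled value forever. Each stage needs the trajectory against \<open>\<alpha>\<close> of the previous one only.\<close>

primrec feedback_stage ::
  "(real^'n \<Rightarrow> 'b) \<Rightarrow> real \<Rightarrow> real^'n \<Rightarrow> ((real \<Rightarrow> 'b) \<Rightarrow> real \<Rightarrow> 'a) \<Rightarrow> nat \<Rightarrow> real \<Rightarrow> 'b" where
  "feedback_stage g h x \<alpha> 0 = (\<lambda>s. g x)"
| "feedback_stage g h x \<alpha> (Suc k) = switch (real (Suc k) * h) (feedback_stage g h x \<alpha> k)
     (\<lambda>s. g (straj f x \<alpha> (feedback_stage g h x \<alpha> k) (real (Suc k) * h)))"

definition feedback_response ::
  "(real^'n \<Rightarrow> 'b) \<Rightarrow> real \<Rightarrow> real^'n \<Rightarrow> ((real \<Rightarrow> 'b) \<Rightarrow> real \<Rightarrow> 'a) \<Rightarrow> real \<Rightarrow> 'b" where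
  "feedback_response g h x \<alpha> s = feedback_stage g h x \<alpha> (nat \<lfloor>s / h\<rfloor>) s"

lemma feedback_stage_controls:
  assumes "0 < h"
  shows "feedback_stage g h x \<alpha> k \<in> controls"
proof (induction k)
  case (Suc k)
  then show ?case unfolding feedback_stage.simps using assms by (intro switch_controls const_controls) auto
qed simp

lemma feedback_stage_stable:
  assumes "0 < h" "j \<le> k" "s < real (Suc j) * h"
  shows "feedback_stage g h x \<alpha> k s = feedback_stage g h x \<alpha> j s"
  using assms(2)
proof (induction k rule: dec_induct)
  case (step k)
  have "real (Suc j) * h \<le> real (Suc k) * h" using step \<open>0 < h\<close> by (intro mult_right_mono) auto
  then show ?case using step assms(3) by (simp add: switch_def)
qed simp

lemma feedback_response_stage:
  assumes "0 < h" "s < real (Suc k) * h"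
  shows "feedback_response g h x \<alpha> s = feedback_stage g h x \<alpha> k s"
proof -
  have "s / h < real (Suc k)" using assms by (simp add: pos_divide_less_eq)
  then have "nat \<lfloor>s / h\<rfloor> \<le> k" by linarith
  moreover have "s / h < real (Suc (nat \<lfloor>s / h\<rfloor>))" by linarith
  then have "s < real (Suc (nat \<lfloor>s / h\<rfloor>)) * h" using \<open>0 < h\<close> by (simp add: pos_divide_less_eq)
  ultimately show ?thesis
    unfolding feedback_response_def using feedback_stage_stable[OF \<open>0 < h\<close>] by simp
qed

lemma feedback_response_controls:
  assumes "0 < h"
  shows "feedback_response g h x \<alpha> \<in> controls"
proof -
  have "(\<lambda>s. nat \<lfloor>s / h\<rfloor>) \<in> borel \<rightarrow>\<^sub>M count_space UNIV" by measurable
  then have "(\<lambda>s. nat \<lfloor>s / h\<rfloor>) \<in> lebesgue_on {0..} \<rightarrow>\<^sub>M count_space UNIV"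
    by (intro measurable_restrict_space1 measurable_completion) simp
  from measurable_compose_countable[OF _ this, of "feedback_stage g h x \<alpha>" borel] feedback_stage_controls[OF assms]
  show ?thesis by (simp add: controls_def feedback_response_def[abs_def])
qed

lemma feedback_response_agree_stage:
  "0 < h \<Longrightarrow> agree (real (Suc k) * h) (feedback_response g h x \<alpha>) (feedback_stage g h x \<alpha> k)"
  by (rule agreeI) (rule feedback_response_stage)

lemma straj_agree:
  assumes \<alpha>: "\<alpha> \<in> strategies" and "b \<in> controls" "b' \<in> controls" "agree t b b'" "0 \<le> s" "s \<le> t"
  shows "straj f x \<alpha> b s = straj f x \<alpha> b' s"
  by (rule traj_agree[OF strategies_controls[OF \<alpha>] _ strategies_controls[OF \<alpha>] _ strategies_agree[OF \<alpha>]]) (fact assms)+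

text \<open>The response and its stage \<open>j\<close> agree before \<open>(j + 1) * h\<close>, so both lead to the same sampled state.\<close>

lemma feedback_response_constant_on_steps:
  fixes g :: "real^'n \<Rightarrow> 'b" and h :: real and x :: "real^'n" and \<alpha> :: "(real \<Rightarrow> 'b) \<Rightarrow> real \<Rightarrow> 'a"
  assumes "0 < h" and \<alpha>: "\<alpha> \<in> strategies"
  defines "b \<equiv> feedback_response g h x \<alpha>"
  shows "agree h (shift (real k * h) b) (\<lambda>_. g (straj f x \<alpha> b (real k * h)))"
proof (rule agreeI)
  fix s assume s: "0 \<le> s" "s < h"
  have b: "b \<in> controls" unfolding b_def by (rule feedback_response_controls[OF \<open>0 < h\<close>])
  have "s + real k * h < real (Suc k) * h" using s by (simp add: distrib_right)
  then have 1: "shift (real k * h) b s = feedback_stage g h x \<alpha> k (s + real k * h)"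
    unfolding shift_def b_def by (rule feedback_response_stage[OF \<open>0 < h\<close>])
  show "shift (real k * h) b s = g (straj f x \<alpha> b (real k * h))"
  proof (cases k)
    case 0
    then show ?thesis using 1 traj_0[OF strategies_controls[OF \<alpha> b] b] by simp
  next
    case (Suc j)
    have "feedback_stage g h x \<alpha> k (s + real k * h) = g (straj f x \<alpha> (feedback_stage g h x \<alpha> j) (real k * h))"
      unfolding Suc feedback_stage.simps switch_def using s by simp
    moreover have "straj f x \<alpha> b (real k * h) = straj f x \<alpha> (feedback_stage g h x \<alpha> j) (real k * h)"
      using feedback_response_agree_stage[OF \<open>0 < h\<close>, of j g x \<alpha>] \<open>0 < h\<close> feedback_stage_controls[OF \<open>0 < h\<close>] b
      unfolding Suc b_def by (intro straj_agree[OF \<alpha>]) auto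
    ultimately show ?thesis using 1 by simp
  qed
qed

text \<open>The value sampled at time \<open>k * h\<close> depends on \<open>\<alpha>\<close> through its action before \<open>k * h\<close> only.\<close>

lemma feedback_stage_nonanticipating:
  assumes "0 < h" "real k * h \<le> t" "\<And>b. b \<in> controls \<Longrightarrow> agree t (\<alpha>1 b) (\<alpha>2 b)"
    and \<alpha>1: "\<alpha>1 \<in> strategies" and \<alpha>2: "\<alpha>2 \<in> strategies"
  shows "feedback_stage g h x \<alpha>1 k = feedback_stage g h x \<alpha>2 k"
  using assms(2)
proof (induction k)
  case (Suc k)
  have "real k * h \<le> real (Suc k) * h" using \<open>0 < h\<close> by (intro mult_right_mono) auto
  with Suc have eq: "feedback_stage g h x \<alpha>1 k = feedback_stage g h x \<alpha>2 k" by simp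
  let ?b = "feedback_stage g h x \<alpha>2 k"
  have b: "?b \<in> controls" by (rule feedback_stage_controls[OF \<open>0 < h\<close>])
  have "straj f x \<alpha>1 ?b (real (Suc k) * h) = straj f x \<alpha>2 ?b (real (Suc k) * h)"
  proof (rule traj_agree[OF strategies_controls[OF \<alpha>1 b] b strategies_controls[OF \<alpha>2 b] b])
    show "agree t (\<alpha>1 ?b) (\<alpha>2 ?b)" by (rule assms(3)[OF b])
  qed (use Suc \<open>0 < h\<close> in auto)
  then show ?case by (simp add: eq)
qed simp

lemma feedback_response_nonanticipating:
  assumes "0 < h"
  shows "feedback_response g h x \<in> nonanticipating_responses"
  unfolding nonanticipating_responses_def
proof (intro CollectI conjI Pi_I allI impI ballI)
  show "feedback_response g h x \<alpha> \<in> controls" for \<alpha> by (rule feedback_response_controls[OF assms])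
  fix t :: real and \<alpha>1 \<alpha>2 :: "(real \<Rightarrow> 'b) \<Rightarrow> real \<Rightarrow> 'a"
  assume "0 \<le> t" and \<alpha>: "\<alpha>1 \<in> strategies" "\<alpha>2 \<in> strategies"
    and "\<forall>b\<in>controls. AE s\<in>{0..t} in lebesgue. \<alpha>1 b s = \<alpha>2 b s"
  then have agr: "agree t (\<alpha>1 b) (\<alpha>2 b)" if "b \<in> controls" for b using that by (simp add: agree_def)
  have "feedback_response g h x \<alpha>1 s = feedback_response g h x \<alpha>2 s" if "s \<in> {0..t}" for s
  proof -
    have "real (nat \<lfloor>s / h\<rfloor>) \<le> s / h" using that assms by simp
    then have "real (nat \<lfloor>s / h\<rfloor>) * h \<le> s" using assms by (simp add: pos_le_divide_eq)
    then show ?thesis unfolding feedback_response_def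
      using feedback_stage_nonanticipating[OF assms _ agr \<alpha>, of "nat \<lfloor>s / h\<rfloor>" g x] that by simp
  qed
  then show "AE s\<in>{0..t} in lebesgue. feedback_response g h x \<alpha>1 s = feedback_response g h x \<alpha>2 s"
    by (intro AE_I2) simp
qed

section \<open>Closures of reachable sets are dominions\<close>

lemma closure_point_near:
  fixes y :: "real^'n"
  assumes "y \<in> closure R" "0 < \<epsilon>" "0 \<le> T"
  obtains z where "z \<in> R" "\<And>t. 0 \<le> t \<Longrightarrow> t \<le> T \<Longrightarrow> 2 * norm (y - z) * exp (2 * L * t) \<le> \<epsilon>"
proof -
  have "0 < \<epsilon> / (2 * exp (2 * L * T))" using assms by simp
  then obtain z where "z \<in> R" and z: "dist z y < \<epsilon> / (2 * exp (2 * L * T))"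
    using assms(1) unfolding closure_approachable by blast
  show thesis
  proof
    fix t assume "0 \<le> t" "t \<le> T"
    then have "2 * norm (y - z) * exp (2 * L * t) \<le> 2 * norm (y - z) * exp (2 * L * T)"
      using L_pos by (intro mult_left_mono) auto
    also have "\<dots> \<le> \<epsilon>" using z by (simp add: dist_norm norm_minus_commute field_simps)
    finally show "2 * norm (y - z) * exp (2 * L * t) \<le> \<epsilon>" .
  qed fact
qed

lemma infdist_closure_le:
  assumes "w \<in> R" "norm (u - w) \<le> \<epsilon>"
  shows "infdist u (closure R) \<le> \<epsilon>"
  using infdist_le[of w "closure R" u] assms closure_subset by (force simp: dist_norm)

text \<open>From a reached point, player 1 continues with the remainder of \<open>\<alpha>\<close> and never leaves the reachable
  set. A point of the closure has reached points near it, whose trajectories stay close for a bounded time.\<close>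

lemma dominion1_closure_reach1:
  assumes \<alpha>: "\<alpha> \<in> strategies"
  shows "dominion1 f (closure (reach1 f \<alpha> x))"
  unfolding dominion1_def
proof (intro conjI ballI allI impI)
  have "straj f x \<alpha> (\<lambda>_. undefined) 0 \<in> reach1 f \<alpha> x" unfolding reach1_def using const_controls by blast
  then show "closure (reach1 f \<alpha> x) \<noteq> {}" using closure_subset by blast
  fix y and \<epsilon> T :: real assume y: "y \<in> closure (reach1 f \<alpha> x)" and "0 < \<epsilon>" "0 \<le> T"
  obtain z where z: "z \<in> reach1 f \<alpha> x" and close: "\<And>t. 0 \<le> t \<Longrightarrow> t \<le> T \<Longrightarrow> 2 * norm (y - z) * exp (2 * L * t) \<le> \<epsilon>"
    using closure_point_near[OF y \<open>0 < \<epsilon>\<close> \<open>0 \<le> T\<close>] by blast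
  from z obtain b0 t0 where z: "z = straj f x \<alpha> b0 t0" and b0: "b0 \<in> controls" and "0 \<le> t0"
    unfolding reach1_def by blast
  show "\<exists>\<alpha>'\<in>strategies. \<forall>b\<in>controls. \<forall>t\<in>{0..T}. infdist (straj f y \<alpha>' b t) (closure (reach1 f \<alpha> x)) \<le> \<epsilon>"
  proof (intro bexI ballI)
    let ?\<alpha> = "\<lambda>b. shift t0 (\<alpha> (switch t0 b0 b))"
    show \<alpha>': "?\<alpha> \<in> strategies" by (rule tail_strategies[OF \<alpha> b0 \<open>0 \<le> t0\<close>])
    fix b :: "real \<Rightarrow> 'b" and t assume b: "b \<in> controls" and t: "t \<in> {0..T}"
    define bb where "bb = switch t0 b0 b"
    have bb: "bb \<in> controls" unfolding bb_def by (rule switch_controls[OF b0 b \<open>0 \<le> t0\<close>])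
    have "straj f x \<alpha> bb (t0 + t) = traj f (straj f x \<alpha> bb t0) (shift t0 (\<alpha> bb)) (shift t0 bb) t"
      using strategies_controls[OF \<alpha> bb] bb \<open>0 \<le> t0\<close> t by (intro traj_shift) auto
    also have "straj f x \<alpha> bb t0 = z"
      unfolding z using \<open>0 \<le> t0\<close> by (intro straj_agree[OF \<alpha> bb b0, of t0]) (auto simp: bb_def agree_switch_left)
    also have "traj f z (shift t0 (\<alpha> bb)) (shift t0 bb) t = traj f z (shift t0 (\<alpha> bb)) b t"
      using shift_controls[OF strategies_controls[OF \<alpha> bb]] shift_controls[OF bb] b \<open>0 \<le> t0\<close> t
      by (intro traj_agree[of _ _ _ _ t]) (auto simp: bb_def shift_switch_agree)
    finally have "straj f z ?\<alpha> b t \<in> reach1 f \<alpha> x"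
      unfolding reach1_def bb_def[symmetric] using bb \<open>0 \<le> t0\<close> t by (auto intro!: exI[of _ bb] exI[of _ "t0 + t"])
    moreover have "norm (straj f y ?\<alpha> b t - straj f z ?\<alpha> b t) \<le> \<epsilon>"
      using traj_stable[OF strategies_controls[OF \<alpha>' b] b, of t y z] close[of t] t by auto
    ultimately show "infdist (straj f y ?\<alpha> b t) (closure (reach1 f \<alpha> x)) \<le> \<epsilon>" by (rule infdist_closure_le)
  qed
qed simp

text \<open>A reached point is the state at time \<open>t0\<close> when \<open>\<beta>\<close> plays against some \<open>\<alpha>0\<close>. Given a new strategy \<open>\<alpha>\<close>,
  let \<open>\<beta>\<close> play against \<open>\<alpha>0\<close> followed by \<open>\<alpha>\<close>: it cannot notice the change before \<open>t0\<close>, so the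
  continuation of its answer keeps the state in the reachable set.\<close>

lemma dominion2_closure_reach2:
  assumes \<beta>: "\<beta> \<in> nonanticipating_responses"
  shows "dominion2 f (closure (reach2 f \<beta> x))"
  unfolding dominion2_def
proof (intro conjI ballI allI impI)
  have "straj f x (\<lambda>b s. undefined) (\<beta> (\<lambda>b s. undefined)) 0 \<in> reach2 f \<beta> x"
    unfolding reach2_def by (auto intro!: exI[of _ "\<lambda>b s. undefined"] exI[of _ 0])
  then show "closure (reach2 f \<beta> x) \<noteq> {}" using closure_subset by blast
  fix y and \<epsilon> T :: real and \<alpha> :: "(real \<Rightarrow> 'b) \<Rightarrow> real \<Rightarrow> 'a"
  assume y: "y \<in> closure (reach2 f \<beta> x)" and "0 < \<epsilon>" "0 \<le> T" and \<alpha>: "\<alpha> \<in> strategies"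
  have \<beta>c: "\<beta> \<alpha> \<in> controls" if "\<alpha> \<in> strategies" for \<alpha>
    using \<beta> that unfolding nonanticipating_responses_def by blast
  obtain z where z: "z \<in> reach2 f \<beta> x" and close: "\<And>t. 0 \<le> t \<Longrightarrow> t \<le> T \<Longrightarrow> 2 * norm (y - z) * exp (2 * L * t) \<le> \<epsilon>"
    using closure_point_near[OF y \<open>0 < \<epsilon>\<close> \<open>0 \<le> T\<close>] by blast
  from z obtain \<alpha>0 t0 where z: "z = straj f x \<alpha>0 (\<beta> \<alpha>0) t0" and \<alpha>0: "\<alpha>0 \<in> strategies" and "0 \<le> t0"
    unfolding reach2_def by blast
  define \<alpha>1 where "\<alpha>1 = (\<lambda>b. switch t0 (\<alpha>0 b) (\<alpha> (shift t0 b)))"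
  have \<alpha>1: "\<alpha>1 \<in> strategies" unfolding \<alpha>1_def using switch_strategies[OF \<alpha>0 \<open>0 \<le> t0\<close>, of "\<lambda>_. \<alpha>"] \<alpha> by simp
  have "agree t0 (\<beta> \<alpha>1) (\<beta> \<alpha>0)"
  proof -
    have "\<forall>b\<in>controls. AE s\<in>{0..t0} in lebesgue. \<alpha>1 b s = \<alpha>0 b s"
      using agree_switch_left unfolding \<alpha>1_def agree_def by blast
    then show ?thesis
      using \<beta> \<alpha>1 \<alpha>0 \<open>0 \<le> t0\<close> unfolding nonanticipating_responses_def agree_def by blast
  qed
  define b1 where "b1 = \<beta> \<alpha>1"
  have b1: "b1 \<in> controls" unfolding b1_def by (rule \<beta>c[OF \<alpha>1])
  define b where "b = shift t0 b1"
  have b: "b \<in> controls" unfolding b_def by (rule shift_controls[OF b1 \<open>0 \<le> t0\<close>])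
  have ac: "\<alpha>1 b1 \<in> controls" by (rule strategies_controls[OF \<alpha>1 b1])
  have a0: "straj f x \<alpha>1 b1 t0 = z"
  proof -
    have "straj f x \<alpha>1 b1 t0 = straj f x \<alpha>1 (\<beta> \<alpha>0) t0"
      using \<open>agree t0 (\<beta> \<alpha>1) (\<beta> \<alpha>0)\<close> \<open>0 \<le> t0\<close> by (intro straj_agree[OF \<alpha>1 b1 \<beta>c[OF \<alpha>0], of t0]) (auto simp: b1_def)
    also have "\<dots> = z"
      unfolding z using \<open>0 \<le> t0\<close> strategies_controls[OF \<alpha>1 \<beta>c[OF \<alpha>0]] strategies_controls[OF \<alpha>0 \<beta>c[OF \<alpha>0]] \<beta>c[OF \<alpha>0]
      by (intro traj_agree[of _ _ _ _ t0]) (auto simp: \<alpha>1_def agree_switch_left)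
    finally show ?thesis .
  qed
  show "\<exists>b\<in>controls. \<forall>t\<in>{0..T}. infdist (straj f y \<alpha> b t) (closure (reach2 f \<beta> x)) \<le> \<epsilon>"
  proof (intro bexI[OF _ b] ballI)
    fix t assume t: "t \<in> {0..T}"
    have ab: "\<alpha> b \<in> controls" by (rule strategies_controls[OF \<alpha> b])
    have "straj f x \<alpha>1 b1 (t0 + t) = traj f z (shift t0 (\<alpha>1 b1)) b t"
      using traj_shift[OF ac b1 \<open>0 \<le> t0\<close>, of t x] t a0 by (simp add: b_def)
    also have "\<dots> = straj f z \<alpha> b t"
      using shift_controls[OF ac \<open>0 \<le> t0\<close>] b ab t
      by (intro traj_agree[of _ _ _ _ t]) (auto simp: \<alpha>1_def b_def shift_switch_agree)
    finally have "straj f z \<alpha> b t \<in> reach2 f \<beta> x"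
      unfolding reach2_def using \<alpha>1 \<open>0 \<le> t0\<close> t unfolding b1_def by (auto intro!: exI[of _ \<alpha>1] exI[of _ "t0 + t"])
    moreover have "norm (straj f y \<alpha> b t - straj f z \<alpha> b t) \<le> \<epsilon>"
      using traj_stable[OF ab b, of t y z] close[of t] t by auto
    ultimately show "infdist (straj f y \<alpha> b t) (closure (reach2 f \<beta> x)) \<le> \<epsilon>" by (rule infdist_closure_le)
  qed
qed simp

end

section \<open>Nearly extremal values persist\<close>

context game begin

lemma run_split:
  assumes a: "a \<in> controls" and b: "b \<in> controls" and "0 < \<delta>" "0 \<le> h" "0 \<le> k"
  shows "run \<delta> (h + k) x a b = run \<delta> h x a b + exp (- (\<delta> * h)) * run \<delta> k (traj f x a b h) (shift h a) (shift h b)"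
proof -
  let ?c = "cost \<delta> x a b" and ?c' = "cost \<delta> (traj f x a b h) (shift h a) (shift h b)"
  have int: "?c integrable_on {0..h + k}" using \<open>0 < \<delta>\<close> by (intro cost_integrable[OF a b]) auto
  then have "(?c has_integral integral {h..h + k} ?c) {0 + h..k + h}"
    using integrable_subinterval_real[OF int, of h "h + k"] \<open>0 \<le> h\<close> by (simp add: add.commute integrable_integral)
  then have "((?c \<circ> (+) h) has_integral integral {h..h + k} ?c) {0..k}"
    by (subst has_integral_shift_Icc_real)
  moreover have "integral {0..k} (?c \<circ> (+) h) = integral {0..k} (\<lambda>s. exp (- (\<delta> * h)) * ?c' s)"
  proof (rule Henstock_Kurzweil_Integration.integral_cong)
    fix s assume "s \<in> {0..k}"
    moreover have "exp (- (\<delta> * (h + s))) = exp (- (\<delta> * h)) * exp (- (\<delta> * s))"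
      by (simp add: distrib_left flip: exp_add)
    ultimately show "(?c \<circ> (+) h) s = exp (- (\<delta> * h)) * ?c' s"
      using traj_shift[OF a b \<open>0 \<le> h\<close>, of s x] by (simp add: cost_def shift_def add.commute)
  qed
  ultimately have "integral {h..h + k} ?c = exp (- (\<delta> * h)) * integral {0..k} ?c'"
    by (simp add: integral_unique)
  then show ?thesis
    unfolding run_def using Henstock_Kurzweil_Integration.integral_combine[OF _ _ int, of h] \<open>0 \<le> h\<close> \<open>0 \<le> k\<close> by simp
qed

lemma low_value_persists:
  assumes \<alpha>: "\<alpha> \<in> strategies" and "0 < \<delta>" and opt: "\<And>b. b \<in> controls \<Longrightarrow> payoff \<delta> x (\<alpha> b) b \<le> val \<delta> x + \<eta> / \<delta>"
    and b: "b \<in> controls" and "0 \<le> t"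
  shows "\<delta> * val \<delta> (straj f x \<alpha> b t) \<le> \<delta> * val \<delta> x + \<eta> + 2 * M * (\<delta> * t)"
proof -
  define v where "v = val \<delta> (straj f x \<alpha> b t)"
  define e where "e = exp (- (\<delta> * t))"
  have e: "e \<le> 1" "1 - e \<le> \<delta> * t"
    using \<open>0 < \<delta>\<close> \<open>0 \<le> t\<close> exp_ge_add_one_self[of "- (\<delta> * t)"] by (auto simp: e_def)
  have "run \<delta> t x (\<alpha> b) b + e * v \<le> val \<delta> x + \<eta> / \<delta>"
    unfolding e_def v_def by (rule dynamic_programming_strategy[OF \<alpha> \<open>0 < \<delta>\<close> opt b \<open>0 \<le> t\<close>])
  moreover have "\<bar>run \<delta> t x (\<alpha> b) b\<bar> \<le> M * t"
    using \<open>0 < \<delta>\<close> \<open>0 \<le> t\<close> by (intro run_bound strategies_controls[OF \<alpha> b] b) auto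
  ultimately have "e * v \<le> val \<delta> x + \<eta> / \<delta> + M * t" by linarith
  then have "\<delta> * (e * v) \<le> \<delta> * (val \<delta> x + \<eta> / \<delta> + M * t)" using \<open>0 < \<delta>\<close> by (intro mult_left_mono) auto
  moreover have "\<delta> * (val \<delta> x + \<eta> / \<delta> + M * t) = \<delta> * val \<delta> x + \<eta> + M * (\<delta> * t)"
    using \<open>0 < \<delta>\<close> by (simp add: distrib_left)
  ultimately have "e * (\<delta> * v) \<le> \<delta> * val \<delta> x + \<eta> + M * (\<delta> * t)" by (simp add: mult.left_commute)
  moreover have "(1 - e) * (\<delta> * v) \<le> \<delta> * t * M"
  proof -
    have "\<delta> * v \<le> M" using val_bound[OF \<open>0 < \<delta>\<close>, of "straj f x \<alpha> b t"] unfolding v_def abs_le_iff by blast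
    then have "(1 - e) * (\<delta> * v) \<le> (1 - e) * M" using e by (intro mult_left_mono) auto
    also have "\<dots> \<le> \<delta> * t * M" using e M_pos by (intro mult_right_mono) auto
    finally show ?thesis .
  qed
  ultimately show ?thesis unfolding v_def[symmetric] by (simp add: algebra_simps)
qed

lemma feedback_iterate:
  fixes g :: "real^'n \<Rightarrow> 'b" and h :: real and x :: "real^'n" and \<alpha> :: "(real \<Rightarrow> 'b) \<Rightarrow> real \<Rightarrow> 'a"
  assumes "0 < \<delta>" "0 < h" "0 \<le> \<eta>"
    and step: "\<And>x a. a \<in> controls \<Longrightarrow>
       V x - \<eta> * h \<le> run \<delta> h x a (\<lambda>_. g x) + exp (- (\<delta> * h)) * V (traj f x a (\<lambda>_. g x) h)"
    and \<alpha>: "\<alpha> \<in> strategies"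
  defines "b \<equiv> feedback_response g h x \<alpha>"
  shows "V x - \<eta> * (real k * h) \<le> run \<delta> (real k * h) x (\<alpha> b) b + exp (- (\<delta> * (real k * h))) * V (straj f x \<alpha> b (real k * h))"
proof (induction k)
  have b: "b \<in> controls" unfolding b_def by (rule feedback_response_controls[OF \<open>0 < h\<close>])
  have a: "\<alpha> b \<in> controls" by (rule strategies_controls[OF \<alpha> b])
  {
    case 0
    show ?case using traj_0[OF a b] by (simp add: run_def)
  next
    case (Suc k)
    define t where "t = real k * h"
    have "0 \<le> t" using \<open>0 < h\<close> by (simp add: t_def)
    define X where "X = straj f x \<alpha> b t"
    have Sk: "real (Suc k) * h = t + h" by (simp add: t_def algebra_simps)
    have sa: "shift t (\<alpha> b) \<in> controls" and sb: "shift t b \<in> controls" using a b \<open>0 \<le> t\<close> by (auto intro: shift_controls)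
    have agr: "agree h (shift t b) (\<lambda>_. g X)"
      using feedback_response_constant_on_steps[OF \<open>0 < h\<close> \<alpha>, of k g x] by (simp add: t_def X_def b_def)
    have 1: "run \<delta> h X (shift t (\<alpha> b)) (shift t b) = run \<delta> h X (shift t (\<alpha> b)) (\<lambda>_. g X)"
      by (rule run_agree[OF sa sb sa const_controls agree_refl agr])
    have 2: "traj f X (shift t (\<alpha> b)) (shift t b) h = traj f X (shift t (\<alpha> b)) (\<lambda>_. g X) h"
      using \<open>0 < h\<close> by (intro traj_agree[OF sa sb sa const_controls agree_refl agr]) auto
    have 3: "straj f x \<alpha> b (t + h) = traj f X (shift t (\<alpha> b)) (\<lambda>_. g X) h"
      unfolding 2[symmetric] using traj_shift[OF a b \<open>0 \<le> t\<close>, of h x] \<open>0 < h\<close> by (simp add: X_def)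
    have 4: "run \<delta> (t + h) x (\<alpha> b) b = run \<delta> t x (\<alpha> b) b + exp (- (\<delta> * t)) * run \<delta> h X (shift t (\<alpha> b)) (\<lambda>_. g X)"
      unfolding 1[symmetric] using run_split[OF a b \<open>0 < \<delta>\<close> \<open>0 \<le> t\<close>, of h x] \<open>0 < h\<close> by (simp add: X_def)
    have "exp (- (\<delta> * t)) * (V X - \<eta> * h) \<le> exp (- (\<delta> * t)) *
        (run \<delta> h X (shift t (\<alpha> b)) (\<lambda>_. g X) + exp (- (\<delta> * h)) * V (traj f X (shift t (\<alpha> b)) (\<lambda>_. g X) h))"
      by (intro mult_left_mono step[OF sa]) auto
    moreover have "exp (- (\<delta> * t)) * (\<eta> * h) \<le> 1 * (\<eta> * h)"
      using assms(1-3) \<open>0 \<le> t\<close> by (intro mult_right_mono) auto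
    moreover have "exp (- (\<delta> * (t + h))) = exp (- (\<delta> * t)) * exp (- (\<delta> * h))"
      by (simp add: distrib_left flip: exp_add)
    ultimately show ?case
      using Suc.IH unfolding Sk 3 4 t_def[symmetric] X_def[symmetric] by (simp add: algebra_simps)
  }
qed

text \<open>At the sampling times, the payoff collected so far plus the discounted \<open>V\<close> has decreased only at a
  small rate. The regularization \<open>V\<close> is close to the value, and between two sampling times the state moves too
  little to matter.\<close>

lemma high_value_persists:
  assumes "0 < \<delta>" "0 < \<eta>"
  obtains \<beta> where "\<beta> \<in> nonanticipating_responses"
    "\<And>\<alpha> t. \<alpha> \<in> strategies \<Longrightarrow> 0 \<le> t \<Longrightarrow>
       \<delta> * val \<delta> x - \<eta> - (2 * M + 1 + \<eta>) * (\<delta> * t) \<le> \<delta> * val \<delta> (straj f x \<alpha> (\<beta> \<alpha>) t)"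
proof -
  define e where "e = min 1 (\<eta> / (2 * \<delta>))"
  have e: "0 < e" "e \<le> 1" "\<delta> * e \<le> \<eta> / 2"
  proof -
    have "\<delta> * e \<le> \<delta> * (\<eta> / (2 * \<delta>))" using \<open>0 < \<delta>\<close> by (intro mult_left_mono) (auto simp: e_def)
    then show "\<delta> * e \<le> \<eta> / 2" using \<open>0 < \<delta>\<close> by simp
  qed (use assms in \<open>auto simp: e_def\<close>)
  obtain r where "0 < r" and r: "\<And>x y. norm (x - y) \<le> r \<Longrightarrow> \<bar>\<delta> * val \<delta> x - \<delta> * val \<delta> y\<bar> \<le> \<eta> / 2"
    using val_uniformly_continuous[OF \<open>0 < \<delta>\<close>, of "\<eta> / 2"] \<open>0 < \<eta>\<close> by auto
  have "0 < r / F" using \<open>0 < r\<close> F_pos by simp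
  obtain V g h where h: "0 < h" "h \<le> r / F"
    and V: "\<And>x. val \<delta> x \<le> V x" "\<And>x. V x \<le> val \<delta> x + e"
    and step: "\<And>x a. a \<in> controls \<Longrightarrow>
       V x - e * h \<le> run \<delta> h x a (\<lambda>_. g x) + exp (- (\<delta> * h)) * V (traj f x a (\<lambda>_. g x) h)"
    by (rule feedback_step[OF \<open>0 < \<delta>\<close> e(1) \<open>0 < r / F\<close>]) (rule that; assumption)
  show thesis
  proof (rule that[of "feedback_response g h x"])
    show "feedback_response g h x \<in> nonanticipating_responses" by (rule feedback_response_nonanticipating[OF h(1)])
    fix \<alpha> :: "(real \<Rightarrow> 'b) \<Rightarrow> real \<Rightarrow> 'a" and t :: real assume \<alpha>: "\<alpha> \<in> strategies" and "0 \<le> t"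
    define b where "b = feedback_response g h x \<alpha>"
    have b: "b \<in> controls" unfolding b_def by (rule feedback_response_controls[OF h(1)])
    have a: "\<alpha> b \<in> controls" by (rule strategies_controls[OF \<alpha> b])
    \<comment> \<open>\<open>s\<close> is the last sampling time before \<open>t\<close>\<close>
    define k where "k = nat \<lfloor>t / h\<rfloor>"
    define s where "s = real k * h"
    have "0 \<le> t / h" using \<open>0 \<le> t\<close> h by simp
    then have "real k \<le> t / h" "t / h < real k + 1" unfolding k_def by linarith+
    then have s: "0 \<le> s" "s \<le> t" "t - s \<le> h"
      using h by (auto simp: s_def pos_le_divide_eq pos_divide_less_eq algebra_simps)
    define X where "X = straj f x \<alpha> b s"
    define E where "E = exp (- (\<delta> * s))"
    have E: "E \<le> 1" "1 - E \<le> \<delta> * s"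
      using \<open>0 < \<delta>\<close> \<open>0 \<le> s\<close> exp_ge_add_one_self[of "- (\<delta> * s)"] by (auto simp: E_def)
    have "V x - e * s \<le> run \<delta> s x (\<alpha> b) b + E * V X"
      using feedback_iterate[OF \<open>0 < \<delta>\<close> h(1) less_imp_le[OF e(1)] step \<alpha>, of x k]
      unfolding s_def E_def X_def b_def .
    moreover have "\<bar>run \<delta> s x (\<alpha> b) b\<bar> \<le> M * s" using \<open>0 < \<delta>\<close> s by (intro run_bound a b) auto
    moreover have "e * s \<le> 1 * s" using e s by (intro mult_right_mono) auto
    ultimately have "val \<delta> x - (M + 1) * s \<le> E * V X" using V(1)[of x] by (simp add: algebra_simps)
    then have "\<delta> * (val \<delta> x - (M + 1) * s) \<le> \<delta> * (E * V X)" using \<open>0 < \<delta>\<close> by (intro mult_left_mono) auto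
    moreover have "(1 - E) * (- (\<delta> * V X)) \<le> \<delta> * s * (M + \<eta>)"
    proof -
      have "- (\<delta> * V X) \<le> M + \<eta>"
        using mult_left_mono[OF V(1)[of X] less_imp_le[OF \<open>0 < \<delta>\<close>]] val_bound[OF \<open>0 < \<delta>\<close>, of X] \<open>0 < \<eta>\<close>
        unfolding abs_le_iff by linarith
      then have "(1 - E) * (- (\<delta> * V X)) \<le> (1 - E) * (M + \<eta>)" using E by (intro mult_left_mono) auto
      also have "\<dots> \<le> \<delta> * s * (M + \<eta>)" using E M_pos \<open>0 < \<eta>\<close> by (intro mult_right_mono) auto
      finally show ?thesis .
    qed
    ultimately have "\<delta> * val \<delta> x - (2 * M + 1 + \<eta>) * (\<delta> * s) \<le> \<delta> * V X" by (simp add: algebra_simps)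
    moreover have "\<delta> * V X \<le> \<delta> * val \<delta> X + \<eta> / 2"
      using mult_left_mono[OF V(2)[of X], of \<delta>] \<open>0 < \<delta>\<close> e(3) by (simp add: distrib_left)
    moreover have "\<delta> * val \<delta> X - \<eta> / 2 \<le> \<delta> * val \<delta> (straj f x \<alpha> b t)"
    proof -
      have "norm (straj f x \<alpha> b t - X) \<le> F * (t - s)" unfolding X_def by (rule traj_speed[OF a b s(1,2)])
      also have "\<dots> \<le> F * (r / F)" using F_pos s h by (intro mult_left_mono) auto
      also have "\<dots> = r" using F_pos by simp
      finally show ?thesis using r[of "straj f x \<alpha> b t" X] unfolding abs_le_iff by linarith
    qed
    moreover have "(2 * M + 1 + \<eta>) * (\<delta> * s) \<le> (2 * M + 1 + \<eta>) * (\<delta> * t)"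
      using M_pos assms s by (intro mult_left_mono) auto
    ultimately show "\<delta> * val \<delta> x - \<eta> - (2 * M + 1 + \<eta>) * (\<delta> * t) \<le> \<delta> * val \<delta> (straj f x \<alpha> (feedback_response g h x \<alpha>) t)"
      unfolding b_def[symmetric] by linarith
  qed
qed

end

section \<open>Dominions in the torus\<close>

lemma int_lattice_add: "z \<in> int_lattice \<Longrightarrow> w \<in> int_lattice \<Longrightarrow> z + w \<in> int_lattice"
  by (simp add: int_lattice_def)

lemma torus_proj_add_lattice: "z \<in> int_lattice \<Longrightarrow> torus_proj (y + z) = torus_proj y"
  by (simp add: torus_proj_eq_iff)

text \<open>Open sets of the torus correspond to open sets that are invariant under the lattice; the one
  generated by a ball is the union of its translates.\<close>

lemma torus_proj_mem_in_torus_iff: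
  fixes x :: "real^'n"
  shows "torus_proj x \<in> in_torus D \<longleftrightarrow> (\<forall>r>0. \<exists>y\<in>D. \<exists>z\<in>int_lattice. norm (x - (y + z)) < r)"
proof
  assume x: "torus_proj x \<in> in_torus D"
  show "\<forall>r>0. \<exists>y\<in>D. \<exists>z\<in>int_lattice. norm (x - (y + z)) < r"
  proof (intro allI impI)
    fix r :: real assume "0 < r"
    let ?T = "torus_proj ` ball x r"
    have "torus_proj -` ?T = (\<Union>z\<in>int_lattice. (+) z ` ball x r)"
    proof (rule set_eqI)
      fix u
      have "u \<in> torus_proj -` ?T \<longleftrightarrow> (\<exists>v\<in>ball x r. u - v \<in> int_lattice)"
        by (auto simp: torus_proj_eq_iff)
      also have "\<dots> \<longleftrightarrow> u \<in> (\<Union>z\<in>int_lattice. (+) z ` ball x r)"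
      proof
        assume "\<exists>v\<in>ball x r. u - v \<in> int_lattice"
        then obtain v where v: "v \<in> ball x r" "u - v \<in> int_lattice" by blast
        then have "u = (u - v) + v" by simp
        with v show "u \<in> (\<Union>z\<in>int_lattice. (+) z ` ball x r)" by blast
      next
        assume "u \<in> (\<Union>z\<in>int_lattice. (+) z ` ball x r)"
        then obtain z v where "z \<in> int_lattice" "v \<in> ball x r" "u = z + v" by blast
        then show "\<exists>v\<in>ball x r. u - v \<in> int_lattice" by (intro bexI[of _ v]) simp_all
      qed
      finally show "u \<in> torus_proj -` ?T \<longleftrightarrow> u \<in> (\<Union>z\<in>int_lattice. (+) z ` ball x r)" .
    qed
    then have "openin torus_topology ?T"
      unfolding openin_torus_topology by (auto intro!: open_UN open_translation)
    moreover have "torus_proj x \<in> ?T" using \<open>0 < r\<close> by simp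
    ultimately have "\<exists>p. p \<in> torus_proj ` D \<and> p \<in> ?T"
      using x unfolding in_torus_def in_closure_of by (elim conjE allE[of _ ?T]) (erule mp, rule conjI)
    then obtain p where "p \<in> torus_proj ` D" "p \<in> ?T" by (elim exE conjE)
    then obtain y v where "y \<in> D" "v \<in> ball x r" "torus_proj v = torus_proj y" by auto
    then have "v - y \<in> int_lattice" "norm (x - (y + (v - y))) < r" by (auto simp: torus_proj_eq_iff dist_norm)
    with \<open>y \<in> D\<close> show "\<exists>y\<in>D. \<exists>z\<in>int_lattice. norm (x - (y + z)) < r" by blast
  qed
next
  assume near: "\<forall>r>0. \<exists>y\<in>D. \<exists>z\<in>int_lattice. norm (x - (y + z)) < r"
  show "torus_proj x \<in> in_torus D"
    unfolding in_torus_def in_closure_of topspace_torus_topology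
  proof (intro conjI allI impI)
    fix T assume T: "torus_proj x \<in> T \<and> openin torus_topology T"
    then have "open (torus_proj -` T)" "x \<in> torus_proj -` T" by (auto simp: openin_torus_topology)
    then obtain r where "0 < r" and r: "ball x r \<subseteq> torus_proj -` T" using openE by blast
    then obtain y z where "y \<in> D" "z \<in> int_lattice" "norm (x - (y + z)) < r" using near by blast
    then have "y + z \<in> ball x r" by (simp add: dist_norm)
    then have "torus_proj y \<in> T" using r torus_proj_add_lattice[OF \<open>z \<in> int_lattice\<close>, of y] by auto
    with \<open>y \<in> D\<close> show "\<exists>p. p \<in> torus_proj ` D \<and> p \<in> T" by blast
  qed simp
qed

lemma in_torus_subset: "in_torus D \<subseteq> range torus_proj"
  unfolding in_torus_def using closure_of_subset_topspace[of torus_topology] topspace_torus_topology by blast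

lemma in_torus_meet_near:
  fixes D1 D2 :: "(real^'n) set"
  assumes "in_torus D1 \<inter> in_torus D2 \<noteq> {}" "0 < r"
  obtains y1 y2 z where "y1 \<in> D1" "y2 \<in> D2" "z \<in> int_lattice" "norm (y1 - (y2 + z)) < r"
proof -
  obtain x :: "real^'n" where x: "torus_proj x \<in> in_torus D1" "torus_proj x \<in> in_torus D2"
    using assms(1) in_torus_subset by blast
  have "0 < r / 2" using assms by simp
  then obtain y1 z1 y2 z2 where 1: "y1 \<in> D1" "z1 \<in> int_lattice" "norm (x - (y1 + z1)) < r / 2"
    and 2: "y2 \<in> D2" "z2 \<in> int_lattice" "norm (x - (y2 + z2)) < r / 2"
    using x unfolding torus_proj_mem_in_torus_iff by meson
  have eq: "y1 - (y2 + (z2 - z1)) = (x - (y2 + z2)) - (x - (y1 + z1))" by simp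
  have "norm (y1 - (y2 + (z2 - z1))) < r"
    unfolding eq using norm_triangle_ineq4[of "x - (y2 + z2)" "x - (y1 + z1)"] 1(3) 2(3) by linarith
  then show thesis using that[OF 1(1) 2(1) int_lattice_diff[OF 2(2) 1(2)]] by blast
qed

definition lattice_dist :: "(real^'n) set \<Rightarrow> real^'n \<Rightarrow> real" where
  "lattice_dist D x = infdist x {y + z |y z. y \<in> D \<and> z \<in> int_lattice}"

lemma lattice_dist_nonneg: "0 \<le> lattice_dist D x"
  by (simp add: lattice_dist_def infdist_nonneg)

lemma lattice_dist_lipschitz: "\<bar>lattice_dist D x - lattice_dist D y\<bar> \<le> norm (x - y)"
  unfolding lattice_dist_def dist_norm[symmetric] by (rule infdist_triangle_abs)

lemma lattice_dist_le_infdist: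
  assumes "D \<noteq> {}" shows "lattice_dist D x \<le> infdist x D"
  unfolding lattice_dist_def
proof (rule infdist_mono[OF _ assms])
  show "D \<subseteq> {y + z |y z. y \<in> D \<and> z \<in> int_lattice}" by (force intro: exI[of _ 0])
qed

lemma lattice_dist_periodic:
  assumes "w \<in> int_lattice"
  shows "lattice_dist D (x + w) = lattice_dist D x"
proof -
  have le: "lattice_dist D (x + w) \<le> lattice_dist D x" if w: "w \<in> int_lattice" for x w
  proof (cases "D = {}")
    case False
    let ?E = "{y + z |y z. y \<in> D \<and> z \<in> int_lattice}"
    have ne: "?E \<noteq> {}" using False zero_int_lattice by blast
    show ?thesis unfolding lattice_dist_def infdist_notempty[OF ne, of x]
    proof (rule cINF_greatest[OF ne])
      fix e assume "e \<in> ?E"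
      then obtain y z where e: "e = y + z" "y \<in> D" "z \<in> int_lattice" by blast
      then have "e + w \<in> ?E" using int_lattice_add[OF e(3) w] by (auto simp: add.assoc)
      then have "infdist (x + w) ?E \<le> dist (x + w) (e + w)" by (rule infdist_le)
      then show "infdist (x + w) ?E \<le> dist x e" by simp
    qed
  qed (simp add: lattice_dist_def infdist_def)
  from le[OF assms, of x] le[OF int_lattice_uminus[OF assms], of "x + w"] show ?thesis by simp
qed

lemma lattice_dist_0:
  fixes x :: "real^'n"
  assumes "D \<noteq> {}" "lattice_dist D x = 0"
  shows "torus_proj x \<in> in_torus D"
  unfolding torus_proj_mem_in_torus_iff
proof (intro allI impI)
  fix r :: real assume "0 < r"
  let ?E = "{y + z |y z. y \<in> D \<and> z \<in> int_lattice}"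
  have ne: "?E \<noteq> {}" using assms(1) zero_int_lattice by blast
  have "x \<in> closure ?E" using in_closure_iff_infdist_zero[OF ne] assms(2) by (simp add: lattice_dist_def)
  then obtain y z where "y \<in> D" "z \<in> int_lattice" "dist (y + z) x < r"
    using \<open>0 < r\<close> unfolding closure_approachable by blast
  then show "\<exists>y\<in>D. \<exists>z\<in>int_lattice. norm (x - (y + z)) < r" by (metis dist_commute dist_norm)
qed

text \<open>The sum is positive everywhere because the closures in the torus are disjoint, and by periodicity
  it attains its minimum on the unit cube.\<close>

lemma lattice_dist_gap:
  fixes D1 D2 :: "(real^'n) set"
  assumes "D1 \<noteq> {}" "D2 \<noteq> {}" and disj: "in_torus D1 \<inter> in_torus D2 = {}"
  obtains m where "0 < m" "\<And>x. m \<le> lattice_dist D1 x + lattice_dist D2 x"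
proof -
  let ?s = "\<lambda>x. lattice_dist D1 x + lattice_dist D2 x"
  have cont: "continuous_on (cbox 0 1) (lattice_dist D)" for D :: "(real^'n) set"
    by (rule lipschitz_on_continuous_on[of 1], rule lipschitz_onI)
       (use lattice_dist_lipschitz[of D] in \<open>auto simp: dist_norm dist_real_def\<close>)
  have "(0 :: real^'n) \<in> cbox 0 1" by (simp add: mem_box_cart)
  then have "cbox (0 :: real^'n) 1 \<noteq> {}" by blast
  then obtain x0 :: "real^'n" where min: "\<And>x. x \<in> cbox 0 1 \<Longrightarrow> ?s x0 \<le> ?s x"
    using continuous_attains_inf[OF compact_cbox, of 0 1 ?s] continuous_on_add[OF cont cont] by metis
  show thesis
  proof
    show "0 < ?s x0"
    proof (rule ccontr)
      assume "\<not> 0 < ?s x0"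
      then have "lattice_dist D1 x0 = 0" "lattice_dist D2 x0 = 0"
        using lattice_dist_nonneg[of D1 x0] lattice_dist_nonneg[of D2 x0] by auto
      then show False using lattice_dist_0 assms by blast
    qed
    fix x :: "real^'n"
    obtain z where z: "z \<in> int_lattice" "x - z \<in> cbox 0 1" using int_lattice_floor by metis
    have "?s (x - z) = ?s x"
      using lattice_dist_periodic[OF z(1), of D1 "x - z"] lattice_dist_periodic[OF z(1), of D2 "x - z"] by simp
    with min[OF z(2)] show "?s x0 \<le> ?s x" by simp
  qed
qed

section \<open>Ergodicity forbids disjoint dominions\<close>

context game begin

text \<open>The sign \<open>\<kappa>\<close> makes the statement an upper bound for player 1 and, with \<open>\<kappa> = -1\<close>, a lower bound for
  player 2. What happens after \<open>T\<close> contributes at most \<open>M exp (- \<delta> T)\<close>.\<close>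

lemma payoff_le_if_running_bound:
  assumes a: "a \<in> controls" and b: "b \<in> controls" and "0 < \<delta>" "0 \<le> T"
    and c: "\<And>s. s \<in> {0..T} \<Longrightarrow> \<kappa> * l (traj f x a b s, a s, b s) \<le> c" and \<kappa>: "\<bar>\<kappa>\<bar> = 1"
  shows "\<delta> * (\<kappa> * payoff \<delta> x a b) \<le> c + (\<bar>c\<bar> + M) * exp (- (\<delta> * T))"
proof -
  have int: "((\<lambda>s. c * exp (- (\<delta> * s))) has_integral c * (1 - exp (- (\<delta> * T))) / \<delta>) {0..T}"
    by (rule has_integral_discount_interval[OF assms(3,4)])
  have ci: "cost \<delta> x a b integrable_on {0..T}" using \<open>0 < \<delta>\<close> by (intro cost_integrable[OF a b]) auto
  have "((\<lambda>s. \<kappa> * cost \<delta> x a b s) has_integral \<kappa> * run \<delta> T x a b) {0..T}"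
    unfolding run_def by (rule has_integral_mult_right[OF integrable_integral[OF ci]])
  then have "\<kappa> * run \<delta> T x a b \<le> c * (1 - exp (- (\<delta> * T))) / \<delta>"
  proof (rule has_integral_le[OF _ int])
    fix s assume "s \<in> {0..T}"
    from mult_left_mono[OF c[OF this], of "exp (- (\<delta> * s))"]
    show "\<kappa> * cost \<delta> x a b s \<le> c * exp (- (\<delta> * s))" by (simp add: cost_def mult_ac)
  qed
  then have "\<delta> * (\<kappa> * run \<delta> T x a b) \<le> \<delta> * (c * (1 - exp (- (\<delta> * T))) / \<delta>)"
    using \<open>0 < \<delta>\<close> by (intro mult_left_mono) auto
  also have "\<dots> = c - c * exp (- (\<delta> * T))" using \<open>0 < \<delta>\<close> by (simp add: field_simps)
  finally have 1: "\<delta> * (\<kappa> * run \<delta> T x a b) \<le> c - c * exp (- (\<delta> * T))" .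
  define P where "P = payoff \<delta> (traj f x a b T) (shift T a) (shift T b)"
  have "\<bar>P\<bar> \<le> M / \<delta>" unfolding P_def using \<open>0 \<le> T\<close> \<open>0 < \<delta>\<close> by (intro payoff_bound shift_controls a b)
  then have "\<bar>\<delta> * (\<kappa> * P)\<bar> \<le> M" using \<open>0 < \<delta>\<close> \<kappa> by (simp add: abs_mult pos_le_divide_eq mult.commute)
  then have "exp (- (\<delta> * T)) * (\<delta> * (\<kappa> * P)) \<le> exp (- (\<delta> * T)) * M" by (intro mult_left_mono) auto
  then have "exp (- (\<delta> * T)) * (\<delta> * (\<kappa> * P)) \<le> M * exp (- (\<delta> * T))" by (simp only: mult.commute)
  moreover have "\<delta> * (\<kappa> * payoff \<delta> x a b) = \<delta> * (\<kappa> * run \<delta> T x a b) + exp (- (\<delta> * T)) * (\<delta> * (\<kappa> * P))"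
    unfolding payoff_split[OF a b \<open>0 < \<delta>\<close> \<open>0 \<le> T\<close>] P_def by (simp add: algebra_simps)
  moreover have "- c * exp (- (\<delta> * T)) \<le> \<bar>c\<bar> * exp (- (\<delta> * T))" by (intro mult_right_mono) auto
  ultimately show ?thesis using 1 unfolding distrib_right by linarith
qed

lemma horizon_exists:
  fixes B :: real
  assumes "0 < \<delta>" "0 < e"
  obtains T where "0 \<le> T" "B * exp (- (\<delta> * T)) \<le> e"
proof
  define B' where "B' = \<bar>B\<bar>"
  have "0 \<le> B'" by (simp add: B'_def)
  show "0 \<le> B' / e / \<delta>" using assms by (simp add: B'_def)
  have "B' / e \<le> exp (B' / e)" using exp_ge_add_one_self[of "B' / e"] by linarith
  then have "B' * exp (- (B' / e)) \<le> e" using \<open>0 < e\<close> by (simp add: exp_minus field_simps)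
  moreover have "B * exp (- (B' / e)) \<le> B' * exp (- (B' / e))" by (intro mult_right_mono) (auto simp: B'_def)
  ultimately have "B * exp (- (B' / e)) \<le> e" by linarith
  then show "B * exp (- (\<delta> * (B' / e / \<delta>))) \<le> e" using \<open>0 < \<delta>\<close> by simp
qed

lemma value_on_dominion1:
  assumes D: "dominion1 f D" "x \<in> D" and "0 < \<epsilon>" "0 < \<delta>" "0 < e"
    and c: "\<And>u a b. infdist u D \<le> \<epsilon> \<Longrightarrow> l (u, a, b) \<le> c"
  shows "\<delta> * val \<delta> x \<le> c + e"
proof -
  obtain T where "0 \<le> T" and T: "(\<bar>c\<bar> + M) * exp (- (\<delta> * T)) \<le> e" using horizon_exists[OF \<open>0 < \<delta>\<close> \<open>0 < e\<close>] by blast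
  obtain \<alpha> where \<alpha>: "\<alpha> \<in> strategies" and stay: "\<And>b t. b \<in> controls \<Longrightarrow> t \<in> {0..T} \<Longrightarrow> infdist (straj f x \<alpha> b t) D \<le> \<epsilon>"
    using D \<open>0 < \<epsilon>\<close> \<open>0 \<le> T\<close> unfolding dominion1_def by meson
  have "val \<delta> x \<le> (c + e) / \<delta>"
  proof (rule val_le[OF \<alpha> \<open>0 < \<delta>\<close>])
    fix b :: "real \<Rightarrow> 'b" assume b: "b \<in> controls"
    have "\<delta> * (1 * payoff \<delta> x (\<alpha> b) b) \<le> c + (\<bar>c\<bar> + M) * exp (- (\<delta> * T))"
      using c stay[OF b] by (intro payoff_le_if_running_bound[OF strategies_controls[OF \<alpha> b] b \<open>0 < \<delta>\<close> \<open>0 \<le> T\<close>]) auto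
    then show "payoff \<delta> x (\<alpha> b) b \<le> (c + e) / \<delta>" using T \<open>0 < \<delta>\<close> by (simp add: pos_le_divide_eq mult.commute)
  qed
  then show ?thesis using \<open>0 < \<delta>\<close> by (simp add: pos_le_divide_eq mult.commute)
qed

lemma value_on_dominion2:
  assumes D: "dominion2 f D" "x \<in> D" and "0 < \<epsilon>" "0 < \<delta>" "0 < e"
    and c: "\<And>u a b. infdist u D \<le> \<epsilon> \<Longrightarrow> c \<le> l (u, a, b)"
  shows "c - e \<le> \<delta> * val \<delta> x"
proof -
  obtain T where "0 \<le> T" and T: "(\<bar>- c\<bar> + M) * exp (- (\<delta> * T)) \<le> e" using horizon_exists[OF \<open>0 < \<delta>\<close> \<open>0 < e\<close>] by blast
  have "(c - e) / \<delta> \<le> val \<delta> x"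
  proof (rule val_ge[OF \<open>0 < \<delta>\<close>])
    fix \<alpha> :: "(real \<Rightarrow> 'b) \<Rightarrow> real \<Rightarrow> 'a" assume \<alpha>: "\<alpha> \<in> strategies"
    obtain b where b: "b \<in> controls" and stay: "\<And>t. t \<in> {0..T} \<Longrightarrow> infdist (straj f x \<alpha> b t) D \<le> \<epsilon>"
      using D \<open>0 < \<epsilon>\<close> \<open>0 \<le> T\<close> \<alpha> unfolding dominion2_def by meson
    have "\<delta> * ((-1) * payoff \<delta> x (\<alpha> b) b) \<le> - c + (\<bar>- c\<bar> + M) * exp (- (\<delta> * T))"
      using c stay by (intro payoff_le_if_running_bound[OF strategies_controls[OF \<alpha> b] b \<open>0 < \<delta>\<close> \<open>0 \<le> T\<close>]) auto
    then have "(c - e) / \<delta> \<le> payoff \<delta> x (\<alpha> b) b" using T \<open>0 < \<delta>\<close> by (simp add: pos_divide_le_eq mult.commute)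
    with b show "\<exists>b\<in>controls. (c - e) / \<delta> \<le> payoff \<delta> x (\<alpha> b) b" by blast
  qed
  then show ?thesis using \<open>0 < \<delta>\<close> by (simp add: pos_divide_le_eq mult.commute)
qed

lemma not_ergodic_if_separated:
  assumes D1: "dominion1 f D1" and D2: "dominion2 f D2" and "0 < \<epsilon>"
    and c1: "\<And>u a b. infdist u D1 \<le> \<epsilon> \<Longrightarrow> l (u, a, b) \<le> c1"
    and c2: "\<And>u a b. infdist u D2 \<le> \<epsilon> \<Longrightarrow> c2 \<le> l (u, a, b)" and "c1 < c2"
  shows "\<not> ergodic f l"
proof
  assume "ergodic f l"
  then obtain c where lim: "uniform_limit UNIV (\<lambda>\<delta> x. \<delta> * val \<delta> x) (\<lambda>_. c) (at_right 0)"
    unfolding ergodic_def by blast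
  obtain x1 x2 where x: "x1 \<in> D1" "x2 \<in> D2" using D1 D2 unfolding dominion1_def dominion2_def by blast
  define e where "e = (c2 - c1) / 4"
  have "0 < e" using \<open>c1 < c2\<close> by (simp add: e_def)
  have "\<forall>\<^sub>F \<delta> in at_right 0. (\<forall>x\<in>UNIV. dist (\<delta> * val \<delta> x) c < e) \<and> 0 < \<delta>"
    using uniform_limitD[OF lim \<open>0 < e\<close>] eventually_at_right_less[of 0] by (rule eventually_conj)
  then obtain \<delta> where \<delta>: "\<And>x. dist (\<delta> * val \<delta> x) c < e" and "0 < \<delta>"
    using eventually_happens trivial_limit_at_right_real by fastforce
  have "\<delta> * val \<delta> x1 \<le> c1 + e" by (rule value_on_dominion1[OF D1 x(1) \<open>0 < \<epsilon>\<close> \<open>0 < \<delta>\<close> \<open>0 < e\<close> c1])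
  moreover have "c2 - e \<le> \<delta> * val \<delta> x2" by (rule value_on_dominion2[OF D2 x(2) \<open>0 < \<epsilon>\<close> \<open>0 < \<delta>\<close> \<open>0 < e\<close> c2])
  ultimately show False using \<delta>[of x1] \<delta>[of x2] unfolding dist_real_def e_def abs_less_iff by argo
qed

section \<open>Intersecting dominions force ergodicity\<close>

text \<open>The balance of the two scales: \<open>\<epsilon> = exp (- p / \<delta>)\<close> is below the scale on which \<open>\<delta> v\<^sub>\<delta>\<close>
  varies, and \<open>\<tau> \<delta>\<close> is the time in which the closed reachable sets are explored with
  precision \<open>\<epsilon>\<close>; the loss \<open>\<delta> * \<tau> \<delta>\<close> is of order \<open>\<delta>\<close> to the power \<open>1 - \<gamma>\<close>.\<close>

lemma ergodic_if_dominions_meet: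
  assumes ute: "uniform_time_estimate f"
    and meet: "\<And>D1 D2. dominion1 f D1 \<Longrightarrow> dominion2 f D2 \<Longrightarrow> in_torus D1 \<inter> in_torus D2 \<noteq> {}"
  shows "ergodic f l"
proof (rule ergodic_if_oscillation_vanishes)
  obtain \<gamma> C where \<gamma>: "0 \<le> \<gamma>" "\<gamma> < 1" and "C > 0"
    and estimate: "\<forall>\<epsilon>. 0 < \<epsilon> \<and> \<epsilon> < 1 \<longrightarrow>
        (\<forall>\<alpha>\<in>strategies. \<forall>x. \<forall>y\<in>closure (reach1 f \<alpha> x).
           \<exists>b\<in>controls. \<exists>t. 0 \<le> t \<and> t \<le> C * (- ln \<epsilon>) powr \<gamma> \<and> norm (y - straj f x \<alpha> b t) \<le> \<epsilon>) \<and>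
        (\<forall>\<beta>\<in>nonanticipating_responses. \<forall>x. \<forall>y\<in>closure (reach2 f \<beta> x).
           \<exists>\<alpha>\<in>strategies. \<exists>t. 0 \<le> t \<and> t \<le> C * (- ln \<epsilon>) powr \<gamma> \<and>
             norm (y - straj f x \<alpha> (\<beta> \<alpha>) t) \<le> \<epsilon>)"
    using ute unfolding uniform_time_estimate_def by (elim exE conjE) (rule that; assumption)
  have ute1: "\<exists>b\<in>controls. \<exists>t. 0 \<le> t \<and> t \<le> C * (- ln \<epsilon>) powr \<gamma> \<and> norm (y - straj f x \<alpha> b t) \<le> \<epsilon>"
    if "0 < \<epsilon>" "\<epsilon> < 1" "\<alpha> \<in> strategies" "y \<in> closure (reach1 f \<alpha> x)" for \<epsilon> \<alpha> x y
    using estimate[rule_format, THEN conjunct1, rule_format, OF conjI] that by simp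
  have ute2: "\<exists>\<alpha>\<in>strategies. \<exists>t. 0 \<le> t \<and> t \<le> C * (- ln \<epsilon>) powr \<gamma> \<and> norm (y - straj f x \<alpha> (\<beta> \<alpha>) t) \<le> \<epsilon>"
    if "0 < \<epsilon>" "\<epsilon> < 1" "\<beta> \<in> nonanticipating_responses" "y \<in> closure (reach2 f \<beta> x)" for \<epsilon> \<beta> x y
    using estimate[rule_format, THEN conjunct2, rule_format, OF conjI] that by simp
  fix \<eta>' :: real assume "0 < \<eta>'"
  \<comment> \<open>in the end the oscillation is at most \<open>(5 + 5 + 2) \<eta>\<close>: two dominions, and the step between them\<close>
  define \<eta> where "\<eta> = min 1 (\<eta>' / 16)"
  have \<eta>: "0 < \<eta>" "\<eta> \<le> 1" "16 * \<eta> \<le> \<eta>'" using \<open>0 < \<eta>'\<close> by (auto simp: \<eta>_def)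
  obtain S0 where "0 \<le> S0" and S0: "2 * M * exp (- (1 * S0)) \<le> \<eta>" using horizon_exists[of 1 \<eta> "2 * M"] \<eta> by auto
  \<comment> \<open>the values from \<open>x\<close> and \<open>y\<close> are compared up to time \<open>S0 / \<delta>\<close>; the summand \<open>1\<close> leaves a factor \<open>exp (- 1 / \<delta>)\<close>\<close>
  define p where "p = 2 * L * S0 + 1"
  have "0 < p" using L_pos \<open>0 \<le> S0\<close> by (simp add: p_def add_nonneg_pos)
  define \<tau> where "\<tau> = (\<lambda>\<delta>. C * (p / \<delta>) powr \<gamma>)"
  have lim1: "((\<lambda>\<delta>. 2 * K * exp (- (1 / \<delta>))) \<longlongrightarrow> 0) (at_right 0)"
  proof (rule tendsto_sandwich[OF _ _ tendsto_const])
    show "((\<lambda>\<delta>. 2 * K * \<delta>) \<longlongrightarrow> 0) (at_right 0)"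
      using tendsto_mult_right_zero[OF tendsto_ident_at, of "2 * K" "{0<..}"] by simp
    show "\<forall>\<^sub>F \<delta> in at_right 0. 0 \<le> 2 * K * exp (- (1 / \<delta>))" using K_pos by simp
    show "\<forall>\<^sub>F \<delta> in at_right 0. 2 * K * exp (- (1 / \<delta>)) \<le> 2 * K * \<delta>"
      unfolding eventually_at_right_field
    proof (intro exI[of _ 1] conjI allI impI)
      fix \<delta> :: real assume "0 < \<delta>"
      have "1 / \<delta> \<le> exp (1 / \<delta>)" using exp_ge_add_one_self[of "1 / \<delta>"] by linarith
      then have "exp (- (1 / \<delta>)) \<le> \<delta>" using \<open>0 < \<delta>\<close> by (simp add: exp_minus field_simps)
      then show "2 * K * exp (- (1 / \<delta>)) \<le> 2 * K * \<delta>" using K_pos by simp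
    qed simp
  qed
  have lim2: "((\<lambda>\<delta>. (2 * M + 2) * (\<delta> * \<tau> \<delta>)) \<longlongrightarrow> 0) (at_right 0)"
  proof -
    have "((\<lambda>\<delta>. \<delta> powr (1 - \<gamma>)) \<longlongrightarrow> 0 powr (1 - \<gamma>)) (at_right 0)"
      using \<gamma> by (intro tendsto_powr' tendsto_ident_at tendsto_const) (auto simp: eventually_at_right_field intro: exI[of _ 1])
    then have "((\<lambda>\<delta>. (2 * M + 2) * (C * p powr \<gamma> * \<delta> powr (1 - \<gamma>))) \<longlongrightarrow> (2 * M + 2) * (C * p powr \<gamma> * 0)) (at_right 0)"
      by (intro tendsto_intros) simp
    moreover have "\<forall>\<^sub>F \<delta> in at_right 0. (2 * M + 2) * (C * p powr \<gamma> * \<delta> powr (1 - \<gamma>)) = (2 * M + 2) * (\<delta> * \<tau> \<delta>)"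
      unfolding eventually_at_right_field
    proof (intro exI[of _ 1] conjI allI impI)
      fix \<delta> :: real assume "0 < \<delta>"
      then show "(2 * M + 2) * (C * p powr \<gamma> * \<delta> powr (1 - \<gamma>)) = (2 * M + 2) * (\<delta> * \<tau> \<delta>)"
        using \<open>0 < p\<close> by (simp add: \<tau>_def powr_divide powr_diff)
    qed simp
    ultimately show ?thesis by (subst (asm) tendsto_cong) simp_all
  qed
  have "\<forall>\<^sub>F \<delta> in at_right 0. 2 * K * exp (- (1 / \<delta>)) < \<eta> \<and> (2 * M + 2) * (\<delta> * \<tau> \<delta>) < \<eta>"
    using order_tendstoD(2)[OF lim1 \<eta>(1)] order_tendstoD(2)[OF lim2 \<eta>(1)] by (rule eventually_conj)
  then obtain \<delta>0 where "0 < \<delta>0"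
    and \<delta>0: "\<And>\<delta>. 0 < \<delta> \<Longrightarrow> \<delta> < \<delta>0 \<Longrightarrow> 2 * K * exp (- (1 / \<delta>)) < \<eta> \<and> (2 * M + 2) * (\<delta> * \<tau> \<delta>) < \<eta>"
    unfolding eventually_at_right_field by auto
  show "\<exists>\<delta>0>0. \<forall>\<delta>. 0 < \<delta> \<and> \<delta> < \<delta>0 \<longrightarrow> hi \<delta> - lo \<delta> \<le> \<eta>'"
  proof (intro exI[of _ \<delta>0] conjI allI impI)
    fix \<delta> assume "0 < \<delta> \<and> \<delta> < \<delta>0"
    then have "0 < \<delta>" and Kd: "2 * K * exp (- (1 / \<delta>)) < \<eta>" and Md: "(2 * M + 2) * (\<delta> * \<tau> \<delta>) < \<eta>" using \<delta>0 by auto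
    define \<epsilon> where "\<epsilon> = exp (- (p / \<delta>))"
    have \<epsilon>: "0 < \<epsilon>" "\<epsilon> < 1" "- ln \<epsilon> = p / \<delta>" using \<open>0 < p\<close> \<open>0 < \<delta>\<close> by (simp_all add: \<epsilon>_def)
    have close: "\<bar>\<delta> * val \<delta> x - \<delta> * val \<delta> y\<bar> \<le> 2 * \<eta>" if "norm (x - y) \<le> \<epsilon>" for x y
    proof -
      have "\<bar>\<delta> * val \<delta> x - \<delta> * val \<delta> y\<bar> \<le> 2 * K * norm (x - y) * exp (2 * L * (S0 / \<delta>)) + 2 * M * exp (- (\<delta> * (S0 / \<delta>)))"
        using \<open>0 < \<delta>\<close> \<open>0 \<le> S0\<close> by (intro val_close) auto
      moreover have "2 * K * norm (x - y) * exp (2 * L * (S0 / \<delta>)) \<le> 2 * K * \<epsilon> * exp (2 * L * (S0 / \<delta>))"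
        using that K_pos by (intro mult_right_mono mult_left_mono) auto
      moreover have "\<epsilon> * exp (2 * L * (S0 / \<delta>)) = exp (- (1 / \<delta>))"
        unfolding \<epsilon>_def p_def by (simp add: add_divide_distrib flip: exp_add)
      then have "2 * K * \<epsilon> * exp (2 * L * (S0 / \<delta>)) = 2 * K * exp (- (1 / \<delta>))" by simp
      moreover have "2 * M * exp (- (\<delta> * (S0 / \<delta>))) \<le> \<eta>" using S0 \<open>0 < \<delta>\<close> by simp
      ultimately show ?thesis using Kd by linarith
    qed
    have time: "(2 * M + 2) * (\<delta> * t) \<le> \<eta>" if "t \<le> C * (- ln \<epsilon>) powr \<gamma>" for t
    proof -
      have "(2 * M + 2) * (\<delta> * t) \<le> (2 * M + 2) * (\<delta> * \<tau> \<delta>)"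
        using that M_pos \<open>0 < \<delta>\<close> unfolding \<epsilon>(3) \<tau>_def by (intro mult_left_mono) auto
      then show ?thesis using Md by simp
    qed
    obtain x1 where x1: "\<delta> * val \<delta> x1 \<le> lo \<delta> + \<eta>" using lo_near[OF \<eta>(1)] by blast
    obtain \<alpha> where \<alpha>: "\<alpha> \<in> strategies" and opt: "\<And>b. b \<in> controls \<Longrightarrow> payoff \<delta> x1 (\<alpha> b) b \<le> val \<delta> x1 + \<eta> / \<delta>"
      using near_optimal_strategy[OF \<open>0 < \<delta>\<close>, of "\<eta> / \<delta>" x1] \<eta> \<open>0 < \<delta>\<close> by auto
    have low: "\<delta> * val \<delta> y \<le> lo \<delta> + 5 * \<eta>" if yc: "y \<in> closure (reach1 f \<alpha> x1)" for y
    proof -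
      obtain b t where b: "b \<in> controls" and t: "0 \<le> t" "t \<le> C * (- ln \<epsilon>) powr \<gamma>" and yt: "norm (y - straj f x1 \<alpha> b t) \<le> \<epsilon>"
        using ute1[OF \<epsilon>(1,2) \<alpha> yc] by blast
      have "\<delta> * val \<delta> (straj f x1 \<alpha> b t) \<le> \<delta> * val \<delta> x1 + \<eta> + 2 * M * (\<delta> * t)"
        by (rule low_value_persists[OF \<alpha> \<open>0 < \<delta>\<close> opt b t(1)])
      moreover have "2 * M * (\<delta> * t) \<le> (2 * M + 2) * (\<delta> * t)" using \<open>0 < \<delta>\<close> t(1) by (intro mult_right_mono) auto
      ultimately show ?thesis using time[OF t(2)] close[OF yt] x1 unfolding abs_le_iff by linarith
    qed
    obtain x2 where x2: "hi \<delta> - \<eta> \<le> \<delta> * val \<delta> x2" using hi_near[OF \<eta>(1)] by blast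
    obtain \<beta> where \<beta>: "\<beta> \<in> nonanticipating_responses"
      and keep: "\<And>\<alpha> t. \<alpha> \<in> strategies \<Longrightarrow> 0 \<le> t \<Longrightarrow>
       \<delta> * val \<delta> x2 - \<eta> - (2 * M + 1 + \<eta>) * (\<delta> * t) \<le> \<delta> * val \<delta> (straj f x2 \<alpha> (\<beta> \<alpha>) t)"
      by (rule high_value_persists[OF \<open>0 < \<delta>\<close> \<eta>(1), of x2]) (rule that; assumption)
    have high: "hi \<delta> - 5 * \<eta> \<le> \<delta> * val \<delta> y" if yc: "y \<in> closure (reach2 f \<beta> x2)" for y
    proof -
      obtain \<alpha> t where \<alpha>: "\<alpha> \<in> strategies" and t: "0 \<le> t" "t \<le> C * (- ln \<epsilon>) powr \<gamma>"
        and yt: "norm (y - straj f x2 \<alpha> (\<beta> \<alpha>) t) \<le> \<epsilon>"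
        using ute2[OF \<epsilon>(1,2) \<beta> yc] by blast
      have "(2 * M + 1 + \<eta>) * (\<delta> * t) \<le> (2 * M + 2) * (\<delta> * t)" using \<open>0 < \<delta>\<close> t(1) \<eta>(2) by (intro mult_right_mono) auto
      then show ?thesis using keep[OF \<alpha> t(1)] time[OF t(2)] close[OF yt] x2 unfolding abs_le_iff by linarith
    qed
    obtain y1 y2 z where y1: "y1 \<in> closure (reach1 f \<alpha> x1)" and y2: "y2 \<in> closure (reach2 f \<beta> x2)"
      and z: "z \<in> int_lattice" and near: "norm (y1 - (y2 + z)) < \<epsilon>"
      using in_torus_meet_near[OF meet[OF dominion1_closure_reach1[OF \<alpha>] dominion2_closure_reach2[OF \<beta>]] \<epsilon>(1)] by blast
    have "\<bar>\<delta> * val \<delta> y1 - \<delta> * val \<delta> y2\<bar> \<le> 2 * \<eta>"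
      using close[OF less_imp_le[OF near]] val_periodic[OF z] by simp
    then show "hi \<delta> - lo \<delta> \<le> \<eta>'" using low[OF y1] high[OF y2] \<eta> unfolding abs_le_iff by linarith
  qed fact
qed

end

section \<open>The equivalence\<close>

lemma game_of_admissible_payoff:
  assumes "control_system f L F"
    and "bounded (range l)" "continuous_on UNIV l" "lipschitz_in_state l" "periodic_in_state l"
  obtains M K where "game f L F l M K"
proof -
  obtain M where M: "M > 0" "\<And>z. norm (l z) \<le> M"
    using assms(2) unfolding bounded_pos by auto
  obtain K where K: "K > 0" "\<And>a b. K-lipschitz_on UNIV (\<lambda>x. l (x, a, b))"
    using assms(4) unfolding lipschitz_in_state_def by blast
  have "game f L F l M K"
    unfolding game_def game_axioms_def
    using assms M K(1) lipschitz_onD[OF K(2)] by (auto simp: dist_norm)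
  then show thesis by (rule that)
qed

lemma admissible_payoff_perturbation:
  fixes l :: "(real^'n) \<times> 'a::metric_space \<times> 'b::metric_space \<Rightarrow> real" and g :: "real^'n \<Rightarrow> real"
  assumes cA: "compact (UNIV :: 'a set)" and cB: "compact (UNIV :: 'b set)"
    and l: "continuous_on UNIV l" "lipschitz_in_state l" "periodic_in_state l"
    and g: "\<exists>L. L-lipschitz_on UNIV g" "\<forall>x. \<forall>z\<in>int_lattice. g (x + z) = g x"
  defines "l' \<equiv> \<lambda>(x, a, b). l (x, a, b) + g x"
  shows "bounded (range l')" "continuous_on UNIV l'" "lipschitz_in_state l'" "periodic_in_state l'"
proof -
  obtain Lg where Lg: "Lg-lipschitz_on UNIV g" using g(1) by blast
  have l'_eq: "l' = (\<lambda>z. l z + g (fst z))" by (auto simp: l'_def fun_eq_iff)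
  have "continuous_on UNIV g" using lipschitz_on_continuous_on[OF Lg] .
  then have "continuous_on UNIV (\<lambda>z :: (real^'n) \<times> 'a \<times> 'b. g (fst z))"
    by (rule continuous_on_compose2) (auto intro!: continuous_intros)
  then show cont: "continuous_on UNIV l'" unfolding l'_eq by (intro continuous_intros l(1))
  show per: "periodic_in_state l'" using l(3) g(2) unfolding periodic_in_state_def l'_def by simp
  obtain B where "\<And>z. norm (l' z) \<le> B" using periodic_continuous_bounded[OF cA cB cont per] by blast
  then show "bounded (range l')" unfolding bounded_iff by auto
  obtain K where K: "K > 0" "\<And>a b. K-lipschitz_on UNIV (\<lambda>x. l (x, a, b))"
    using l(2) unfolding lipschitz_in_state_def by blast
  show "lipschitz_in_state l'" unfolding lipschitz_in_state_def l'_def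
  proof (intro exI conjI allI)
    show "K + Lg > 0" using K(1) lipschitz_on_nonneg[OF Lg] by simp
    show "(K + Lg)-lipschitz_on UNIV (\<lambda>x. case (x, a, b) of (x, a, b) \<Rightarrow> l (x, a, b) + g x)" for a b
      using lipschitz_on_add[OF K(2) Lg, of a b] by simp
  qed
qed

lemma control_system_of_standing_assumptions:
  fixes f :: "(real^'n) \<times> 'a::metric_space \<times> 'b::metric_space \<Rightarrow> real^'n"
  assumes cA: "compact (UNIV :: 'a set)" and cB: "compact (UNIV :: 'b set)"
    and cf: "continuous_on UNIV f"
    and "\<exists>L\<ge>0. \<forall>x y a b. norm (f (x, a, b) - f (y, a, b)) \<le> L * norm (x - y)"
    and pf: "periodic_in_state f"
  obtains L F where "control_system f L F"
proof -
  obtain L where "L \<ge> 0" and L: "\<And>x y a b. norm (f (x, a, b) - f (y, a, b)) \<le> L * norm (x - y)"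
    using assms(4) by blast
  obtain F where F: "F > 0" "\<And>z. norm (f z) \<le> F" using periodic_continuous_bounded[OF cA cB cf pf] by blast
  have "norm (f (x, a, b) - f (y, a, b)) \<le> (L + 1) * norm (x - y)" for x y a b
    using L[of x a b y] norm_ge_zero[of "x - y"] unfolding distrib_right mult_1 by linarith
  then have "control_system f (L + 1) F"
    unfolding control_system_def using assms F \<open>L \<ge> 0\<close> by auto
  then show thesis by (rule that)
qed

text \<open>The perturbation is \<open>k\<close> times the difference of the distances to the dominions, with \<open>k m\<close> larger
  than the bound of \<open>l\<close>.\<close>

lemma disjoint_dominions_not_ergodic:
  fixes f :: "(real^'n) \<times> 'a::metric_space \<times> 'b::metric_space \<Rightarrow> real^'n" and l :: "(real^'n) \<times> 'a \<times> 'b \<Rightarrow> real"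
  assumes cs: "control_system f L F"
    and l: "bounded (range l)" "continuous_on UNIV l" "lipschitz_in_state l" "periodic_in_state l"
    and D1: "dominion1 f D1" and D2: "dominion2 f D2" and disj: "in_torus D1 \<inter> in_torus D2 = {}"
  obtains g :: "real^'n \<Rightarrow> real" where "\<exists>L. L-lipschitz_on UNIV g" "\<forall>x. \<forall>z\<in>int_lattice. g (x + z) = g x"
    "\<not> ergodic f (\<lambda>(x, a, b). l (x, a, b) + g x)"
proof -
  have ne: "D1 \<noteq> {}" "D2 \<noteq> {}" using D1 D2 by (auto simp: dominion1_def dominion2_def)
  obtain m where "0 < m" and m: "\<And>x. m \<le> lattice_dist D1 x + lattice_dist D2 x"
    using lattice_dist_gap[OF ne disj] by blast
  obtain M where "M > 0" and M: "\<And>z. \<bar>l z\<bar> \<le> M" using l(1) unfolding bounded_pos by auto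
  define k where "k = (M + 1) / m"
  have k: "0 < k" "k * m = M + 1" using \<open>0 < m\<close> \<open>M > 0\<close> by (auto simp: k_def)
  define g where "g = (\<lambda>x. k * (lattice_dist D1 x - lattice_dist D2 x))"
  have g1: "\<exists>L. L-lipschitz_on UNIV g"
  proof (intro exI lipschitz_onI)
    fix x y :: "real^'n"
    have "\<bar>g x - g y\<bar> = k * \<bar>(lattice_dist D1 x - lattice_dist D1 y) - (lattice_dist D2 x - lattice_dist D2 y)\<bar>"
      using k(1) unfolding g_def right_diff_distrib[symmetric] abs_mult by (simp add: algebra_simps)
    also have "\<dots> \<le> k * (2 * norm (x - y))"
      using k(1) lattice_dist_lipschitz[of D1 x y] lattice_dist_lipschitz[of D2 x y] by (intro mult_left_mono) auto
    finally show "dist (g x) (g y) \<le> (2 * k) * dist x y" by (simp add: dist_real_def dist_norm)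
  qed (use k in simp)
  have g2: "\<forall>x. \<forall>z\<in>int_lattice. g (x + z) = g x" by (simp add: g_def lattice_dist_periodic)
  define l' where "l' = (\<lambda>(x, a, b). l (x, a, b) + g x)"
  have cA: "compact (UNIV :: 'a set)" and cB: "compact (UNIV :: 'b set)" using cs by (auto simp: control_system_def)
  note adm = admissible_payoff_perturbation[OF cA cB l(2-4) g1 g2, folded l'_def]
  obtain M' K' where "game f L F l' M' K'" using game_of_admissible_payoff[OF cs adm] by blast
  then interpret G: game f L F l' M' K' .
  define \<epsilon> where "\<epsilon> = 1 / (4 * k)"
  have \<epsilon>: "0 < \<epsilon>" "2 * (k * \<epsilon>) = 1 / 2" using k by (auto simp: \<epsilon>_def)
  have "\<not> ergodic f l'"
  proof (rule G.not_ergodic_if_separated[OF D1 D2 \<epsilon>(1), of "- 1 / 2" "1 / 2"])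
    fix u a b
    {
      assume "infdist u D1 \<le> \<epsilon>"
      then have "lattice_dist D1 u \<le> \<epsilon>" using lattice_dist_le_infdist[OF ne(1), of u] by linarith
      then have "lattice_dist D1 u - lattice_dist D2 u \<le> 2 * \<epsilon> - m" using m[of u] by linarith
      then have "g u \<le> k * (2 * \<epsilon> - m)" unfolding g_def using k(1) by (intro mult_left_mono) auto
      then show "l' (u, a, b) \<le> - 1 / 2" using M[of "(u, a, b)"] k(2) \<epsilon>(2) by (simp add: l'_def right_diff_distrib abs_le_iff)
    }
    {
      assume "infdist u D2 \<le> \<epsilon>"
      then have "lattice_dist D2 u \<le> \<epsilon>" using lattice_dist_le_infdist[OF ne(2), of u] by linarith
      then have "m - 2 * \<epsilon> \<le> lattice_dist D1 u - lattice_dist D2 u" using m[of u] by linarith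
      then have "k * (m - 2 * \<epsilon>) \<le> g u" unfolding g_def using k(1) by (intro mult_left_mono) auto
      then show "1 / 2 \<le> l' (u, a, b)" using M[of "(u, a, b)"] k(2) \<epsilon>(2) by (simp add: l'_def right_diff_distrib abs_le_iff)
    }
  qed simp
  then show thesis using that[OF g1 g2] by (simp add: l'_def)
qed

theorem theorem5p3:
  fixes f :: "(real^'n) \<times> 'a::metric_space \<times> 'b::metric_space \<Rightarrow> real^'n"
    and l :: "(real^'n) \<times> 'a \<times> 'b \<Rightarrow> real"
  assumes "compact (UNIV :: 'a set)" and "compact (UNIV :: 'b set)"
    and "continuous_on UNIV f"
    and "\<exists>L\<ge>0. \<forall>x y a b. norm (f (x, a, b) - f (y, a, b)) \<le> L * norm (x - y)"
    and "periodic_in_state f"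
    and "bounded (range l)" and "continuous_on UNIV l"
    and "\<exists>\<omega>. modulus_of_continuity \<omega> \<and>
           (\<forall>x y a b. \<bar>l (x, a, b) - l (y, a, b)\<bar> \<le> \<omega> (norm (x - y)))"
    and "periodic_in_state l"
    and "\<not> lipschitz_system f"
    and "uniform_time_estimate f"
    and "lipschitz_in_state l"
  shows "((\<forall>l' :: (real^'n) \<times> 'a \<times> 'b \<Rightarrow> real.
             bounded (range l') \<and> continuous_on UNIV l' \<and> lipschitz_in_state l' \<and> periodic_in_state l'
             \<longrightarrow> ergodic f l')
          \<longleftrightarrow> (\<forall>D1 D2. dominion1 f D1 \<and> dominion2 f D2 \<longrightarrow> in_torus D1 \<inter> in_torus D2 \<noteq> {}))
       \<and> ((\<forall>g :: real^'n \<Rightarrow> real.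
             (\<exists>L. L-lipschitz_on UNIV g) \<and> (\<forall>x. \<forall>z\<in>int_lattice. g (x + z) = g x)
             \<longrightarrow> ergodic f (\<lambda>(x, a, b). l (x, a, b) + g x))
          \<longleftrightarrow> (\<forall>D1 D2. dominion1 f D1 \<and> dominion2 f D2 \<longrightarrow> in_torus D1 \<inter> in_torus D2 \<noteq> {}))"
    (is "(?i \<longleftrightarrow> ?iii) \<and> (?ii \<longleftrightarrow> ?iii)")
proof -
  obtain L F where cs: "control_system f L F"
    using control_system_of_standing_assumptions[OF assms(1-5)] by blast
  have "?i \<Longrightarrow> ?ii"
  proof (intro allI impI)
    fix g :: "real^'n \<Rightarrow> real"
    assume i: ?i and "(\<exists>L. L-lipschitz_on UNIV g) \<and> (\<forall>x. \<forall>z\<in>int_lattice. g (x + z) = g x)"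
    then have g: "\<exists>L. L-lipschitz_on UNIV g" "\<forall>x. \<forall>z\<in>int_lattice. g (x + z) = g x" by auto
    from i admissible_payoff_perturbation[OF assms(1,2,7,12,9) g]
    show "ergodic f (\<lambda>(x, a, b). l (x, a, b) + g x)" by blast
  qed
  moreover have "?ii \<Longrightarrow> ?iii"
  proof (intro allI impI notI)
    fix D1 D2 assume ii: ?ii and D: "dominion1 f D1 \<and> dominion2 f D2" and disj: "in_torus D1 \<inter> in_torus D2 = {}"
    obtain g :: "real^'n \<Rightarrow> real" where "\<exists>L. L-lipschitz_on UNIV g" "\<forall>x. \<forall>z\<in>int_lattice. g (x + z) = g x"
      "\<not> ergodic f (\<lambda>(x, a, b). l (x, a, b) + g x)"
      using disjoint_dominions_not_ergodic[OF cs assms(6,7,12,9) _ _ disj] D by blast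
    with ii show False by blast
  qed
  moreover have "?iii \<Longrightarrow> ?i"
  proof (intro allI impI)
    fix l' :: "(real^'n) \<times> 'a \<times> 'b \<Rightarrow> real"
    assume iii: ?iii
      and l': "bounded (range l') \<and> continuous_on UNIV l' \<and> lipschitz_in_state l' \<and> periodic_in_state l'"
    obtain M K where "game f L F l' M K" using game_of_admissible_payoff[OF cs, of l'] l' by blast
    then show "ergodic f l'" by (rule game.ergodic_if_dominions_meet[OF _ assms(11)]) (use iii in blast)
  qed
  ultimately show ?thesis by blast
qed

end
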